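(* Let $d\geq 1$ and let $P$ be a Borel probability measure on $\mathbb{R}^d$. The equality $P=\mathcal{L}_d(F_P^{\mathrm g})$ holds in $\mathcal{S}(\mathbb{R}^d)'$ (tempered distributions), i.e. $\langle P,\psi\rangle=\langle\mathcal{L}_d(F_P^{\mathrm g}),\psi\rangle$ for every $\psi\in\mathcal{S}(\mathbb{R}^d)$. In other words, letting $Z$ be a random vector with law $P$, $$\mathbb{E}[\psi(Z)]=\int_{\mathbb{R}^d}\langle F_P^{\mathrm g}(z),(\mathcal{L}_d^*\psi)(z)\rangle\,dz\quad\text{for all }\psi\in\mathcal{S}(\mathbb{R}^d),$$ where $\mathcal{L}_d^*\psi:=-\gamma_d\,\nabla(-\Delta)^{\frac{d-1}{2}}\psi$.
   Context: Geometric cdf: for a Borel probability measure $P$ on $\mathbb{R}^d$ and $Z$ a random vector with law $P$, $F_P^{\mathrm g}:\mathbb{R}^d\to\mathbb{R}^d$ is $F_P^{\mathrm g}(x)=\mathbb{E}\big[\frac{x-Z}{\|x-Z\|}\mathbb{I}[Z\neq x]\big]$; it is bounded by $1$ in norm. In the integral, $\langle a,b\rangle=\sum_i a_ib_i$. Fourier transform: $(\mathcal{F}u)(\xi)=\int_{\mathbb{R}^d}u(x)e^{-2i\pi\langle x,\xi\rangle}dx$. For $s>0$ and $\psi\in\mathcal{S}(\mathbb{R}^d)$ (complex-valued Schwartz class), $(-\Delta)^s\psi:=(2\pi)^{2s}\mathcal{F}^{-1}(\|\xi\|^{2s}(\mathcal{F}\psi)(\xi))$ (for $s$ a nonnegative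 integer, this is $-\Delta$ iterated $s$ times). Let $\mathcal{S}_{1/2}(\mathbb{R}^d)$ be the space of $\psi\in\mathcal{C}^\infty(\mathbb{R}^d)$ with $\sup_x|(1+\|x\|^{d+1})\partial^\alpha\psi(x)|<\infty$ for all $\alpha\in\mathbb{N}^d$, with the topology given by these seminorms, and $\mathcal{S}_{1/2}(\mathbb{R}^d)'$ the space of continuous linear maps $\mathcal{S}_{1/2}(\mathbb{R}^d)\to\mathbb{C}$. This space contains $L^\infty(\mathbb{R}^d)$ and is closed under distributional differentiation, and $(-\Delta)^{1/2}$ maps $\mathcal{S}(\mathbb{R}^d)$ continuously into $\mathcal{S}_{1/2}(\mathbb{R}^d)$. For $T\in\mathcal{S}_{1/2}(\mathbb{R}^d)'$, $(-\Delta)^{1/2}T$ is the tempered distribution $\psi\mapsto\langle T,(-\Delta)^{1/2}\psi\rangle$, $\psi\in\mathcal{S}(\mathbb{R}^d)$. For $T$ a bounded measurable vector field on $\mathbb{R}^d$ (derivatives in the sense of distributions, $\nabla\cdot$ the divergence), the tempered distribution $\mathcal{L}_dT$ is $$\mathcal{L}_dT:=\gamma_d\,(-\Delta)^{\frac{d-1}{2}}(\nabla\cdot T),\qquad \gamma_d^{-1}=2^d\pi^{\frac{d-1}{2}}\Gamma\big(\tfrac{d+1}{2}\big),$$ where, for $d$ odd, $(-\Delta)^{(d-1)/2}$ is $-\Delta$ iterated $(d-1)/2$ times, and, for $d$ even, $(-\Delta)^{(d-1)/2}:=(-\Delta)^{1/2}(-\Delta)^{(d-2)/2}$ with $(-\Delta)^{(d-2)/2}$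 being $-\Delta$ iterated $(d-2)/2$ times. *)

theory Defs
  imports "HOL-Probability.Probability"
begin

definition geometric_cdf :: "(real^'n) measure \<Rightarrow> real^'n::finite \<Rightarrow> real^'n" where
  "geometric_cdf P x = (\<integral>z. of_bool (z \<noteq> x) *\<^sub>R ((x - z) /\<^sub>R norm (x - z)) \<partial>P)"

text \<open>Meant for differentiable functions;
  elsewhere \<open>frechet_derivative\<close> returns an unspecified value.\<close>

definition partial :: "'n::finite \<Rightarrow> (real^'n \<Rightarrow> complex) \<Rightarrow> real^'n \<Rightarrow> complex" where
  "partial i f x = frechet_derivative f (at x) (axis i 1)"

text \<open>For smooth \<open>f\<close>, the functions \<open>partials is f\<close> are exactly the derivatives
  \<open>\<partial>\<^sup>\<alpha> f\<close> with \<open>\<alpha>\<close> a multi-index: \<open>\<alpha>\<close> counts the occurrences of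
  each coordinate in the list.\<close>

definition partials :: "'n::finite list \<Rightarrow> (real^'n \<Rightarrow> complex) \<Rightarrow> real^'n \<Rightarrow> complex" where
  "partials is f = foldr partial is f"

definition smooth :: "(real^'n::finite \<Rightarrow> complex) \<Rightarrow> bool" where
  "smooth f \<longleftrightarrow> (\<forall>is x. partials is f differentiable (at x))"


subsection \<open>Test functions and their duals\<close>

text \<open>Both spaces of test functions consist of the smooth functions all of whose derivatives
  are bounded against each weight of a set \<open>W\<close> of weights; the seminorms below give the topology.\<close>

definition weighted_seminorm ::
    "(real^'n \<Rightarrow> real) \<Rightarrow> 'n list \<Rightarrow> (real^'n::finite \<Rightarrow> complex) \<Rightarrow> real" where
  "weighted_seminorm w is \<psi> = (SUP x. w x * norm (partials is \<psi> x))"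

definition test_space :: "(real^'n \<Rightarrow> real) set \<Rightarrow> (real^'n::finite \<Rightarrow> complex) set" where
  "test_space W = {\<psi>. smooth \<psi> \<and>
     (\<forall>w\<in>W. \<forall>is. bdd_above (range (\<lambda>x. w x * norm (partials is \<psi> x))))}"

definition test_topology :: "(real^'n \<Rightarrow> real) set \<Rightarrow> (real^'n::finite \<Rightarrow> complex) topology" where
  "test_topology W = topology_generated_by
     {{\<phi> \<in> test_space W. weighted_seminorm w is (\<lambda>x. \<phi> x - \<psi> x) < e} | w is \<psi> e.
        w \<in> W \<and> \<psi> \<in> test_space W \<and> 0 < e}"

text \<open>Functionals are extensional, so that equality of elements of a dual space is equality
  on all test functions.\<close>

definition test_dual :: "(real^'n \<Rightarrow> real) set \<Rightarrow> ((real^'n::finite \<Rightarrow> complex) \<Rightarrow> complex) set" where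
  "test_dual W = {T \<in> extensional (test_space W).
     (\<forall>\<phi>\<in>test_space W. \<forall>\<psi>\<in>test_space W. T (\<lambda>x. \<phi> x + \<psi> x) = T \<phi> + T \<psi>) \<and>
     (\<forall>c. \<forall>\<psi>\<in>test_space W. T (\<lambda>x. c * \<psi> x) = c * T \<psi>) \<and>
     continuous_map (test_topology W) euclidean T}"

definition schwartz_weights :: "(real^'n::finite \<Rightarrow> real) set" where
  "schwartz_weights = range (\<lambda>k x. 1 + norm x ^ k)"

definition half_weights :: "(real^'n::finite \<Rightarrow> real) set" where
  "half_weights = {\<lambda>x. 1 + norm x ^ (CARD('n) + 1)}"

abbreviation schwartz :: "(real^'n::finite \<Rightarrow> complex) set" where
  "schwartz \<equiv> test_space schwartz_weights"

abbreviation tempered_distributions :: "((real^'n::finite \<Rightarrow> complex) \<Rightarrow> complex) set" where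
  "tempered_distributions \<equiv> test_dual schwartz_weights"

abbreviation schwartz_half :: "(real^'n::finite \<Rightarrow> complex) set" where
  "schwartz_half \<equiv> test_space half_weights"

abbreviation schwartz_half_dual :: "((real^'n::finite \<Rightarrow> complex) \<Rightarrow> complex) set" where
  "schwartz_half_dual \<equiv> test_dual half_weights"


subsection \<open>Fourier transform and fractional Laplacian of Schwartz functions\<close>

definition fourier :: "(real^'n::finite \<Rightarrow> complex) \<Rightarrow> real^'n \<Rightarrow> complex" where
  "fourier u \<xi> = (\<integral>x. u x * exp (- 2 * \<i> * of_real pi * of_real (x \<bullet> \<xi>)) \<partial>lborel)"

definition inverse_fourier :: "(real^'n::finite \<Rightarrow> complex) \<Rightarrow> real^'n \<Rightarrow> complex" where
  "inverse_fourier v x = (\<integral>\<xi>. v \<xi> * exp (2 * \<i> * of_real pi * of_real (x \<bullet> \<xi>)) \<partial>lborel)"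

text \<open>\<open>frac_neg_laplacian s\<close> is \<open>(-\<Delta>)\<^sup>s\<close> for \<open>s \<ge> 0\<close>; the power 0 is the identity.\<close>

definition frac_neg_laplacian ::
    "real \<Rightarrow> (real^'n::finite \<Rightarrow> complex) \<Rightarrow> real^'n \<Rightarrow> complex" where
  "frac_neg_laplacian s \<psi> = (if s = 0 then \<psi> else
     (\<lambda>x. of_real ((2 * pi) powr (2 * s)) *
        inverse_fourier (\<lambda>\<xi>. of_real (norm \<xi> powr (2 * s)) * fourier \<psi> \<xi>) x))"


subsection \<open>Distributions\<close>

text \<open>The operations below act on elements of \<open>schwartz_half_dual\<close>, which contains the bounded
  measurable functions and is closed under differentiation.\<close>

definition dist_of_fun ::
    "(real^'n \<Rightarrow> real) \<Rightarrow> (real^'n::finite \<Rightarrow> complex) \<Rightarrow> complex" where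
  "dist_of_fun g = (\<lambda>\<psi>\<in>schwartz_half. \<integral>x. of_real (g x) * \<psi> x \<partial>lborel)"

definition dist_partial ::
    "'n \<Rightarrow> ((real^'n \<Rightarrow> complex) \<Rightarrow> complex) \<Rightarrow> (real^'n::finite \<Rightarrow> complex) \<Rightarrow> complex" where
  "dist_partial i T = (\<lambda>\<psi>\<in>schwartz_half. - T (partial i \<psi>))"

definition dist_neg_laplacian ::
    "((real^'n \<Rightarrow> complex) \<Rightarrow> complex) \<Rightarrow> (real^'n::finite \<Rightarrow> complex) \<Rightarrow> complex" where
  "dist_neg_laplacian T =
     (\<lambda>\<psi>\<in>schwartz_half. - (\<Sum>i\<in>UNIV. dist_partial i (dist_partial i T) \<psi>))"

definition dist_divergence ::
    "(real^'n \<Rightarrow> real^'n) \<Rightarrow> (real^'n::finite \<Rightarrow> complex) \<Rightarrow> complex" where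
  "dist_divergence T =
     (\<lambda>\<psi>\<in>schwartz_half. \<Sum>i\<in>UNIV. dist_partial i (dist_of_fun (\<lambda>x. T x $ i)) \<psi>)"

text \<open>Takes an element of \<open>schwartz_half_dual\<close> to a tempered distribution.\<close>

definition dist_sqrt_neg_laplacian ::
    "((real^'n \<Rightarrow> complex) \<Rightarrow> complex) \<Rightarrow> (real^'n::finite \<Rightarrow> complex) \<Rightarrow> complex" where
  "dist_sqrt_neg_laplacian T = (\<lambda>\<psi>\<in>schwartz. T (frac_neg_laplacian (1 / 2) \<psi>))"

definition dist_of_measure ::
    "(real^'n) measure \<Rightarrow> (real^'n::finite \<Rightarrow> complex) \<Rightarrow> complex" where
  "dist_of_measure P = (\<lambda>\<psi>\<in>schwartz. \<integral>x. \<psi> x \<partial>P)"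


subsection \<open>The operator and its adjoint\<close>

definition gamma_const :: "nat \<Rightarrow> real" where
  "gamma_const d = inverse (2 ^ d * pi powr ((real d - 1) / 2) * Gamma ((real d + 1) / 2))"

definition L_op ::
    "(real^'n \<Rightarrow> real^'n) \<Rightarrow> (real^'n::finite \<Rightarrow> complex) \<Rightarrow> complex" where
  "L_op T = (\<lambda>\<psi>\<in>schwartz. of_real (gamma_const CARD('n)) *
     (if odd CARD('n)
      then (dist_neg_laplacian ^^ ((CARD('n) - 1) div 2)) (dist_divergence T) \<psi>
      else dist_sqrt_neg_laplacian
             ((dist_neg_laplacian ^^ ((CARD('n) - 2) div 2)) (dist_divergence T)) \<psi>))"

definition L_adjoint :: "(real^'n::finite \<Rightarrow> complex) \<Rightarrow> real^'n \<Rightarrow> complex^'n" where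
  "L_adjoint \<psi> z = (\<chi> i. - of_real (gamma_const CARD('n)) *
     partial i (frac_neg_laplacian ((real CARD('n) - 1) / 2) \<psi>) z)"

end

theory Submission
  imports Defs
begin

text \<open>Write \<open>d\<close> for the dimension. By Fubini, pairing \<open>geometric_cdf P\<close> with the gradient of a test
function is an average over \<open>x\<close>, with respect to \<open>P\<close>, of pairings with the radial unit field
\<open>z \<mapsto> (z - x) / |z - x|\<close>. So everything rests on one identity about a single point
(\<open>fundamental_identity\<close>): for a Schwartz function \<open>f\<close> and \<open>g = (-\<Delta>)^((d - 1)/2) f\<close>, the
integral of \<open>\<langle>(z - x) / |z - x|, \<nabla>g(z)\<rangle>\<close> over \<open>z\<close> is \<open>- f(x) / \<gamma>\<close>, with \<open>\<gamma>\<close> the constant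
\<open>gamma_const d\<close>. In other words, the unit field is a fundamental solution.

This identity comes from Gaussian subordination,
\<open>\<surd>\<pi> / |z| = \<integral> t^(-1/2) exp(- t |z|\<^sup>2) dt\<close> over \<open>t > 0\<close>. For fixed \<open>t\<close> the field becomes a Gaussian
moment, whose Fourier transform is explicit (\<open>gaussian_moment\<close>), and \<open>\<nabla>g\<close> is an inverse Fourier
transform. The \<open>t\<close>-integral that remains on the frequency side is a Gamma integral
(\<open>heat_kernel_time_integral\<close>) proportional to \<open>|y|^(-d - 1)\<close>. It cancels the symbol \<open>|y|^(d - 1)\<close> of
\<open>(-\<Delta>)^((d - 1)/2)\<close> up to the factor \<open>(y $ j)\<^sup>2 / |y|\<^sup>2\<close> contributed by the \<open>j\<close>-th component
(\<open>radial_integral\<close>). Summing over \<open>j\<close> leaves \<open>\<integral> fourier f y * wave x y dy\<close>, and this is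
\<open>f x\<close> by Fourier inversion. The computation is the same in every dimension and avoids polar coordinates.

The second ingredient makes these integrals converge, and makes the distributional definition
meaningful, in even dimension: \<open>(-\<Delta>)^(1/2)\<close> must map Schwartz functions to functions of decay
\<open>|x|^(-d - 1)\<close>. Its symbol \<open>2 \<pi> |y|\<close> is not smooth at \<open>0\<close>, and differentiating it on the frequency side just
fails to give this rate. Instead, \<open>\<surd>\<pi> |y|\<close> is written as an average
\<open>\<integral> (|y|\<^sup>2 a(t) + b(t)) exp(- t |y|\<^sup>2) dt\<close> whose weights are integrable and bounded by \<open>t^(-3/2)\<close>
(\<open>square_root_subordination\<close>). Hence \<open>(-\<Delta>)^(1/2) f\<close> is an average of heat flows of Schwartz
functions, and integrating the tail of the heat kernel against \<open>t^(-3/2)\<close> gives exactly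
\<open>|x|^(-d - 1)\<close> (\<open>heat_average_decay\<close>, \<open>half_laplacian_decay\<close>).

Finally, the operator is defined by iterating \<open>-\<Delta>\<close> on distributions, its adjoint by a Fourier
multiplier. The two are compared on functions \<open>inverse_fourier m\<close> with \<open>m\<close> a \<open>half_symbol\<close>, on which
differentiation is multiplication of \<open>m\<close> by \<open>partial_symbol i\<close> (\<open>iterated_neg_laplacian\<close>, \<open>L_op_eq\<close>).\<close>

section \<open>Gamma integrals and subordination\<close>

lemma has_bochner_integral_gamma:
  fixes a s :: real
  assumes "0 < a" "0 < s"
  shows "has_bochner_integral lborel
    (\<lambda>t. indicator {0<..} t * (t powr (s - 1) * exp (- (a * t)))) (Gamma s * a powr (- s))"
proof -
  define f where "f = (\<lambda>t::real. indicator {0<..} t * (t powr (s - 1) * exp (- t)))"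
  have "((\<lambda>t. t powr (s - 1) / exp t) has_integral Gamma s) {0..}"
    by (rule Gamma_integral_real) fact
  hence "((\<lambda>t. if t \<in> {0..} then t powr (s - 1) / exp t else 0) has_integral Gamma s) UNIV"
    by (rule iffD2[OF has_integral_restrict_UNIV])
  moreover have "(\<lambda>t. if t \<in> {0..} then t powr (s - 1) / exp t else 0) = f"
    by (auto simp: f_def fun_eq_iff indicator_def exp_minus field_simps)
  ultimately have "(f has_integral Gamma s) UNIV"
    by simp
  moreover have f[measurable]: "f \<in> borel_measurable borel"
    unfolding f_def by measurable
  moreover have f0: "0 \<le> f t" for t
    by (simp add: f_def indicator_def)
  ultimately have "integral\<^sup>N lborel f = ennreal (Gamma s)"
    by (intro nn_integral_has_integral_lborel)
  hence "has_bochner_integral lborel f (Gamma s)"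
    using f0 assms by (intro has_bochner_integral_nn_integral) (auto simp: Gamma_real_pos less_imp_le)
  hence "has_bochner_integral lborel (\<lambda>t. f (0 + a * t)) (Gamma s /\<^sub>R \<bar>a\<bar>)"
    using assms lborel_has_bochner_integral_real_affine_iff[of a f "Gamma s" 0] by simp
  hence "has_bochner_integral lborel (\<lambda>t. a powr (1 - s) * f (0 + a * t)) (a powr (1 - s) * (Gamma s /\<^sub>R \<bar>a\<bar>))"
    by (rule has_bochner_integral_mult_right) 
  also have "(\<lambda>t. a powr (1 - s) * f (0 + a * t)) = (\<lambda>t. indicator {0<..} t * (t powr (s - 1) * exp (- (a * t))))"
  proof
    fix t
    have "a powr (1 - s) * a powr (s - 1) = 1"
      using assms by (simp flip: powr_add)
    then show "a powr (1 - s) * f (0 + a * t) = indicator {0<..} t * (t powr (s - 1) * exp (- (a * t)))"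
      using assms by (auto simp: f_def indicator_def powr_mult zero_less_mult_iff)
  qed
  also have "a powr (1 - s) * (Gamma s /\<^sub>R \<bar>a\<bar>) = Gamma s * a powr (- s)"
    using assms by (simp add: powr_diff powr_minus field_simps)
  finally show ?thesis .
qed

text \<open>The substitution \<open>t \<mapsto> 1 / t\<close> in the Gamma integral. In this form it integrates heat kernels over
their time parameter.\<close>

lemma has_bochner_integral_gamma_inverse:
  fixes a s :: real
  assumes "0 < a" "0 < s"
  shows "has_bochner_integral lborel
    (\<lambda>t. indicator {0<..} t * (t powr (- s - 1) * exp (- (a / t)))) (Gamma s * a powr (- s))"
proof -
  define f where "f = (\<lambda>t::real. t powr (s - 1) * exp (- (a * t)))"
  have g: "has_bochner_integral lborel (\<lambda>t. indicator {0<..} t * f t) (Gamma s * a powr (- s))"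
    unfolding f_def by (rule has_bochner_integral_gamma) fact+
  have G: "f absolutely_integrable_on {0<..} \<and> integral {0<..} f = Gamma s * a powr (- s)"
  proof -
    have "set_integrable lborel {0<..} f"
      using g by (auto simp: set_integrable_def has_bochner_integral_iff)
    then have "f absolutely_integrable_on {0<..}" "(LINT t:{0<..}|lborel. f t) = integral {0<..} f"
      by (auto simp: integrable_completion set_integrable_def set_borel_integral_eq_integral intro: set_borel_integral_eq_integral)
    then show ?thesis using g
      by (auto simp: set_lebesgue_integral_def has_bochner_integral_iff)
  qed
  have im: "(\<lambda>t::real. inverse t) ` {0<..} = {0<..}"
    by (auto simp: image_iff intro!: bexI[of _ "inverse _"])
  have "(\<lambda>x. \<bar>- inverse (x^2)\<bar> * f (inverse x)) absolutely_integrable_on {0<..} \<and>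
      integral {0<..} (\<lambda>x. \<bar>- inverse (x^2)\<bar> * f (inverse x)) = Gamma s * a powr (- s)"
    using G
    by (subst has_absolute_integral_change_of_variables_1'[where g=inverse])
       (auto simp: im inj_on_def power2_eq_square intro!: derivative_eq_intros)
  hence *: "((\<lambda>x. \<bar>- inverse (x^2)\<bar> * f (inverse x)) has_integral Gamma s * a powr (- s)) {0<..}"
    using absolutely_integrable_on_def integrable_integral by metis
  define h where "h = (\<lambda>t. indicator {0<..} t * (t powr (- s - 1) * exp (- (a / t))))"
  have "(\<lambda>x. if x \<in> {0<..} then \<bar>- inverse (x^2)\<bar> * f (inverse x) else 0) = h"
  proof
    fix x :: real
    have "x > 0 \<Longrightarrow> inverse (x\<^sup>2) * inverse x powr (s - 1) = x powr (- s - 1)"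
      by (simp add: powr_minus powr_diff inverse_powr power2_eq_square divide_inverse)
    then show "(if x \<in> {0<..} then \<bar>- inverse (x^2)\<bar> * f (inverse x) else 0) = h x"
      by (auto simp: f_def h_def divide_inverse)
  qed
  then have "(h has_integral Gamma s * a powr (- s)) UNIV"
    using iffD2[OF has_integral_restrict_UNIV *] by (simp only:)
  moreover have [measurable]: "h \<in> borel_measurable borel"
    unfolding h_def by measurable
  moreover have h0: "0 \<le> h t" for t
    by (simp add: h_def indicator_def)
  ultimately have "integral\<^sup>N lborel h = ennreal (Gamma s * a powr (- s))"
    by (intro nn_integral_has_integral_lborel)
  hence "has_bochner_integral lborel h (Gamma s * a powr (- s))"
    using h0 assms by (intro has_bochner_integral_nn_integral) (auto simp: Gamma_real_pos less_imp_le)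
  then show ?thesis by (simp add: h_def)
qed

text \<open>The subordination formula that replaces \<open>1 / |z|\<close> by Gaussians.\<close>

lemma has_bochner_integral_inverse_sqrt_exp:
  fixes r :: real
  assumes "0 < r"
  shows "has_bochner_integral lborel
    (\<lambda>t. indicator {0<..} t * (t powr (-1/2) * exp (- (t * r\<^sup>2)))) (sqrt pi / r)"
proof -
  have "Gamma (1/2) * (r\<^sup>2) powr (- (1/2)) = sqrt pi / r"
    using assms by (simp add: powr_minus powr_half_sqrt Gamma_one_half_real inverse_eq_divide)
  moreover have "r\<^sup>2 * t = t * r\<^sup>2" for t
    by simp
  ultimately show ?thesis
    using has_bochner_integral_gamma[of "r\<^sup>2" "1/2"] assms
    by (simp only: zero_less_power) simp
qed

text \<open>Weights that write the square root as an average of exponentials. Put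
\<open>h(t) = \<surd>t / (1 + t)\<close>. Then \<open>t^(-1/2) = lap_weight t + h(t)\<close>, and \<open>id_weight\<close> is the derivative
of \<open>h\<close>. In \<open>r = \<integral> t^(-1/2) r\<^sup>2 exp(- t r\<^sup>2) dt / \<surd>\<pi>\<close> the part with \<open>h\<close> is integrated by parts,
which trades the factor \<open>r\<^sup>2\<close> for better decay at large times. Up to constants, the remaining weights behave like
\<open>t^(-1/2)\<close> near \<open>0\<close> and like \<open>t^(-3/2)\<close> near infinity, so they are integrable at both ends.\<close>

definition lap_weight :: "real \<Rightarrow> real" where
  "lap_weight t = 1 / (sqrt t * (1 + t))"

definition id_weight :: "real \<Rightarrow> real" where
  "id_weight t = (1 - t) / (2 * sqrt t * (1 + t)\<^sup>2)"

lemma lap_weight_measurable [measurable]: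
  "lap_weight \<in> borel_measurable borel" "id_weight \<in> borel_measurable borel"
  by (auto simp: lap_weight_def[abs_def] id_weight_def[abs_def])

lemma lap_weight_nonneg: "0 < t \<Longrightarrow> 0 \<le> lap_weight t"
  by (simp add: lap_weight_def)

text \<open>The power \<open>-3/2\<close> is the one that produces the kernel \<open>|x|^(-d - 1)\<close> of the square root of the
Laplacian from heat kernels.\<close>

lemma lap_weight_le: "0 < t \<Longrightarrow> lap_weight t \<le> t powr (-3/2)"
proof -
  assume t: "0 < t"
  have "t powr (-3/2) = 1 / (sqrt t * t)"
    using powr_add[of t "1/2" 1] t by (simp add: powr_minus_divide powr_half_sqrt)
  then show ?thesis
    using t by (simp add: lap_weight_def frac_le)
qed

lemma abs_id_weight_le: "0 < t \<Longrightarrow> \<bar>id_weight t\<bar> \<le> lap_weight t"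
proof -
  assume t: "0 < t"
  have "\<bar>id_weight t\<bar> = \<bar>1 - t\<bar> / (2 * (1 + t)) * lap_weight t"
    using t by (simp add: id_weight_def lap_weight_def abs_mult power2_eq_square)
  also have "\<dots> \<le> 1 * lap_weight t"
    using t by (intro mult_right_mono) (auto simp: lap_weight_nonneg abs_if)
  finally show ?thesis by simp
qed

lemma integrable_lap_weight: "integrable lborel (\<lambda>t. indicator {0<..} t * lap_weight t)"
proof -
  have "set_integrable lborel (einterval 0 \<infinity>) lap_weight"
  proof (rule interval_integral_FTC_nonneg(1)[where F="\<lambda>t. 2 * arctan (sqrt t)" and A=0 and B=pi])
    show "DERIV (\<lambda>t. 2 * arctan (sqrt t)) x :> lap_weight x"
      if "(0::ereal) < ereal x" "ereal x < \<infinity>" for x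
    proof -
      have "x > 0" using that by simp
      then have "2 * (inverse (1 + (sqrt x)\<^sup>2) * (inverse (sqrt x) / 2)) = lap_weight x"
        by (simp add: lap_weight_def inverse_eq_divide)
      then show ?thesis
        using DERIV_cmult[OF DERIV_chain2[OF DERIV_arctan DERIV_real_sqrt[OF \<open>x > 0\<close>]], of 2] by simp
    qed
    show "isCont lap_weight x" if "(0::ereal) < ereal x" "ereal x < \<infinity>" for x
    proof -
      have "x > 0" using that by simp
      then show ?thesis unfolding lap_weight_def by (intro continuous_intros) auto
    qed
    show "AE x in lborel. (0::ereal) < ereal x \<longrightarrow> ereal x < \<infinity> \<longrightarrow> 0 \<le> lap_weight x"
      by (auto simp: lap_weight_nonneg)
    have "((\<lambda>t. 2 * arctan (sqrt t)) \<longlongrightarrow> 2 * arctan (sqrt 0)) (at_right 0)"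
      by (intro tendsto_intros)
    then show "(((\<lambda>t. 2 * arctan (sqrt t)) \<circ> real_of_ereal) \<longlongrightarrow> 0) (at_right 0)"
      by (simp add: ereal_tendsto_simps zero_ereal_def)
    have "((\<lambda>t. 2 * arctan (sqrt t)) \<longlongrightarrow> 2 * (pi / 2)) at_top"
      by (intro tendsto_intros filterlim_compose[OF tendsto_arctan_at_top] sqrt_at_top)
    then show "(((\<lambda>t. 2 * arctan (sqrt t)) \<circ> real_of_ereal) \<longlongrightarrow> pi) (at_left \<infinity>)"
      by (simp add: ereal_tendsto_simps)
  qed simp
  moreover have "einterval 0 \<infinity> = {0<..}"
    by (auto simp: einterval_def)
  ultimately show ?thesis
    by (simp add: set_integrable_def)
qed

text \<open>Both sides of \<open>r\<^sup>2 h(t) exp(- t r\<^sup>2) = h'(t) exp(- t r\<^sup>2) - (h(t) exp(- t r\<^sup>2))'\<close> are integrated; the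
boundary terms vanish because \<open>h(t) = \<surd>t / (1 + t)\<close> does at \<open>0\<close> and at infinity.\<close>

lemma square_root_subordination:
  fixes r :: real
  assumes r: "0 \<le> r"
  shows "has_bochner_integral lborel
    (\<lambda>t. indicator {0<..} t * ((r\<^sup>2 * lap_weight t + id_weight t) * exp (- (t * r\<^sup>2)))) (sqrt pi * r)"
proof -
  let ?I = "\<lambda>t::real. indicator {0<..} t :: real"
  define H where "H t = sqrt t / (1 + t) * exp (- (t * r\<^sup>2))" for t
  define f where "f t = (id_weight t - r\<^sup>2 * (sqrt t / (1 + t))) * exp (- (t * r\<^sup>2))" for t
  have A: "has_bochner_integral lborel (\<lambda>t. ?I t * (r\<^sup>2 * t powr (-1/2) * exp (- (t * r\<^sup>2)))) (sqrt pi * r)"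
  proof (cases "r = 0")
    case False
    with r have "has_bochner_integral lborel (\<lambda>t. r\<^sup>2 * (?I t * (t powr (-1/2) * exp (- (t * r\<^sup>2)))))
        (r\<^sup>2 * (sqrt pi / r))"
      by (intro has_bochner_integral_mult_right has_bochner_integral_inverse_sqrt_exp) auto
    then show ?thesis
      using False by (simp add: power2_eq_square mult_ac)
  qed (simp add: has_bochner_integral_zero)
  have split: "t powr (-1/2) = lap_weight t + sqrt t / (1 + t)" if "t > 0" for t
  proof -
    have "1 + t \<noteq> 0" "sqrt t \<noteq> 0" using that by auto
    moreover have "t powr (-1/2) = 1 / sqrt t"
      using that by (simp add: powr_minus_divide powr_half_sqrt)
    ultimately show ?thesis
      using that by (simp add: lap_weight_def divide_simps)
  qed
  have int1: "integrable lborel (\<lambda>t. ?I t * (id_weight t * exp (- (t * r\<^sup>2))))"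
  proof (rule Bochner_Integration.integrable_bound[OF integrable_lap_weight])
    show "AE t in lborel. norm (?I t * (id_weight t * exp (- (t * r\<^sup>2)))) \<le> norm (?I t * lap_weight t)"
    proof (intro always_eventually allI)
      fix t :: real
      have "t > 0 \<Longrightarrow> \<bar>id_weight t\<bar> * exp (- (t * r\<^sup>2)) \<le> lap_weight t * 1"
        by (intro mult_mono abs_id_weight_le lap_weight_nonneg) auto
      then show "norm (?I t * (id_weight t * exp (- (t * r\<^sup>2)))) \<le> norm (?I t * lap_weight t)"
        by (auto simp: indicator_def abs_mult lap_weight_nonneg)
    qed
  qed simp
  have int2: "integrable lborel (\<lambda>t. ?I t * (r\<^sup>2 * (sqrt t / (1 + t)) * exp (- (t * r\<^sup>2))))"
  proof (rule Bochner_Integration.integrable_bound[OF integrable.intros[OF A]])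
    show "AE t in lborel. norm (?I t * (r\<^sup>2 * (sqrt t / (1 + t)) * exp (- (t * r\<^sup>2))))
        \<le> norm (?I t * (r\<^sup>2 * t powr (-1/2) * exp (- (t * r\<^sup>2))))"
    proof (intro always_eventually allI)
      fix t :: real
      have "t > 0 \<Longrightarrow> r\<^sup>2 * (sqrt t / (1 + t)) * exp (- (t * r\<^sup>2)) \<le> r\<^sup>2 * t powr (-1/2) * exp (- (t * r\<^sup>2))"
        using split[of t] lap_weight_nonneg[of t] by (intro mult_right_mono mult_left_mono) auto
      then show "norm (?I t * (r\<^sup>2 * (sqrt t / (1 + t)) * exp (- (t * r\<^sup>2))))
        \<le> norm (?I t * (r\<^sup>2 * t powr (-1/2) * exp (- (t * r\<^sup>2))))"
        by (auto simp: indicator_def abs_mult)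
    qed
  qed simp
  have eq_f: "?I t * f t = ?I t * (id_weight t * exp (- (t * r\<^sup>2)))
      - ?I t * (r\<^sup>2 * (sqrt t / (1 + t)) * exp (- (t * r\<^sup>2)))" for t
    by (simp add: f_def algebra_simps)
  have int_f: "integrable lborel (\<lambda>t. ?I t * f t)"
    unfolding eq_f by (intro Bochner_Integration.integrable_diff int1 int2)
  have e: "einterval 0 \<infinity> = {0<..}"
    by (auto simp: einterval_def)
  have H0: "((\<lambda>t. sqrt t / (1 + t)) \<longlongrightarrow> 0) at_top"
  proof (rule tendsto_sandwich[OF _ _ tendsto_const tendsto_inverse_0_at_top[OF sqrt_at_top]])
    show "\<forall>\<^sub>F t in at_top. 0 \<le> sqrt t / (1 + t)"
      using eventually_gt_at_top[of 0] by eventually_elim simp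
    show "\<forall>\<^sub>F t in at_top. sqrt t / (1 + t) \<le> inverse (sqrt t)"
      using eventually_gt_at_top[of 0] by eventually_elim (simp add: divide_simps)
  qed
  \<comment> \<open>\<open>f\<close> is the derivative of \<open>H\<close>, which vanishes at both ends.\<close>
  have "(LBINT t=0..\<infinity>. f t) = 0 - 0"
  proof (rule interval_integral_FTC_integrable[where F=H])
    fix x :: real assume "(0::ereal) < ereal x" "ereal x < \<infinity>"
    hence x: "0 < x" by simp
    have D1: "DERIV (\<lambda>x. sqrt x / (1 + x)) x :> ((1 / (2 * sqrt x)) * (1 + x) - sqrt x) / (1 + x)\<^sup>2"
    proof -
      have "DERIV (\<lambda>x. 1 + x) x :> 1"
        by (auto intro!: derivative_eq_intros)
      from DERIV_divide[OF DERIV_real_sqrt[OF x] this] x show ?thesis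
        by (simp add: power2_eq_square inverse_eq_divide mult.commute[of "sqrt x" 2])
    qed
    have D2: "DERIV (\<lambda>x. exp (- (x * r\<^sup>2))) x :> - r\<^sup>2 * exp (- (x * r\<^sup>2))"
      by (auto intro!: derivative_eq_intros)
    have "DERIV H x :> ((1 / (2 * sqrt x)) * (1 + x) - sqrt x) / (1 + x)\<^sup>2 * exp (- (x * r\<^sup>2))
        - sqrt x / (1 + x) * r\<^sup>2 * exp (- (x * r\<^sup>2))"
      unfolding H_def[abs_def] using DERIV_mult[OF D1 D2] by (simp only: mult_ac diff_conv_add_uminus minus_mult_left minus_mult_right add_ac)
    moreover have "((1 / (2 * sqrt x)) * (1 + x) - sqrt x) / (1 + x)\<^sup>2 = id_weight x"
    proof -
      have "(1 / (2 * sqrt x)) * (1 + x) - sqrt x = (1 - x) / (2 * sqrt x)"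
        using x real_sqrt_mult_self[of x] by (simp add: divide_simps del: real_sqrt_mult_self)
      then show ?thesis by (simp add: id_weight_def)
    qed
    moreover have "f x = id_weight x * exp (- (x * r\<^sup>2)) - sqrt x / (1 + x) * r\<^sup>2 * exp (- (x * r\<^sup>2))"
      by (simp add: f_def left_diff_distrib)
    ultimately have "DERIV H x :> f x"
      by (simp only:)
    then show "(H has_vector_derivative f x) (at x)"
      by (simp add: has_real_derivative_iff_has_vector_derivative)
    show "isCont f x"
      using x unfolding f_def[abs_def] id_weight_def by (intro continuous_intros) auto
  next
    show "set_integrable lborel (einterval 0 \<infinity>) f"
      using int_f by (simp add: set_integrable_def e)
    have "(H \<longlongrightarrow> sqrt 0 / (1 + 0) * exp (- (0 * r\<^sup>2))) (at_right 0)"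
      unfolding H_def by (intro tendsto_intros) auto
    then show "((H \<circ> real_of_ereal) \<longlongrightarrow> 0) (at_right 0)"
      by (simp add: ereal_tendsto_simps zero_ereal_def)
    have "(H \<longlongrightarrow> 0) at_top"
    proof (rule tendsto_sandwich[OF _ _ tendsto_const H0])
      show "\<forall>\<^sub>F t in at_top. 0 \<le> H t"
        using eventually_gt_at_top[of 0] by eventually_elim (simp add: H_def)
      show "\<forall>\<^sub>F t in at_top. H t \<le> sqrt t / (1 + t)"
        using eventually_gt_at_top[of 0]
      proof eventually_elim
        case (elim t)
        show ?case unfolding H_def by (rule mult_left_le) (use elim in auto)
      qed
    qed
    then show "((H \<circ> real_of_ereal) \<longlongrightarrow> 0) (at_left \<infinity>)"
      by (simp add: ereal_tendsto_simps)
  qed simp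
  hence "(\<integral>t. ?I t * f t \<partial>lborel) = 0"
    by (simp add: interval_lebesgue_integral_def set_lebesgue_integral_def e)
  with int_f have "has_bochner_integral lborel (\<lambda>t. ?I t * f t) 0"
    by (simp add: has_bochner_integral_iff)
  from has_bochner_integral_add[OF A this]
  have "has_bochner_integral lborel
    (\<lambda>t. ?I t * (r\<^sup>2 * t powr (-1/2) * exp (- (t * r\<^sup>2))) + ?I t * f t) (sqrt pi * r)"
    by simp
  moreover have "?I t * (r\<^sup>2 * t powr (-1/2) * exp (- (t * r\<^sup>2))) + ?I t * f t =
        ?I t * ((r\<^sup>2 * lap_weight t + id_weight t) * exp (- (t * r\<^sup>2)))" for t
  proof (cases "t > 0")
    case True
    show ?thesis unfolding split[OF True] f_def by (simp add: ring_distribs)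
  qed simp
  ultimately show ?thesis
    by (simp only:)
qed

section \<open>Gaussian integrals\<close>

definition wave :: "real^'n::finite \<Rightarrow> real^'n \<Rightarrow> complex" where
  "wave x y = cis (2 * pi * (x \<bullet> y))"

text \<open>The density whose Fourier transform is \<open>exp(- t |y|\<^sup>2)\<close>. With the factor \<open>2 \<pi>\<close> in the exponent of
the transform, the heat equation that it solves runs at speed \<open>1 / (4 \<pi>\<^sup>2)\<close>.\<close>

definition heat_kernel :: "real \<Rightarrow> real^'n::finite \<Rightarrow> real" where
  "heat_kernel t y = sqrt (pi / t) ^ CARD('n) * exp (- (pi\<^sup>2 * (norm y)\<^sup>2 / t))"

text \<open>The characteristic function of the standard normal distribution, rescaled.\<close>

lemma gaussian_fourier_1d:
  assumes t: "0 < t"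
  shows "has_bochner_integral lborel
    (\<lambda>x::real. of_real (exp (- (t * x\<^sup>2))) * cis (2 * pi * (y * x)))
    (of_real (sqrt (pi / t) * exp (- (pi\<^sup>2 * y\<^sup>2 / t))))"
proof -
  \<comment> \<open>The substitution \<open>x \<mapsto> c * x\<close> turns the exponent of the normal density into \<open>- t x\<^sup>2\<close>.\<close>
  define c where "c = sqrt (2 * t)"
  have c: "c > 0" "c\<^sup>2 = 2 * t" using t by (auto simp: c_def)
  define s where "s = 2 * pi * y / c"
  let ?f = "\<lambda>x. complex_of_real (std_normal_density x) * iexp (s * x)"
  have int: "integrable lborel ?f"
    by (rule Bochner_Integration.integrable_bound[OF integrable_normal_density[of 1 0]])
       (auto simp: norm_mult)
  have "(\<integral>x. ?f x \<partial>lborel) = char std_normal_distribution s"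
    by (simp add: char_def integral_density scaleR_conv_of_real)
  also have "\<dots> = of_real (exp (- (s\<^sup>2) / 2))"
    by (simp add: char_std_normal_distribution)
  finally have "has_bochner_integral lborel ?f (of_real (exp (- (s\<^sup>2) / 2)))"
    using int by (simp add: has_bochner_integral_iff)
  hence "has_bochner_integral lborel (\<lambda>x. ?f (0 + c * x)) (of_real (exp (- (s\<^sup>2) / 2)) /\<^sub>R \<bar>c\<bar>)"
    using c by (subst (asm) lborel_has_bochner_integral_real_affine_iff[of c _ _ 0]) auto
  hence A: "has_bochner_integral lborel (\<lambda>x. of_real (sqrt (2 * pi)) * ?f (0 + c * x))
      (of_real (sqrt (2 * pi)) * (of_real (exp (- (s\<^sup>2) / 2)) /\<^sub>R \<bar>c\<bar>))"
    by (rule has_bochner_integral_mult_right)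
  have B: "of_real (sqrt (2 * pi)) * ?f (0 + c * x) = of_real (exp (- (t * x\<^sup>2))) * cis (2 * pi * (y * x))" for x
  proof -
    have "std_normal_density (c * x) = 1 / sqrt (2 * pi) * exp (- (t * x\<^sup>2))"
      using c(2) by (simp add: std_normal_density_def power_mult_distrib)
    hence "sqrt (2 * pi) * std_normal_density (c * x) = exp (- (t * x\<^sup>2))"
      by simp
    moreover have "s * (c * x) = 2 * pi * (y * x)"
      using c(1) by (simp add: s_def)
    ultimately show ?thesis
      by (metis (no_types, lifting) add_0 cis_conv_exp mult.assoc of_real_mult)
  qed
  have "sqrt (2 * pi) / c = sqrt (pi / t)"
    by (simp add: c_def real_sqrt_mult real_sqrt_divide)
  moreover have "s\<^sup>2 / 2 = pi\<^sup>2 * y\<^sup>2 / t"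
    using t by (simp add: s_def power_divide power_mult_distrib c(2))
  ultimately have C: "of_real (sqrt (2 * pi)) * (of_real (exp (- (s\<^sup>2) / 2)) /\<^sub>R \<bar>c\<bar>)
     = (of_real (sqrt (pi / t) * exp (- (pi\<^sup>2 * y\<^sup>2 / t))) :: complex)"
  proof -
    assume a: "sqrt (2 * pi) / c = sqrt (pi / t)" "s\<^sup>2 / 2 = pi\<^sup>2 * y\<^sup>2 / t"
    have e: "exp (- (s\<^sup>2) / 2) = exp (- (pi\<^sup>2 * y\<^sup>2 / t))"
      unfolding a(2)[symmetric] by simp
    have "of_real (sqrt (2 * pi)) * (of_real (exp (- (s\<^sup>2) / 2)) /\<^sub>R \<bar>c\<bar>)
      = complex_of_real (sqrt (2 * pi) / c * exp (- (s\<^sup>2) / 2))"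
      using c(1) by (simp add: scaleR_conv_of_real inverse_eq_divide)
    then show ?thesis
      unfolding a(1) e .
  qed
  show ?thesis
    using A unfolding B C .
qed

text \<open>Lebesgue measure is a product measure, so integrals of products over coordinates factor; this reduces
Gaussian integrals to one dimension.\<close>

lemma has_bochner_integral_lborel_prod:
  fixes f :: "'a::euclidean_space \<Rightarrow> real \<Rightarrow> complex"
  assumes f: "\<And>b. b \<in> Basis \<Longrightarrow> has_bochner_integral lborel (f b) (I b)"
  shows "has_bochner_integral lborel (\<lambda>x. \<Prod>b\<in>Basis. f b (x \<bullet> b)) (\<Prod>b\<in>Basis. I b)"
proof -
  interpret product_sigma_finite "\<lambda>_::'a. lborel :: real measure" ..
  have int: "\<And>b. b \<in> Basis \<Longrightarrow> integrable lborel (f b)" and I: "\<And>b. b \<in> Basis \<Longrightarrow> integral\<^sup>L lborel (f b) = I b"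
    using f by (auto simp: has_bochner_integral_iff)
  have [measurable]: "\<And>b. b \<in> Basis \<Longrightarrow> f b \<in> borel_measurable borel"
    using int by (auto dest: borel_measurable_integrable)
  let ?P = "\<Pi>\<^sub>M b\<in>(Basis::'a set). (lborel :: real measure)"
  let ?T = "\<lambda>g::'a \<Rightarrow> real. \<Sum>b\<in>Basis. g b *\<^sub>R b"
  let ?F = "\<lambda>x. \<Prod>b\<in>Basis. f b (x \<bullet> b)"
  have [measurable]: "?F \<in> borel_measurable borel" by measurable
  have T[measurable]: "?T \<in> ?P \<rightarrow>\<^sub>M borel" by measurable
  have FT: "?F (?T g) = (\<Prod>b\<in>Basis. f b (g b))" for g
    by (intro prod.cong refl) simp
  have "integrable ?P (\<lambda>g. ?F (?T g))"
    unfolding FT by (rule product_integrable_prod) (auto intro: int)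
  hence "integrable (distr ?P borel ?T) ?F"
    by (subst integrable_distr_eq) auto
  moreover have "integral\<^sup>L (distr ?P borel ?T) ?F = (\<integral>g. ?F (?T g) \<partial>?P)"
    by (rule integral_distr) auto
  moreover have "\<dots> = (\<Prod>b\<in>Basis. I b)"
    unfolding FT by (subst product_integral_prod) (auto intro: int simp: I)
  ultimately show ?thesis
    by (subst lborel_eq) (simp add: has_bochner_integral_iff)
qed

lemma gaussian_fourier:
  fixes y :: "real^'n::finite"
  assumes t: "0 < t"
  shows "has_bochner_integral lborel (\<lambda>x. of_real (exp (- (t * (norm x)\<^sup>2))) * wave y x)
    (of_real (heat_kernel t y))"
proof -
  let ?f = "\<lambda>b x. of_real (exp (- (t * x\<^sup>2))) * cis (2 * pi * ((y \<bullet> b) * x))"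
  have n2: "(norm x)\<^sup>2 = (\<Sum>b\<in>Basis. (x \<bullet> b)\<^sup>2)" for x :: "real^'n"
    by (simp only: power2_norm_eq_inner euclidean_inner[of x x]) (simp add: power2_eq_square)
  have "has_bochner_integral lborel (\<lambda>x. \<Prod>b\<in>(Basis :: (real^'n) set). ?f b (x \<bullet> b))
     (\<Prod>b\<in>(Basis :: (real^'n) set). of_real (sqrt (pi / t) * exp (- (pi\<^sup>2 * (y \<bullet> b)\<^sup>2 / t))))"
    by (rule has_bochner_integral_lborel_prod) (rule gaussian_fourier_1d[OF t])
  moreover have "(\<Prod>b\<in>(Basis :: (real^'n) set). ?f b (x \<bullet> b)) = of_real (exp (- (t * (norm x)\<^sup>2))) * wave y x" for x
  proof -
    have "(\<Prod>b\<in>(Basis :: (real^'n) set). of_real (exp (- (t * (x \<bullet> b)\<^sup>2)))) = (of_real (exp (- (t * (norm x)\<^sup>2))) :: complex)"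
      by (simp add: n2 exp_sum sum_distrib_left flip: sum_negf)
    moreover have "(\<Prod>b\<in>(Basis :: (real^'n) set). cis (2 * pi * ((y \<bullet> b) * (x \<bullet> b)))) = wave y x"
      by (simp add: wave_def cis_conv_exp euclidean_inner[of y x] sum_distrib_left flip: exp_sum)
    ultimately show ?thesis by (simp add: prod.distrib)
  qed
  moreover have "(\<Prod>b\<in>(Basis :: (real^'n) set). of_real (sqrt (pi / t) * exp (- (pi\<^sup>2 * (y \<bullet> b)\<^sup>2 / t))))
     = (of_real (heat_kernel t y) :: complex)"
  proof -
    have "(\<Prod>b\<in>(Basis :: (real^'n) set). exp (- (pi\<^sup>2 * (y \<bullet> b)\<^sup>2 / t))) = exp (- (pi\<^sup>2 * (norm y)\<^sup>2 / t))"
      by (simp add: n2 sum_distrib_left sum_divide_distrib flip: exp_sum sum_negf)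
    then show ?thesis by (simp add: heat_kernel_def prod.distrib flip: of_real_prod)
  qed
  ultimately show ?thesis by simp
qed

lemma gaussian_integral:
  assumes t: "0 < t"
  shows "has_bochner_integral lborel (\<lambda>x::real^'n::finite. exp (- (t * (norm x)\<^sup>2))) (sqrt (pi / t) ^ CARD('n))"
  using has_bochner_integral_bounded_linear[OF bounded_linear_Re gaussian_fourier[OF t, of "0::real^'n"]]
  by (simp add: wave_def heat_kernel_def)

lemma heat_kernel_nonneg: "0 < t \<Longrightarrow> 0 \<le> heat_kernel t y"
  by (simp add: heat_kernel_def)

lemma heat_kernel_measurable [measurable]: "(\<lambda>y. heat_kernel t y) \<in> borel_measurable borel"
  unfolding heat_kernel_def by measurable

text \<open>Up to normalization, the Gaussian integral with parameter \<open>\<pi>\<^sup>2 / t\<close>.\<close>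

lemma heat_kernel_integral:
  assumes t: "0 < t"
  shows "has_bochner_integral lborel (heat_kernel t :: real^'n::finite \<Rightarrow> real) 1"
proof -
  have "has_bochner_integral lborel (\<lambda>y::real^'n. sqrt (pi / t) ^ CARD('n) * exp (- (pi\<^sup>2 / t * (norm y)\<^sup>2)))
      (sqrt (pi / t) ^ CARD('n) * sqrt (pi / (pi\<^sup>2 / t)) ^ CARD('n))"
    by (intro has_bochner_integral_mult_right gaussian_integral) (use t in auto)
  moreover have "sqrt (pi / t) ^ CARD('n) * sqrt (pi / (pi\<^sup>2 / t)) ^ CARD('n) = 1"
  proof -
    have "sqrt (pi / t) * sqrt (pi / (pi\<^sup>2 / t)) = 1"
      using t by (simp add: power2_eq_square flip: real_sqrt_mult)
    then show ?thesis by (simp flip: power_mult_distrib)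
  qed
  ultimately show ?thesis by (simp add: heat_kernel_def[abs_def])
qed

lemma integral_lborel_affine:
  fixes f :: "'a::euclidean_space \<Rightarrow> 'b::{banach, second_countable_topology}"
  assumes c: "c \<noteq> 0" and f[measurable]: "f \<in> borel_measurable borel"
  shows "(\<integral>x. f x \<partial>lborel) = \<bar>c\<bar> ^ DIM('a) *\<^sub>R (\<integral>x. f (a + c *\<^sub>R x) \<partial>lborel)"
  by (subst lborel_affine[OF c, of a]) (simp add: integral_density integral_distr)

lemma integrable_lborel_affine:
  fixes f :: "'a::euclidean_space \<Rightarrow> 'b::{banach, second_countable_topology}"
  assumes c: "c \<noteq> 0" and f: "integrable lborel f"
  shows "integrable lborel (\<lambda>x. f (a + c *\<^sub>R x))"
proof -
  have [measurable]: "f \<in> borel_measurable borel"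
    using f by (auto dest: borel_measurable_integrable)
  have "integrable (density (distr lborel borel (\<lambda>x. a + c *\<^sub>R x)) (\<lambda>_. \<bar>c\<bar>^DIM('a))) f"
    using f lborel_affine[OF c, of a] by simp
  hence "integrable lborel (\<lambda>x. \<bar>c\<bar> ^ DIM('a) *\<^sub>R f (a + c *\<^sub>R x))"
    by (simp add: integrable_density integrable_distr_eq)
  hence "integrable lborel (\<lambda>x. inverse (\<bar>c\<bar> ^ DIM('a)) *\<^sub>R (\<bar>c\<bar> ^ DIM('a) *\<^sub>R f (a + c *\<^sub>R x)))"
    by (rule integrable_scaleR_right)
  moreover have "inverse (\<bar>c\<bar> ^ DIM('a)) *\<^sub>R (\<bar>c\<bar> ^ DIM('a) *\<^sub>R z) = z" for z :: 'b
    using c by simp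
  ultimately show ?thesis
    by (simp only:)
qed

text \<open>The exponent \<open>d + 1\<close> just exceeds the critical one. Subordination avoids polar coordinates:
\<open>(1 + |x|\<^sup>2)^(-s)\<close> with \<open>s = (d + 1) / 2\<close> is a Gamma integral over Gaussians in \<open>x\<close>, and integrating
these first leaves \<open>\<integral> t^(-1/2) exp(- t) dt\<close>, which is finite.\<close>

lemma integrable_inverse_power:
  "integrable lborel (\<lambda>x::real^'n::finite. 1 / (1 + norm x ^ (CARD('n) + 1)))"
proof -
  define s where "s = (real CARD('n) + 1) / 2"
  have s: "s > 0" by (simp add: s_def)
  let ?I = "\<lambda>t::real. indicator {0<..} t :: real"
  let ?g = "\<lambda>(x::real^'n) t. ?I t * (t powr (s - 1) * exp (- ((1 + (norm x)\<^sup>2) * t)))"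
  have pos: "1 + (norm x)\<^sup>2 > 0" for x :: "real^'n"
    by (simp add: add_pos_nonneg)
  have "(\<integral>\<^sup>+x. ennreal (Gamma s * (1 + (norm (x::real^'n))\<^sup>2) powr (- s)) \<partial>lborel) = (\<integral>\<^sup>+x. \<integral>\<^sup>+t. ?g x t \<partial>lborel \<partial>lborel)"
  proof (rule nn_integral_cong)
    fix x :: "real^'n"
    show "ennreal (Gamma s * (1 + (norm x)\<^sup>2) powr (- s)) = (\<integral>\<^sup>+t. ?g x t \<partial>lborel)"
      using has_bochner_integral_gamma[OF pos s, of x]
      by (subst nn_integral_eq_integral) (auto simp: has_bochner_integral_iff)
  qed
  also have "\<dots> = (\<integral>\<^sup>+t. \<integral>\<^sup>+x. ?g x t \<partial>lborel \<partial>lborel)"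
    by (rule pair_sigma_finite.Fubini'[OF pair_sigma_finite.intro[OF sigma_finite_lborel sigma_finite_lborel]]) measurable
  also have "\<dots> = (\<integral>\<^sup>+t. ennreal (sqrt pi ^ CARD('n) * (?I t * (t powr (1/2 - 1) * exp (- (1 * t))))) \<partial>lborel)"
  proof (rule nn_integral_cong)
    fix t :: real
    show "(\<integral>\<^sup>+x. ?g x t \<partial>lborel) = ennreal (sqrt pi ^ CARD('n) * (?I t * (t powr (1/2 - 1) * exp (- (1 * t)))))"
    proof (cases "t > 0")
      case True
      have "has_bochner_integral lborel (\<lambda>x::real^'n. ?I t * (t powr (s - 1) * exp (- t)) * exp (- (t * (norm x)\<^sup>2)))
         (?I t * (t powr (s - 1) * exp (- t)) * sqrt (pi / t) ^ CARD('n))"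
        by (intro has_bochner_integral_mult_right gaussian_integral True)
      moreover have "?I t * (t powr (s - 1) * exp (- t)) * exp (- (t * (norm x)\<^sup>2)) = ?g x t" for x :: "real^'n"
      proof -
        have "exp (- ((1 + (norm x)\<^sup>2) * t)) = exp (- t) * exp (- (t * (norm x)\<^sup>2))"
          by (simp add: algebra_simps flip: exp_add)
        then show ?thesis by simp
      qed
      moreover have "?I t * (t powr (s - 1) * exp (- t)) * sqrt (pi / t) ^ CARD('n)
        = sqrt pi ^ CARD('n) * (?I t * (t powr (1/2 - 1) * exp (- (1 * t))))"
      proof -
        have "t powr (s - 1) = t powr (1/2 - 1) * sqrt t ^ CARD('n)"
        proof -
          have "sqrt t ^ CARD('n) = t powr (real CARD('n) / 2)"
            using True by (simp add: powr_powr flip: powr_half_sqrt powr_realpow)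
          moreover have "s - 1 = (1/2 - 1) + real CARD('n) / 2"
            by (simp add: s_def field_simps)
          ultimately show ?thesis using True by (simp only: powr_add)
        qed
        then show ?thesis using True by (simp add: real_sqrt_divide power_divide)
      qed
      ultimately have "has_bochner_integral lborel (\<lambda>x::real^'n. ?g x t) (sqrt pi ^ CARD('n) * (?I t * (t powr (1/2 - 1) * exp (- (1 * t)))))"
        by (simp only:)
      then show ?thesis
        by (subst nn_integral_eq_integral) (auto simp: has_bochner_integral_iff)
    qed simp
  qed
  also have "\<dots> < \<infinity>"
  proof -
    have "has_bochner_integral lborel (\<lambda>t. sqrt pi ^ CARD('n) * (?I t * (t powr (1/2 - 1) * exp (- (1 * t)))))
       (sqrt pi ^ CARD('n) * (Gamma (1/2) * 1 powr (- (1/2))))"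
      by (intro has_bochner_integral_mult_right has_bochner_integral_gamma) auto
    then show ?thesis
      by (subst nn_integral_eq_integral) (auto simp: has_bochner_integral_iff)
  qed
  finally have "integrable lborel (\<lambda>x::real^'n. Gamma s * (1 + (norm x)\<^sup>2) powr (- s))"
    using s by (intro integrableI_nonneg) (auto simp: Gamma_real_pos less_imp_le)
  hence "integrable lborel (\<lambda>x::real^'n. 2 powr s / Gamma s * (Gamma s * (1 + (norm x)\<^sup>2) powr (- s)))"
    by (rule integrable_mult_right)
  hence int: "integrable lborel (\<lambda>x::real^'n. 2 powr s * (1 + (norm x)\<^sup>2) powr (- s))"
    using Gamma_real_pos[OF s] by (simp add: mult.assoc)
  show ?thesis
  proof (rule Bochner_Integration.integrable_bound[OF int], measurable, intro always_eventually allI)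
    fix x :: "real^'n"
    let ?r = "norm x"
    have "(1 + ?r\<^sup>2) powr s \<le> (2 * (max 1 ?r)\<^sup>2) powr s"
    proof (rule powr_mono2)
      have "1 \<le> (max 1 ?r)\<^sup>2" "?r\<^sup>2 \<le> (max 1 ?r)\<^sup>2"
        by (auto intro!: power_mono one_le_power)
      then show "1 + ?r\<^sup>2 \<le> 2 * (max 1 ?r)\<^sup>2" by linarith
    qed (use s pos[of x] in auto)
    also have "\<dots> = 2 powr s * (max 1 ?r) ^ (CARD('n) + 1)"
    proof -
      have "((max 1 ?r)\<^sup>2) powr s = max 1 ?r powr (2 * s)"
        by (simp add: powr_powr flip: powr_numeral)
      also have "2 * s = real (CARD('n) + 1)"
        by (simp add: s_def)
      also have "max 1 ?r powr real (CARD('n) + 1) = (max 1 ?r) ^ (CARD('n) + 1)"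
        by (rule powr_realpow) simp
      finally show ?thesis by (simp add: powr_mult)
    qed
    also have "\<dots> \<le> 2 powr s * (1 + ?r ^ (CARD('n) + 1))"
      by (intro mult_left_mono) (auto simp: max_def)
    finally have le: "(1 + ?r\<^sup>2) powr s \<le> 2 powr s * (1 + ?r ^ (CARD('n) + 1))" .
    have p1: "(1 + ?r\<^sup>2) powr s > 0" using pos[of x] by (simp add: less_imp_neq[THEN not_sym])
    have p2: "1 + ?r ^ (CARD('n) + 1) > 0" by (intro add_pos_nonneg) auto
    have "1 / (1 + ?r ^ (CARD('n) + 1)) \<le> 2 powr s / (1 + ?r\<^sup>2) powr s"
      using le by (simp only: divide_le_eq p2 if_True pos_le_divide_eq[OF p1] times_divide_eq_left mult_1_left)
    then show "norm (1 / (1 + ?r ^ (CARD('n) + 1))) \<le> norm (2 powr s * (1 + ?r\<^sup>2) powr (- s))"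
      using pos[of x] by (simp add: powr_minus inverse_eq_divide abs_mult add_pos_nonneg)
  qed
qed

section \<open>Plane waves and inverse Fourier transforms\<close>

lemma wave_eq_exp: "wave x y = exp (2 * \<i> * of_real pi * of_real (x \<bullet> y))"
  by (simp add: wave_def cis_conv_exp mult_ac)

lemma norm_wave [simp]: "norm (wave x y) = 1"
  by (simp add: wave_def)

lemma wave_add: "wave (x + y) z = wave x z * wave y z"
  by (simp add: wave_def inner_add_left ring_distribs cis_mult)

lemma wave_commute: "wave x y = wave y x"
  by (simp add: wave_def inner_commute)

lemma wave_uminus: "wave (- x) y = wave x (- y)"
  by (simp add: wave_def)

lemma vec_nth_measurable [measurable (raw)]:
  fixes f :: "'a \<Rightarrow> real^'n::finite"
  assumes "f \<in> borel_measurable M"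
  shows "(\<lambda>x. f x $ i) \<in> borel_measurable M"
  by (rule measurable_compose[OF assms]) (intro borel_measurable_continuous_onI continuous_intros)

lemma wave_measurable [measurable (raw)]:
  assumes "f \<in> borel_measurable M" "g \<in> borel_measurable M"
  shows "(\<lambda>x. wave (f x) (g x)) \<in> borel_measurable M"
  unfolding wave_def cis_conv_exp using assms by measurable

lemma inverse_fourier_wave: "inverse_fourier m x = (\<integral>y. m y * wave x y \<partial>lborel)"
  by (simp add: inverse_fourier_def wave_eq_exp)

lemma fourier_eq: "fourier u y = (\<integral>x. u x * wave x (- y) \<partial>lborel)"
  by (simp add: fourier_def wave_eq_exp)

text \<open>Integrability against all powers of \<open>|y|\<close> is what makes the inverse Fourier transform smooth. Unlike
Schwartz functions, such symbols may be singular at the origin, as \<open>|y|\<close> times a Schwartz function is.\<close>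

definition all_moments :: "(real^'n::finite \<Rightarrow> complex) \<Rightarrow> bool" where
  "all_moments m \<longleftrightarrow> m \<in> borel_measurable borel \<and> (\<forall>k. integrable lborel (\<lambda>y. norm y ^ k * norm (m y)))"

lemma all_moments_measurable: "all_moments m \<Longrightarrow> m \<in> borel_measurable borel"
  by (simp add: all_moments_def)

lemma all_moments_moment: "all_moments m \<Longrightarrow> integrable lborel (\<lambda>y. norm y ^ k * norm (m y))"
  by (simp add: all_moments_def)

lemma all_moments_integrable: "all_moments m \<Longrightarrow> integrable lborel m"
  using all_moments_moment[of m 0] all_moments_measurable[of m] by (simp add: integrable_norm_iff)

lemma all_moments_integrable_mult:
  assumes m: "all_moments m" and k[measurable]: "k \<in> borel_measurable borel" and b: "\<And>y. norm (k y) \<le> C * norm y ^ n"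
  shows "integrable lborel (\<lambda>y. k y * m y)"
proof (rule Bochner_Integration.integrable_bound[OF integrable_mult_right[OF all_moments_moment[OF m, of n], of C]])
  note all_moments_measurable[OF m, measurable]
  show "(\<lambda>y. k y * m y) \<in> borel_measurable lborel" by measurable
  show "AE y in lborel. norm (k y * m y) \<le> norm (C * (norm y ^ n * norm (m y)))"
  proof (intro always_eventually allI)
    fix y
    have "norm (k y) * norm (m y) \<le> (C * norm y ^ n) * norm (m y)"
      using b[of y] by (intro mult_right_mono) auto
    then show "norm (k y * m y) \<le> norm (C * (norm y ^ n * norm (m y)))"
      by (simp add: norm_mult mult.assoc)
  qed
qed

lemma all_moments_mult:
  assumes m: "all_moments m" and k[measurable]: "k \<in> borel_measurable borel" and b: "\<And>y. norm (k y) \<le> C * norm y ^ n"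
  shows "all_moments (\<lambda>y. k y * m y)"
  unfolding all_moments_def
proof safe
  note all_moments_measurable[OF m, measurable]
  show "(\<lambda>y. k y * m y) \<in> borel_measurable borel" by measurable
  fix j
  have "integrable lborel (\<lambda>y. norm ((of_real (norm y ^ j) * k y) * m y))"
  proof (rule integrable_norm, rule all_moments_integrable_mult[OF m])
    show "norm (of_real (norm y ^ j) * k y) \<le> C * norm y ^ (j + n)" for y
      using mult_left_mono[OF b[of y], of "norm y ^ j"] by (simp add: norm_mult norm_power power_add mult_ac)
  qed measurable
  then show "integrable lborel (\<lambda>y. norm y ^ j * norm (k y * m y))"
    by (simp add: norm_mult norm_power mult_ac)
qed

lemma inverse_fourier_integrable: "integrable lborel m \<Longrightarrow> integrable lborel (\<lambda>y. m y * wave x y)"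
  by (rule Bochner_Integration.integrable_bound[of lborel "\<lambda>y. m y"])
     (auto simp: norm_mult dest: borel_measurable_integrable)

lemma inverse_fourier_sum:
  assumes "\<And>i. i \<in> I \<Longrightarrow> integrable lborel (m i)"
  shows "inverse_fourier (\<lambda>y. \<Sum>i\<in>I. m i y) x = (\<Sum>i\<in>I. inverse_fourier (m i) x)"
  using assms by (simp add: inverse_fourier_wave sum_distrib_right inverse_fourier_integrable)

lemma inverse_fourier_cmult: "inverse_fourier (\<lambda>y. c * m y) x = c * inverse_fourier m x"
  by (simp add: inverse_fourier_wave mult.assoc)

definition partial_symbol :: "'n \<Rightarrow> real^'n::finite \<Rightarrow> complex" where
  "partial_symbol i y = 2 * of_real pi * \<i> * of_real (y $ i)"

lemma partial_symbol_measurable [measurable]: "partial_symbol i \<in> borel_measurable borel"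
  unfolding partial_symbol_def[abs_def] by measurable

lemma norm_partial_symbol_le: "norm (partial_symbol i y) \<le> (2 * pi) * norm y ^ 1"
  by (simp add: partial_symbol_def norm_mult component_le_norm_cart)

lemma all_moments_partial_symbol: "all_moments m \<Longrightarrow> all_moments (\<lambda>y. partial_symbol i y * m y)"
  by (rule all_moments_mult[OF _ _ norm_partial_symbol_le]) auto

lemma partial_eqI: "(f has_derivative D) (at x) \<Longrightarrow> partial i f x = D (axis i 1)"
  by (metis frechet_derivative_at partial_def)

text \<open>Differentiation under the integral. The remainder is quadratic in \<open>h\<close> because
\<open>|exp(i s) - 1 - i s| \<le> s\<^sup>2 / 2\<close>, and the second moment of \<open>m\<close> is finite.\<close>

lemma inverse_fourier_has_derivative:
  assumes m: "all_moments m"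
  shows "(inverse_fourier m has_derivative (\<lambda>h. \<integral>y. (\<i> * of_real (2 * pi * (h \<bullet> y))) * m y * wave x y \<partial>lborel)) (at x)"
proof -
  note all_moments_measurable[OF m, measurable]
  let ?k = "\<lambda>h y. \<i> * of_real (2 * pi * (h \<bullet> y))"
  define D where "D h = (\<integral>y. ?k h y * m y * wave x y \<partial>lborel)" for h
  have kb: "norm (?k h y) \<le> (2 * pi * norm h) * norm y ^ 1" for h y
    using Cauchy_Schwarz_ineq2[of h y] by (simp add: norm_mult abs_mult mult.assoc)
  have intk: "integrable lborel (\<lambda>y. ?k h y * m y)" for h
    by (rule all_moments_integrable_mult[OF m _ kb]) measurable
  note ik = inverse_fourier_integrable[OF intk, of _ x]
  have "bounded_linear D"
  proof (rule bounded_linear_intro[where K="2 * pi * (\<integral>y. norm y * norm (m y) \<partial>lborel)"])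
    fix h h' :: "real^'a" and r :: real
    have "?k (h + h') y * m y * wave x y = ?k h y * m y * wave x y + ?k h' y * m y * wave x y" for y
      by (simp add: inner_add_left ring_distribs)
    then show "D (h + h') = D h + D h'"
      unfolding D_def using ik by simp
    have "?k (r *\<^sub>R h) y * m y * wave x y = r *\<^sub>R (?k h y * m y * wave x y)" for y
      by (simp add: scaleR_conv_of_real[where 'a=complex] mult_ac)
    then show "D (r *\<^sub>R h) = r *\<^sub>R D h"
      unfolding D_def by simp
    have "norm (D h) \<le> (\<integral>y. norm (?k h y * m y * wave x y) \<partial>lborel)"
      unfolding D_def by (rule integral_norm_bound)
    also have "\<dots> \<le> (\<integral>y. (2 * pi * norm h) * (norm y ^ 1 * norm (m y)) \<partial>lborel)"
    proof (rule integral_mono)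
      show "integrable lborel (\<lambda>y. norm (?k h y * m y * wave x y))"
        by (rule integrable_norm[OF ik])
      show "integrable lborel (\<lambda>y. (2 * pi * norm h) * (norm y ^ 1 * norm (m y)))"
        by (rule integrable_mult_right[OF all_moments_moment[OF m]])
      show "norm (?k h y * m y * wave x y) \<le> (2 * pi * norm h) * (norm y ^ 1 * norm (m y))" for y
        using mult_right_mono[OF kb[of h y], of "norm (m y)"] by (simp only: norm_mult norm_wave mult_1_right mult.assoc norm_ge_zero)
    qed
    finally have "norm (D h) \<le> (2 * pi * norm h) * (\<integral>y. norm y * norm (m y) \<partial>lborel)"
      unfolding integral_mult_right_zero power_one_right .
    then show "norm (D h) \<le> norm h * (2 * pi * (\<integral>y. norm y * norm (m y) \<partial>lborel))"
      by (simp only: mult_ac)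
  qed
  moreover define C where "C = (\<integral>y. 2 * pi\<^sup>2 * (norm y ^ 2 * norm (m y)) \<partial>lborel)"
  have rem: "norm (inverse_fourier m (x + h) - inverse_fourier m x - D h) \<le> C * (norm h)\<^sup>2" for h
  proof -
    have im: "integrable lborel (\<lambda>y. m y * wave z y)" for z
      by (rule inverse_fourier_integrable[OF all_moments_integrable[OF m]])
    have eq: "inverse_fourier m (x + h) - inverse_fourier m x - D h = (\<integral>y. m y * wave (x + h) y - m y * wave x y - ?k h y * m y * wave x y \<partial>lborel)"
      unfolding inverse_fourier_wave D_def using im ik by simp
    have "norm (inverse_fourier m (x + h) - inverse_fourier m x - D h)
        \<le> (\<integral>y. norm (m y * wave (x + h) y - m y * wave x y - ?k h y * m y * wave x y) \<partial>lborel)"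
      unfolding eq by (rule integral_norm_bound)
    also have "\<dots> \<le> (\<integral>y. (norm h)\<^sup>2 * (2 * pi\<^sup>2 * (norm y ^ 2 * norm (m y))) \<partial>lborel)"
    proof (rule integral_mono)
      show "integrable lborel (\<lambda>y. norm (m y * wave (x + h) y - m y * wave x y - ?k h y * m y * wave x y))"
        by (rule integrable_norm, rule Bochner_Integration.integrable_diff, rule Bochner_Integration.integrable_diff, rule im, rule im, rule ik)
      show "integrable lborel (\<lambda>y. (norm h)\<^sup>2 * (2 * pi\<^sup>2 * (norm y ^ 2 * norm (m y))))"
        by (rule integrable_mult_right, rule integrable_mult_right, rule all_moments_moment, rule m)
      fix y
      have "m y * wave (x + h) y - m y * wave x y - ?k h y * m y * wave x y
         = m y * wave x y * (wave h y - 1 - ?k h y)"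
        by (simp only: wave_add right_diff_distrib mult_ac mult_1_right mult_1_left)
      hence eq: "norm (m y * wave (x + h) y - m y * wave x y - ?k h y * m y * wave x y)
         = norm (m y) * norm (wave h y - 1 - ?k h y)"
        by (simp only: norm_mult norm_wave mult_1_right)
      have "norm (wave h y - 1 - ?k h y) \<le> \<bar>2 * pi * (h \<bullet> y)\<bar>\<^sup>2 / 2"
        using iexp_approx1[of "2 * pi * (h \<bullet> y)" 1] by (simp add: wave_def cis_conv_exp diff_diff_eq numeral_2_eq_2)
      also have "\<dots> \<le> (2 * pi * (norm h * norm y))\<^sup>2 / 2"
        using Cauchy_Schwarz_ineq2[of h y] by (intro divide_right_mono power_mono) (auto simp: abs_mult)
      also have "\<dots> = (norm h)\<^sup>2 * (2 * pi\<^sup>2 * (norm y ^ 2))"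
        by (simp add: power_mult_distrib)
      finally have "norm (m y) * norm (wave h y - 1 - ?k h y) \<le> norm (m y) * ((norm h)\<^sup>2 * (2 * pi\<^sup>2 * (norm y ^ 2)))"
        by (rule mult_left_mono) simp
      then show "norm (m y * wave (x + h) y - m y * wave x y - ?k h y * m y * wave x y)
          \<le> (norm h)\<^sup>2 * (2 * pi\<^sup>2 * (norm y ^ 2 * norm (m y)))"
        unfolding eq by (simp only: mult_ac)
    qed
    also have "\<dots> = C * (norm h)\<^sup>2"
      by (simp add: C_def)
    finally show ?thesis .
  qed
  have "(inverse_fourier m has_derivative D) (at x)"
  proof (rule has_derivativeI_sandwich[of 1])
    show "bounded_linear D" by fact
    fix z assume "z \<noteq> x"
    then have nz: "norm (z - x) > 0" by simp
    have "norm (inverse_fourier m z - inverse_fourier m x - D (z - x)) / norm (z - x) \<le> C * (norm (z - x))\<^sup>2 / norm (z - x)"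
      using rem[of "z - x"] by (intro divide_right_mono) auto
    then show "norm (inverse_fourier m z - inverse_fourier m x - D (z - x)) / norm (z - x) \<le> C * norm (z - x)"
      using nz by (simp add: power2_eq_square)
  next
    have "((\<lambda>z. C * norm (z - x)) \<longlongrightarrow> C * norm (x - x)) (at x)"
      by (intro tendsto_intros)
    then show "((\<lambda>z. C * norm (z - x)) \<longlongrightarrow> 0) (at x)" by simp
  qed simp
  then show ?thesis unfolding D_def .
qed

lemma partial_inverse_fourier:
  assumes m: "all_moments m"
  shows "partial i (inverse_fourier m) = inverse_fourier (\<lambda>y. partial_symbol i y * m y)"
proof
  fix x
  show "partial i (inverse_fourier m) x = inverse_fourier (\<lambda>y. partial_symbol i y * m y) x"
    by (subst partial_eqI[OF inverse_fourier_has_derivative[OF m]]) (simp add: inverse_fourier_wave partial_symbol_def inner_axis' mult_ac)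
qed

lemma partials_Nil [simp]: "partials [] f = f"
  by (simp add: partials_def)

lemma partials_Cons [simp]: "partials (i # is) f = partial i (partials is f)"
  by (simp add: partials_def)

lemma partials_partial: "partials is (partial i f) = partials (is @ [i]) f"
  by (simp add: partials_def)

text \<open>Both conclusions are needed together in the induction: the next derivative requires that the symbol
obtained so far has all its moments.\<close>

lemma partials_inverse_fourier:
  assumes m: "all_moments m"
  shows "all_moments (\<lambda>y. prod_list (map (\<lambda>i. partial_symbol i y) is) * m y) \<and>
     partials is (inverse_fourier m) = inverse_fourier (\<lambda>y. prod_list (map (\<lambda>i. partial_symbol i y) is) * m y)"
proof (induction "is")
  case (Cons i "is")
  then show ?case
    using all_moments_partial_symbol[of "\<lambda>y. prod_list (map (\<lambda>i. partial_symbol i y) is) * m y" i] by (simp add: partial_inverse_fourier mult.assoc)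
qed (simp add: m)

lemma smooth_inverse_fourier:
  assumes m: "all_moments m"
  shows "smooth (inverse_fourier m)"
  unfolding smooth_def
proof safe
  fix "is" :: "'a list" and x :: "real^'a"
  show "partials is (inverse_fourier m) differentiable at x"
    unfolding conjunct2[OF partials_inverse_fourier[OF m]]
    by (rule differentiableI[OF inverse_fourier_has_derivative[OF conjunct1[OF partials_inverse_fourier[OF m]]]])
qed

section \<open>Test functions\<close>

lemma smooth_partial: "smooth f \<Longrightarrow> smooth (partial i f)"
  by (simp add: smooth_def partials_partial)

lemma test_space_partial: "f \<in> test_space W \<Longrightarrow> partial i f \<in> test_space W"
  by (simp add: test_space_def partials_partial smooth_partial)

lemma test_space_partials: "f \<in> test_space W \<Longrightarrow> partials is f \<in> test_space W"
  by (induction "is") (auto simp: test_space_partial)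

lemma test_space_differentiable: "f \<in> test_space W \<Longrightarrow> f differentiable (at x)"
  unfolding test_space_def smooth_def by (metis (mono_tags, lifting) mem_Collect_eq partials_Nil)

lemma test_space_continuous: "f \<in> test_space W \<Longrightarrow> continuous_on UNIV f"
  by (simp add: continuous_at_imp_continuous_on differentiable_imp_continuous_within test_space_differentiable)

lemma test_space_measurable: "f \<in> test_space W \<Longrightarrow> f \<in> borel_measurable borel"
  by (intro borel_measurable_continuous_onI test_space_continuous)

lemma test_space_bound:
  assumes "f \<in> test_space W" "w \<in> W"
  obtains C where "\<And>x. w x * norm (f x) \<le> C"
proof -
  have "bdd_above (range (\<lambda>x. w x * norm (partials [] f x)))"
    using assms by (auto simp: test_space_def simp del: partials_Nil)
  then show ?thesis using that by (auto simp: bdd_above_def)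
qed

lemma schwartz_bound:
  assumes "f \<in> schwartz"
  obtains C where "C \<ge> 0" "\<And>x. norm x ^ k * norm (f x) \<le> C"
proof -
  obtain C where C: "\<And>x. (1 + norm x ^ k) * norm (f x) \<le> C"
    using test_space_bound[OF assms, of "\<lambda>x. 1 + norm x ^ k"] unfolding schwartz_weights_def by blast
  have "norm x ^ k * norm (f x) \<le> C" for x
  proof -
    have "norm x ^ k * norm (f x) \<le> (1 + norm x ^ k) * norm (f x)"
      by (intro mult_right_mono) auto
    then show ?thesis using C[of x] by linarith
  qed
  moreover have "C \<ge> 0" using calculation[of 0] by (meson mult_nonneg_nonneg norm_ge_zero order_trans zero_le_power)
  ultimately show ?thesis using that by blast
qed

text \<open>The reciprocal of the single weight that defines \<open>schwartz_half\<close>.\<close>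

definition decay_weight :: "real^'n::finite \<Rightarrow> real" where
  "decay_weight x = 1 / (1 + norm x ^ (CARD('n) + 1))"

lemma decay_weight_pos: "decay_weight x > 0"
  by (simp add: decay_weight_def add_pos_nonneg)

lemma integrable_decay_weight: "integrable lborel decay_weight"
  unfolding decay_weight_def[abs_def] by (rule integrable_inverse_power)

lemma decay_weight_boundI:
  fixes x :: "real^'n::finite"
  assumes "a \<le> C" "norm x ^ (CARD('n) + 1) * a \<le> C'"
  shows "a \<le> (C + C') * decay_weight x"
proof -
  have "a * (1 + norm x ^ (CARD('n) + 1)) \<le> C + C'"
    using assms by (simp add: algebra_simps)
  then show ?thesis
    by (simp add: decay_weight_def pos_le_divide_eq add_pos_nonneg)
qed

lemma schwartz_half_iff:
  "f \<in> schwartz_half \<longleftrightarrow> smooth f \<and> (\<forall>is. \<exists>C. \<forall>x. norm (partials is f x) \<le> C * decay_weight x)"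
proof -
  have "bdd_above (range (\<lambda>x. (1 + norm x ^ (CARD('a) + 1)) * norm (partials is f x))) \<longleftrightarrow>
    (\<exists>C. \<forall>x. norm (partials is f x) \<le> C * decay_weight x)" for "is"
    by (auto simp: bdd_above_def decay_weight_def pos_le_divide_eq add_pos_nonneg mult_ac)
  then show ?thesis
    by (simp add: test_space_def half_weights_def)
qed

lemma schwartz_half_bound:
  assumes "f \<in> schwartz_half"
  obtains C where "C \<ge> 0" "\<And>x. norm (f x) \<le> C * decay_weight x"
proof -
  obtain C where C: "\<And>x. norm (f x) \<le> C * decay_weight x"
    using assms unfolding schwartz_half_iff by (metis partials_Nil)
  have "0 \<le> C * decay_weight (0::real^'a)"
    using C[of 0] norm_ge_zero order_trans by blast
  then have "0 \<le> C" using decay_weight_pos[of "0::real^'a"] by (simp add: zero_le_mult_iff)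
  with C that show ?thesis by blast
qed

lemma integrable_decay_weight_bound:
  fixes f :: "real^'n::finite \<Rightarrow> 'b::{banach, second_countable_topology}"
  assumes [measurable]: "f \<in> borel_measurable borel" and "\<And>x. norm (f x) \<le> C * decay_weight x"
  shows "integrable lborel f"
proof (rule Bochner_Integration.integrable_bound[OF integrable_mult_right[OF integrable_decay_weight, of C]])
  show "AE x in lborel. norm (f x) \<le> norm (C * decay_weight x)"
  proof (intro always_eventually allI)
    fix x show "norm (f x) \<le> norm (C * decay_weight x)"
      using assms(2)[of x] abs_ge_self[of "C * decay_weight x"] by (simp del: abs_mult abs_ge_self)
  qed
qed simp

lemma schwartz_half_integrable: "f \<in> schwartz_half \<Longrightarrow> integrable lborel f"
  by (rule schwartz_half_bound[of f], assumption, rule integrable_decay_weight_bound[OF test_space_measurable])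

lemma schwartz_subset_half: "schwartz \<subseteq> schwartz_half"
  by (auto simp: test_space_def half_weights_def schwartz_weights_def simp del: power_Suc)

lemma all_momentsI:
  fixes f :: "real^'n::finite \<Rightarrow> complex"
  assumes m[measurable]: "f \<in> borel_measurable borel"
    and b: "\<And>k. \<exists>C. \<forall>x. norm x ^ k * norm (f x) \<le> C"
  shows "all_moments f"
  unfolding all_moments_def
proof safe
  fix k
  obtain C where C: "\<And>x. norm x ^ k * norm (f x) \<le> C" using b by blast
  obtain C' where C': "\<And>x. norm x ^ (CARD('n) + 1 + k) * norm (f x) \<le> C'" using b by blast
  show "integrable lborel (\<lambda>y. norm y ^ k * norm (f y))"
  proof (rule integrable_decay_weight_bound)
    show "norm (norm x ^ k * norm (f x)) \<le> (C + C') * decay_weight x" for x :: "real^'n"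
    proof -
      have "norm x ^ (CARD('n) + 1) * (norm x ^ k * norm (f x)) \<le> C'"
        using C'[of x] by (simp only: power_add mult.assoc)
      from decay_weight_boundI[OF C[of x] this] show ?thesis by simp
    qed
  qed measurable
qed (rule m)

lemma schwartz_all_moments:
  assumes "f \<in> schwartz"
  shows "all_moments f"
proof (rule all_momentsI[OF test_space_measurable[OF assms]])
  show "\<exists>C. \<forall>x. norm x ^ k * norm (f x) \<le> C" for k
    by (rule schwartz_bound[OF assms, of k]) blast
qed

section \<open>The Fourier transform of a Schwartz function\<close>

text \<open>Unit shifts distort the weight by a bounded factor, so that decay of a derivative carries over
to difference quotients with steps of length at most \<open>1\<close>.\<close>

lemma decay_weight_shift:
  fixes x v :: "real^'n::finite"
  assumes "norm v \<le> 1"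
  shows "decay_weight (x + v) \<le> 2 ^ (CARD('n) + 2) * decay_weight x"
proof -
  define n where "n = CARD('n) + 1"
  define a where "a = norm (x + v)"
  have a: "a \<ge> 0" by (simp add: a_def)
  have "norm x \<le> norm (x + v) + norm v"
    using norm_triangle_ineq4[of "x + v" v] by simp
  hence "norm x \<le> a + 1" using assms by (simp add: a_def)
  hence "norm x \<le> 2 * max 1 a" using a by linarith
  hence "norm x ^ n \<le> (2 * max 1 a) ^ n" by (intro power_mono) auto
  also have "\<dots> = 2 ^ n * (max 1 a) ^ n" by (rule power_mult_distrib)
  also have "\<dots> \<le> 2 ^ n * (1 + a ^ n)"
    using a by (intro mult_left_mono) (auto simp: max_def)
  finally have A: "norm x ^ n \<le> 2 ^ n * (1 + a ^ n)" .
  have "1 * 1 \<le> 2 ^ n * (1 + a ^ n)"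
    using a by (intro mult_mono) auto
  with A have le: "1 + norm x ^ n \<le> 2 ^ (n + 1) * (1 + a ^ n)" by simp
  have p: "1 + norm x ^ n > 0" "1 + a ^ n > 0"
    using a by (auto intro!: add_pos_nonneg)
  have "1 / (1 + a ^ n) \<le> 2 ^ (n + 1) / (1 + norm x ^ n)"
    using le p by (simp only: pos_divide_le_eq[OF p(2)] pos_le_divide_eq[OF p(1)] times_divide_eq_left mult_1_left)
  then show ?thesis
    by (simp add: decay_weight_def n_def a_def)
qed

lemma line_has_vector_derivative:
  assumes "\<And>x. f differentiable (at x)"
  shows "((\<lambda>s. f (x + s *\<^sub>R axis i 1)) has_vector_derivative partial i f (x + s *\<^sub>R axis i 1)) (at s)"
proof -
  let ?y = "x + s *\<^sub>R axis i 1"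
  have d: "(f has_derivative frechet_derivative f (at ?y)) (at ?y)"
    using assms[of ?y] by (simp add: frechet_derivative_works)
  have "((\<lambda>s. x + s *\<^sub>R axis i 1) has_derivative (\<lambda>h. h *\<^sub>R axis i 1)) (at s)"
    by (auto intro!: derivative_eq_intros)
  from has_derivative_compose[OF this d] show ?thesis
    unfolding has_vector_derivative_def partial_def
    using linear_simps(5)[OF has_derivative_bounded_linear[OF d]] by simp
qed

text \<open>By translation invariance every difference quotient of \<open>f\<close> has integral zero, and the quotients converge
dominatedly to the partial derivative. This gives integration by parts without slicing the space into lines.\<close>

lemma integral_partial_zero:
  fixes f :: "real^'n::finite \<Rightarrow> complex"
  assumes diff: "\<And>x. f differentiable (at x)"
    and b: "\<And>x. norm (f x) \<le> C * decay_weight x" and b': "\<And>x. norm (partial i f x) \<le> C * decay_weight x"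
    and [measurable]: "partial i f \<in> borel_measurable borel"
  shows "(\<integral>x. partial i f x \<partial>lborel) = 0"
proof -
  define e :: "real^'n" where "e = axis i 1"
  define h where "h n = inverse (real (Suc n))" for n
  define q where "q n x = (f (x + h n *\<^sub>R e) - f x) /\<^sub>R h n" for n x
  have h: "0 < h n" "h n \<le> 1" for n
    by (auto simp: h_def field_simps)
  have C: "C \<ge> 0"
  proof -
    have "0 \<le> C * decay_weight (0::real^'n)" using b[of 0] norm_ge_zero order_trans by blast
    then show ?thesis using decay_weight_pos[of "0::real^'n"] by (simp add: zero_le_mult_iff)
  qed
  have fm[measurable]: "f \<in> borel_measurable borel"
    by (intro borel_measurable_continuous_onI continuous_at_imp_continuous_on)
       (simp add: diff differentiable_imp_continuous_within)
  have fi: "integrable lborel f"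
    by (rule integrable_decay_weight_bound[OF fm b])
  have bound: "norm (q n x) \<le> C * 2 ^ (CARD('n) + 2) * decay_weight x" for n x
  proof -
    let ?p = "\<lambda>s. f (x + s *\<^sub>R e)"
    have vd: "(?p has_vector_derivative partial i f (x + s *\<^sub>R e)) (at s)" for s
      unfolding e_def by (rule line_has_vector_derivative[OF diff])
    have "\<exists>s\<in>{0<..<h n}. norm (?p (h n) - ?p 0) \<le> norm ((h n - 0) *\<^sub>R partial i f (x + s *\<^sub>R e))"
    proof (rule mvt_general)
      show "continuous_on {0..h n} ?p"
        by (intro continuous_at_imp_continuous_on ballI has_vector_derivative_continuous[OF vd])
      show "(?p has_derivative (\<lambda>k. k *\<^sub>R partial i f (x + s *\<^sub>R e))) (at s)" for s
        using vd[of s] by (simp add: has_vector_derivative_def)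
    qed (rule h)
    then obtain s where s: "0 < s" "s < h n"
      and le: "norm (?p (h n) - ?p 0) \<le> norm ((h n - 0) *\<^sub>R partial i f (x + s *\<^sub>R e))"
      by auto
    have "norm (q n x) = norm (?p (h n) - ?p 0) / h n"
      using h[of n] by (simp add: q_def inverse_eq_divide)
    also have "\<dots> \<le> norm (partial i f (x + s *\<^sub>R e))"
      using le h(1)[of n] by (simp add: pos_divide_le_eq mult.commute)
    also have "\<dots> \<le> C * decay_weight (x + s *\<^sub>R e)" by (rule b')
    also have "\<dots> \<le> C * (2 ^ (CARD('n) + 2) * decay_weight x)"
      by (intro mult_left_mono decay_weight_shift C) (use s h(2)[of n] in \<open>auto simp: e_def\<close>)
    finally show ?thesis by simp
  qed
  have lim: "(\<lambda>n. q n x) \<longlonglongrightarrow> partial i f x" for x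
  proof -
    let ?p = "\<lambda>s. f (x + s *\<^sub>R e)"
    have "(?p has_vector_derivative partial i f (x + 0 *\<^sub>R e)) (at 0)"
      unfolding e_def by (rule line_has_vector_derivative[OF diff])
    hence "((\<lambda>k. norm (?p (0 + k) - ?p 0 - k *\<^sub>R partial i f x) / norm k) \<longlongrightarrow> 0) (at 0)"
      by (simp add: has_vector_derivative_def has_derivative_at)
    moreover have "filterlim h (at 0) sequentially"
      unfolding filterlim_at using h(1) LIMSEQ_inverse_real_of_nat
      by (auto simp: h_def[abs_def] less_imp_neq[THEN not_sym])
    ultimately have l: "(\<lambda>n. norm (?p (0 + h n) - ?p 0 - h n *\<^sub>R partial i f x) / norm (h n)) \<longlonglongrightarrow> 0"
      by (rule filterlim_compose)
    have "norm (?p (0 + h n) - ?p 0 - h n *\<^sub>R partial i f x) / norm (h n) = norm (q n x - partial i f x)" for n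
    proof -
      have "q n x - partial i f x = (?p (0 + h n) - ?p 0 - h n *\<^sub>R partial i f x) /\<^sub>R h n"
        using h(1)[of n] by (simp add: q_def scaleR_diff_right)
      then show ?thesis using h(1)[of n] by (simp add: inverse_eq_divide)
    qed
    with l have "(\<lambda>n. norm (q n x - partial i f x)) \<longlonglongrightarrow> 0" by (simp only:)
    then show ?thesis
      by (simp add: tendsto_norm_zero_iff LIM_zero_iff)
  qed
  have zero: "(\<integral>x. q n x \<partial>lborel) = 0" for n
  proof -
    have "integrable lborel (\<lambda>x. f (h n *\<^sub>R e + 1 *\<^sub>R x))"
      by (rule integrable_lborel_affine[OF _ fi]) simp
    hence i: "integrable lborel (\<lambda>x. f (x + h n *\<^sub>R e))" by (simp add: add.commute)
    have "(\<integral>x. f x \<partial>lborel) = (\<integral>x. f (x + h n *\<^sub>R e) \<partial>lborel)"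
      using integral_lborel_affine[of 1 f "h n *\<^sub>R e"] fm by (simp add: add.commute)
    then show ?thesis
      unfolding q_def using i fi by simp
  qed
  have qm[measurable]: "q n \<in> borel_measurable borel" for n
    unfolding q_def[abs_def] by measurable
  have "(\<lambda>n. \<integral>x. q n x \<partial>lborel) \<longlonglongrightarrow> (\<integral>x. partial i f x \<partial>lborel)"
  proof (rule integral_dominated_convergence)
    show "integrable lborel (\<lambda>x::real^'n. C * 2 ^ (CARD('n) + 2) * decay_weight x)"
      by (rule integrable_mult_right[OF integrable_decay_weight])
    show "AE x in lborel. (\<lambda>n. q n x) \<longlonglongrightarrow> partial i f x" by (simp add: lim)
    show "AE x in lborel. norm (q n x) \<le> C * 2 ^ (CARD('n) + 2) * decay_weight x" for n using bound[of n] by simp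
  qed auto
  then show ?thesis
    unfolding zero by (simp add: LIMSEQ_const_iff)
qed

lemma wave_has_derivative:
  "((\<lambda>x. wave x y) has_derivative (\<lambda>h. (2 * \<i> * of_real pi * of_real (h \<bullet> y)) * wave x y)) (at x)"
proof -
  have "((\<lambda>x. 2 * \<i> * of_real pi * of_real (x \<bullet> y)) has_derivative (\<lambda>h. 2 * \<i> * of_real pi * of_real (h \<bullet> y))) (at x)"
    by (auto intro!: derivative_eq_intros)
  from has_derivative_compose[OF this DERIV_exp[unfolded has_field_derivative_def]] show ?thesis
    by (simp add: wave_eq_exp mult.commute)
qed

text \<open>Integration by parts: \<open>integral_partial_zero\<close> applied to \<open>f\<close> times a plane wave.\<close>

lemma fourier_partial:
  assumes f: "f \<in> schwartz"
  shows "fourier (partial i f) y = partial_symbol i y * fourier f y"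
proof -
  define g where "g x = f x * wave x (- y)" for x
  have pf: "partial i f \<in> schwartz" using f by (rule test_space_partial)
  note [measurable] = test_space_measurable[OF f] test_space_measurable[OF pf]
  obtain C where C: "C \<ge> 0" "\<And>x. norm (f x) \<le> C * decay_weight x"
    using schwartz_half_bound[of f] schwartz_subset_half f by blast
  obtain C' where C': "C' \<ge> 0" "\<And>x. norm (partial i f x) \<le> C' * decay_weight x"
    using schwartz_half_bound[of "partial i f"] schwartz_subset_half pf by blast
  have gd: "(g has_derivative (\<lambda>h. f x * ((2 * \<i> * of_real pi * of_real (h \<bullet> (- y))) * wave x (- y))
      + frechet_derivative f (at x) h * wave x (- y))) (at x)" for x
    unfolding g_def
    by (rule has_derivative_mult[OF _ wave_has_derivative])
       (simp add: frechet_derivative_works[symmetric] test_space_differentiable[OF f])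
  have pg: "partial i g x = partial i f x * wave x (- y) - partial_symbol i y * (f x * wave x (- y))" for x
    by (subst partial_eqI[OF gd]) (simp add: partial_def partial_symbol_def inner_axis' mult_ac)
  have pg': "partial i g = (\<lambda>x. partial i f x * wave x (- y) - partial_symbol i y * (f x * wave x (- y)))"
    by (rule ext) (rule pg)
  have "(\<integral>x. partial i g x \<partial>lborel) = 0"
  proof (rule integral_partial_zero[where C="C + C' + norm (partial_symbol i y) * C"])
    show "g differentiable at x" for x using gd by (rule differentiableI)
    show "norm (g x) \<le> (C + C' + norm (partial_symbol i y) * C) * decay_weight x" for x
    proof -
      have "norm (g x) \<le> C * decay_weight x" using C(2)[of x] by (simp add: g_def norm_mult)
      also have "\<dots> \<le> (C + C' + norm (partial_symbol i y) * C) * decay_weight x"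
        using C(1) C'(1) decay_weight_pos[of x] by (intro mult_right_mono) auto
      finally show ?thesis .
    qed
    show "norm (partial i g x) \<le> (C + C' + norm (partial_symbol i y) * C) * decay_weight x" for x
    proof -
      have "norm (partial i g x) \<le> norm (partial i f x) + norm (partial_symbol i y) * norm (f x)"
        unfolding pg by (rule order_trans[OF norm_triangle_ineq4]) (simp add: norm_mult)
      also have "\<dots> \<le> C' * decay_weight x + norm (partial_symbol i y) * (C * decay_weight x)"
        by (intro add_mono mult_left_mono C C') auto
      also have "\<dots> \<le> C' * decay_weight x + norm (partial_symbol i y) * (C * decay_weight x) + C * decay_weight x"
        using C(1) decay_weight_pos[of x] by simp
      finally show ?thesis by (simp only: distrib_right mult.assoc add_ac)
    qed
    show "partial i g \<in> borel_measurable borel" unfolding pg' by measurable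
  qed
  moreover have "integrable lborel (\<lambda>x. partial i f x * wave x (- y))" "integrable lborel (\<lambda>x. f x * wave x (- y))"
    using inverse_fourier_integrable[OF all_moments_integrable[OF schwartz_all_moments[OF pf]], of "- y"]
      inverse_fourier_integrable[OF all_moments_integrable[OF schwartz_all_moments[OF f]], of "- y"]
    by (simp_all add: wave_commute)
  ultimately show ?thesis
    unfolding pg' by (simp add: fourier_eq)
qed

lemma fourier_partials:
  assumes f: "f \<in> schwartz"
  shows "fourier (partials is f) y = prod_list (map (\<lambda>i. partial_symbol i y) is) * fourier f y"
  by (induction "is") (simp_all add: fourier_partial test_space_partials f mult.assoc)

lemma norm_fourier_le:
  "norm (fourier f y) \<le> (\<integral>x. norm (f x) \<partial>lborel)"
  unfolding fourier_eq using integral_norm_bound[of lborel "\<lambda>x. f x * wave x (- y)"] by (simp add: norm_mult)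

lemma fourier_measurable [measurable]:
  assumes [measurable]: "f \<in> borel_measurable borel"
  shows "fourier f \<in> borel_measurable borel"
  unfolding fourier_eq[abs_def] by measurable

text \<open>Turns decay in each coordinate, which is what derivatives give, into decay in the norm.\<close>

lemma large_component:
  fixes y :: "real^'n::finite"
  obtains i where "norm y \<le> real CARD('n) * \<bar>y $ i\<bar>"
proof -
  have "\<exists>i. norm y \<le> real CARD('n) * \<bar>y $ i\<bar>"
  proof (rule ccontr)
    assume "\<not> ?thesis"
    hence "(\<Sum>i\<in>UNIV. real CARD('n) * \<bar>y $ i\<bar>) < (\<Sum>i\<in>(UNIV::'n set). norm y)"
      by (intro sum_strict_mono) (auto simp: not_le)
    hence "real CARD('n) * (\<Sum>i\<in>UNIV. \<bar>y $ i\<bar>) < real CARD('n) * norm y"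
      by (simp add: sum_distrib_left)
    hence "(\<Sum>i\<in>UNIV. \<bar>y $ i\<bar>) < norm y" by simp
    with norm_le_l1_cart[of y] show False by simp
  qed
  then show ?thesis using that by blast
qed

text \<open>Multiplying the transform by the \<open>m\<close>-th power of a coordinate amounts to transforming an \<open>m\<close>-fold
partial derivative, which is bounded by its integral norm.\<close>

lemma all_moments_fourier:
  fixes f :: "real^'n::finite \<Rightarrow> complex"
  assumes f: "f \<in> schwartz"
  shows "all_moments (fourier f)"
proof (rule all_momentsI)
  show "fourier f \<in> borel_measurable borel"
    by (rule fourier_measurable[OF test_space_measurable[OF f]])
  fix m
  define B where "B i = (\<integral>x. norm (partials (replicate m i) f x) \<partial>lborel)" for i
  have B0: "B i \<ge> 0" for i by (simp add: B_def)
  have "norm y ^ m * norm (fourier f y) \<le> real CARD('n) ^ m * (\<Sum>i\<in>UNIV. B i)" for y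
  proof -
    obtain i where i: "norm y \<le> real CARD('n) * \<bar>y $ i\<bar>" by (rule large_component)
    have "\<bar>y $ i\<bar> \<le> norm (partial_symbol i y)"
    proof -
      have "1 * \<bar>y $ i\<bar> \<le> (2 * pi) * \<bar>y $ i\<bar>"
        using pi_gt3 by (intro mult_right_mono) auto
      then show ?thesis by (simp add: partial_symbol_def norm_mult)
    qed
    with i have "norm y \<le> real CARD('n) * norm (partial_symbol i y)"
      by (meson mult_left_mono of_nat_0_le_iff order_trans)
    hence "norm y ^ m * norm (fourier f y) \<le> (real CARD('n) * norm (partial_symbol i y)) ^ m * norm (fourier f y)"
      by (intro mult_right_mono power_mono) auto
    also have "\<dots> = real CARD('n) ^ m * norm (fourier (partials (replicate m i) f) y)"
      by (simp add: fourier_partials[OF f] norm_mult norm_power power_mult_distrib)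
    also have "\<dots> \<le> real CARD('n) ^ m * B i"
      unfolding B_def by (intro mult_left_mono norm_fourier_le) auto
    also have "\<dots> \<le> real CARD('n) ^ m * (\<Sum>i\<in>UNIV. B i)"
      by (intro mult_left_mono member_le_sum) (auto simp: B0)
    finally show ?thesis .
  qed
  then show "\<exists>C. \<forall>y. norm y ^ m * norm (fourier f y) \<le> C" by blast
qed

section \<open>Heat flow and Fourier inversion\<close>

text \<open>Fubini for a bounded kernel between two integrable functions. It serves for plane waves, for damped
plane waves and for the components of the unit field.\<close>

lemma integral_swap_bounded:
  fixes f :: "'a \<Rightarrow> complex" and g :: "'b \<Rightarrow> complex"
  assumes "sigma_finite_measure M1" "sigma_finite_measure M2"
    and f: "integrable M1 f" and g: "integrable M2 g"
    and k[measurable]: "case_prod k \<in> borel_measurable (M1 \<Otimes>\<^sub>M M2)"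
    and b: "\<And>x y. norm (k x y) \<le> 1"
  shows "(\<integral>x. f x * (\<integral>y. g y * k x y \<partial>M2) \<partial>M1) = (\<integral>y. g y * (\<integral>x. f x * k x y \<partial>M1) \<partial>M2)"
    and "integrable M2 (\<lambda>y. g y * (\<integral>x. f x * k x y \<partial>M1))"
proof -
  interpret pair_sigma_finite M1 M2 by (rule pair_sigma_finite.intro) fact+
  note [measurable] = borel_measurable_integrable[OF f] borel_measurable_integrable[OF g]
  define F where "F x y = f x * (g y * k x y)" for x y
  have Fm: "case_prod F \<in> borel_measurable (M1 \<Otimes>\<^sub>M M2)"
    unfolding F_def by measurable
  have gk: "integrable M2 (\<lambda>y. g y * k x y)" if "x \<in> space M1" for x
  proof (rule Bochner_Integration.integrable_bound[OF g])
    show "(\<lambda>y. g y * k x y) \<in> borel_measurable M2" using that by measurable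
    show "AE y in M2. norm (g y * k x y) \<le> norm (g y)"
      using b[of x] by (auto simp: norm_mult mult_left_le)
  qed
  have F: "integrable (M1 \<Otimes>\<^sub>M M2) (case_prod F)"
  proof (rule Fubini_integrable[OF Fm])
    show "integrable M1 (\<lambda>x. \<integral>y. norm (case_prod F (x, y)) \<partial>M2)"
    proof (rule Bochner_Integration.integrable_bound[OF integrable_mult_left[OF integrable_norm[OF f]]])
      show "(\<lambda>x. \<integral>y. norm (case_prod F (x, y)) \<partial>M2) \<in> borel_measurable M1"
        using Fm by measurable
      show "AE x in M1. norm (\<integral>y. norm (case_prod F (x, y)) \<partial>M2) \<le> norm (norm (f x) * (\<integral>y. norm (g y) \<partial>M2))"
      proof (rule AE_I2)
        fix x assume x: "x \<in> space M1"
        have "(\<integral>y. norm (g y * k x y) \<partial>M2) \<le> (\<integral>y. norm (g y) \<partial>M2)"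
          by (rule integral_mono[OF integrable_norm[OF gk[OF x]] integrable_norm[OF g]])
             (use b[of x] in \<open>auto simp: norm_mult mult_left_le\<close>)
        then have "norm (f x) * (\<integral>y. norm (g y * k x y) \<partial>M2) \<le> norm (f x) * (\<integral>y. norm (g y) \<partial>M2)"
          by (rule mult_left_mono) simp
        moreover have "(\<integral>y. norm (case_prod F (x, y)) \<partial>M2) = norm (f x) * (\<integral>y. norm (g y * k x y) \<partial>M2)"
          by (simp add: F_def norm_mult)
        ultimately show "norm (\<integral>y. norm (case_prod F (x, y)) \<partial>M2) \<le> norm (norm (f x) * (\<integral>y. norm (g y) \<partial>M2))"
          by simp
      qed
    qed
    show "AE x in M1. integrable M2 (\<lambda>y. case_prod F (x, y))"
      by (rule AE_I2) (simp add: F_def gk)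
  qed
  have 1: "(\<integral>y. F x y \<partial>M2) = f x * (\<integral>y. g y * k x y \<partial>M2)" for x
    by (simp add: F_def)
  have 2: "(\<integral>x. F x y \<partial>M1) = g y * (\<integral>x. f x * k x y \<partial>M1)" for y
  proof -
    have "F x y = g y * (f x * k x y)" for x by (simp add: F_def mult_ac)
    then show ?thesis by simp
  qed
  show "(\<integral>x. f x * (\<integral>y. g y * k x y \<partial>M2) \<partial>M1) = (\<integral>y. g y * (\<integral>x. f x * k x y \<partial>M1) \<partial>M2)"
    using Fubini_integral[OF F] unfolding 1 2 by simp
  show "integrable M2 (\<lambda>y. g y * (\<integral>x. f x * k x y \<partial>M1))"
    using integrable_snd[OF F] unfolding 2 .
qed

text \<open>A Gaussian factor on the frequency side is convolution with the heat kernel.\<close>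

lemma heat_convolution:
  fixes u :: "real^'n::finite \<Rightarrow> complex"
  assumes t: "0 < t" and u: "integrable lborel u"
  shows "inverse_fourier (\<lambda>y. of_real (exp (- (t * (norm y)\<^sup>2))) * fourier u y) x = (\<integral>y. u y * of_real (heat_kernel t (x - y)) \<partial>lborel)"
proof -
  have e: "integrable lborel (\<lambda>y::real^'n. complex_of_real (exp (- (t * (norm y)\<^sup>2))))"
    using gaussian_integral[OF t, where 'n='n] by (intro integrable_of_real) (simp add: has_bochner_integral_iff)
  have in1: "fourier u y * wave x y = (\<integral>z. u z * wave (x - z) y \<partial>lborel)" for y
  proof -
    have "wave (x - z) y = wave z (- y) * wave x y" for z
      by (metis wave_add wave_uminus mult.commute diff_conv_add_uminus)
    then show ?thesis by (simp add: fourier_eq flip: mult.assoc)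
  qed
  have "inverse_fourier (\<lambda>y. of_real (exp (- (t * (norm y)\<^sup>2))) * fourier u y) x
      = (\<integral>y. of_real (exp (- (t * (norm y)\<^sup>2))) * (\<integral>z. u z * wave (x - z) y \<partial>lborel) \<partial>lborel)"
    by (simp add: inverse_fourier_wave in1 mult.assoc)
  also have "\<dots> = (\<integral>z. u z * (\<integral>y. of_real (exp (- (t * (norm y)\<^sup>2))) * wave (x - z) y \<partial>lborel) \<partial>lborel)"
  proof (rule integral_swap_bounded(1)[OF sigma_finite_lborel sigma_finite_lborel e u])
    show "(\<lambda>(y, z). wave (x - z) y) \<in> borel_measurable (lborel \<Otimes>\<^sub>M lborel)"
      unfolding split_beta' by (rule wave_measurable) auto
  qed simp
  also have "\<dots> = (\<integral>y. u y * of_real (heat_kernel t (x - y)) \<partial>lborel)"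
    by (simp add: has_bochner_integral_integral_eq[OF gaussian_fourier[OF t]])
  finally show ?thesis .
qed

text \<open>Rescaling by \<open>\<surd>t\<close> moves the time from the kernel to the argument of \<open>u\<close>, where continuity of \<open>u\<close>
can be used as \<open>t\<close> tends to \<open>0\<close>.\<close>

lemma heat_convolution_scaled:
  fixes u :: "real^'n::finite \<Rightarrow> complex"
  assumes t: "0 < t" and u[measurable]: "u \<in> borel_measurable borel"
  shows "(\<integral>y. u y * of_real (heat_kernel t (x - y)) \<partial>lborel) = (\<integral>w. u (x + sqrt t *\<^sub>R w) * of_real (heat_kernel 1 w) \<partial>lborel)"
proof -
  have s: "sqrt t > 0" "(sqrt t)\<^sup>2 = t" using t by auto
  have g: "sqrt t ^ CARD('n) * heat_kernel t (x - (x + sqrt t *\<^sub>R w)) = heat_kernel 1 w" for w :: "real^'n"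
  proof -
    have "sqrt t ^ CARD('n) * sqrt (pi / t) ^ CARD('n) = sqrt pi ^ CARD('n)"
      using t by (simp add: real_sqrt_divide power_divide)
    then show ?thesis using t s by (simp add: heat_kernel_def power_mult_distrib flip: mult.assoc)
  qed
  have "(\<integral>y. u y * of_real (heat_kernel t (x - y)) \<partial>lborel) =
     \<bar>sqrt t\<bar> ^ DIM(real^'n) *\<^sub>R (\<integral>w. u (x + sqrt t *\<^sub>R w) * of_real (heat_kernel t (x - (x + sqrt t *\<^sub>R w))) \<partial>lborel)"
    by (rule integral_lborel_affine) (use s in auto)
  also have "\<dots> = (\<integral>w. (sqrt t ^ CARD('n)) *\<^sub>R (u (x + sqrt t *\<^sub>R w) * of_real (heat_kernel t (x - (x + sqrt t *\<^sub>R w)))) \<partial>lborel)"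
    using s by simp
  also have "\<dots> = (\<integral>w. u (x + sqrt t *\<^sub>R w) * of_real (heat_kernel 1 w) \<partial>lborel)"
  proof (rule Bochner_Integration.integral_cong[OF refl])
    fix w :: "real^'n"
    show "(sqrt t ^ CARD('n)) *\<^sub>R (u (x + sqrt t *\<^sub>R w) * of_real (heat_kernel t (x - (x + sqrt t *\<^sub>R w))))
        = u (x + sqrt t *\<^sub>R w) * of_real (heat_kernel 1 w)"
      unfolding g[symmetric] by (simp add: scaleR_conv_of_real mult_ac)
  qed
  finally show ?thesis .
qed

text \<open>The transform is damped by \<open>exp(- t |y|\<^sup>2)\<close>, and \<open>t\<close> tends to \<open>0\<close>: the damped inversion integral is a
convolution with the heat kernel, which tends to \<open>u x\<close>.\<close>

lemma fourier_inversion: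
  fixes u :: "real^'n::finite \<Rightarrow> complex"
  assumes u: "u \<in> schwartz"
  shows "inverse_fourier (fourier u) = u"
proof
  fix x
  define t where "t n = inverse (real (Suc n))" for n
  have t: "t n > 0" for n by (simp add: t_def)
  have t0: "t \<longlonglongrightarrow> 0" unfolding t_def[abs_def] by (rule LIMSEQ_inverse_real_of_nat)
  note um[measurable] = test_space_measurable[OF u]
  have ui: "integrable lborel u" by (rule all_moments_integrable[OF schwartz_all_moments[OF u]])
  have fi: "integrable lborel (fourier u)" by (rule all_moments_integrable[OF all_moments_fourier[OF u]])
  obtain C where C: "\<And>y. norm (u y) \<le> C" using schwartz_bound[OF u, of 0] by auto
  have "(\<lambda>n. inverse_fourier (\<lambda>y. of_real (exp (- (t n * (norm y)\<^sup>2))) * fourier u y) x) \<longlonglongrightarrow> inverse_fourier (fourier u) x"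
    unfolding inverse_fourier_wave
  proof (rule integral_dominated_convergence)
    show "integrable lborel (\<lambda>y. norm (fourier u y))" using fi by (rule integrable_norm)
    show "AE y in lborel. (\<lambda>n. of_real (exp (- (t n * (norm y)\<^sup>2))) * fourier u y * wave x y) \<longlonglongrightarrow> fourier u y * wave x y"
    proof (intro always_eventually allI)
      fix y
      have "(\<lambda>n. of_real (exp (- (t n * (norm y)\<^sup>2))) * fourier u y * wave x y)
          \<longlonglongrightarrow> of_real (exp (- (0 * (norm y)\<^sup>2))) * fourier u y * wave x y"
        by (intro tendsto_intros t0)
      then show "(\<lambda>n. of_real (exp (- (t n * (norm y)\<^sup>2))) * fourier u y * wave x y) \<longlonglongrightarrow> fourier u y * wave x y"
        by simp
    qed
    show "AE y in lborel. norm (of_real (exp (- (t n * (norm y)\<^sup>2))) * fourier u y * wave x y) \<le> norm (fourier u y)" for n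
      using t[of n] by (auto simp: norm_mult intro!: mult_left_le_one_le)
  qed measurable
  moreover have "(\<lambda>n. inverse_fourier (\<lambda>y. of_real (exp (- (t n * (norm y)\<^sup>2))) * fourier u y) x)
     \<longlonglongrightarrow> (\<integral>w. u x * of_real (heat_kernel 1 (w :: real^'n)) \<partial>lborel)"
    unfolding heat_convolution[OF t ui] heat_convolution_scaled[OF t um]
  proof (rule integral_dominated_convergence)
    show "integrable lborel (\<lambda>w::real^'n. C * heat_kernel 1 w)"
      using heat_kernel_integral[of 1] by (intro integrable_mult_right) (auto simp: has_bochner_integral_iff)
    show "AE w in lborel. (\<lambda>n. u (x + sqrt (t n) *\<^sub>R w) * of_real (heat_kernel 1 w)) \<longlonglongrightarrow> u x * of_real (heat_kernel 1 w)"
    proof (intro always_eventually allI)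
      fix w
      have "isCont u x"
        using test_space_continuous[OF u] by (simp add: continuous_on_eq_continuous_at)
      moreover have "(\<lambda>n. x + sqrt (t n) *\<^sub>R w) \<longlonglongrightarrow> x + sqrt 0 *\<^sub>R w"
        by (intro tendsto_intros t0)
      ultimately have "(\<lambda>n. u (x + sqrt (t n) *\<^sub>R w)) \<longlonglongrightarrow> u x"
        using isCont_tendsto_compose[of x u] by simp
      then show "(\<lambda>n. u (x + sqrt (t n) *\<^sub>R w) * of_real (heat_kernel 1 w)) \<longlonglongrightarrow> u x * of_real (heat_kernel 1 w)"
        by (intro tendsto_intros)
    qed
    show "AE w in lborel. norm (u (x + sqrt (t n) *\<^sub>R w) * of_real (heat_kernel 1 w)) \<le> C * heat_kernel 1 w" for n
    proof (intro always_eventually allI)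
      fix w :: "real^'n"
      have "norm (u (x + sqrt (t n) *\<^sub>R w)) * heat_kernel 1 w \<le> C * heat_kernel 1 w"
        by (rule mult_right_mono[OF C]) (simp add: heat_kernel_nonneg)
      then show "norm (u (x + sqrt (t n) *\<^sub>R w) * of_real (heat_kernel 1 w)) \<le> C * heat_kernel 1 w"
        using heat_kernel_nonneg[of 1 w] by (simp add: norm_mult)
    qed
  qed measurable
  ultimately have "inverse_fourier (fourier u) x = (\<integral>w. u x * of_real (heat_kernel 1 (w :: real^'n)) \<partial>lborel)"
    by (rule LIMSEQ_unique)
  also have "\<dots> = u x"
    using heat_kernel_integral[of 1, where 'n='n] by (simp add: has_bochner_integral_iff)
  finally show "inverse_fourier (fourier u) x = u x" .
qed

section \<open>Decay of the square root of the Laplacian\<close>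

text \<open>Heat kernels integrated against \<open>t^(-3/2)\<close> give a multiple of \<open>|x|^(-d - 1)\<close>. The formula is used twice:
in space, for the decay of the square root of the Laplacian, and in frequency, where it cancels the symbol
of the operator.\<close>

lemma heat_kernel_time_integral:
  fixes x :: "real^'n::finite"
  assumes x: "x \<noteq> 0"
  shows "has_bochner_integral lborel (\<lambda>t. indicator {0<..} t * (t powr (-3/2) * heat_kernel t x))
    (sqrt pi ^ CARD('n) * Gamma ((real CARD('n) + 1) / 2) / (pi * norm x) ^ (CARD('n) + 1))"
proof -
  define s where "s = (real CARD('n) + 1) / 2"
  define a where "a = (pi * norm x)\<^sup>2"
  have s: "s > 0" by (simp add: s_def)
  have a: "a > 0" using x by (simp add: a_def)
  have "has_bochner_integral lborel
      (\<lambda>t. sqrt pi ^ CARD('n) * (indicator {0<..} t * (t powr (- s - 1) * exp (- (a / t)))))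
      (sqrt pi ^ CARD('n) * (Gamma s * a powr (- s)))"
    by (intro has_bochner_integral_mult_right has_bochner_integral_gamma_inverse a s)
  moreover have "sqrt pi ^ CARD('n) * (indicator {0<..} t * (t powr (- s - 1) * exp (- (a / t))))
      = indicator {0<..} t * (t powr (-3/2) * heat_kernel t x)" for t :: real
  proof (cases "t > 0")
    case True
    have sq: "sqrt t ^ CARD('n) = t powr (real CARD('n) / 2)"
      using True by (simp add: powr_powr flip: powr_half_sqrt powr_realpow)
    have "- s - 1 = -3/2 - real CARD('n) / 2"
      by (simp add: s_def field_simps)
    hence "t powr (- s - 1) = t powr (-3/2) / sqrt t ^ CARD('n)"
      unfolding sq by (simp only: powr_diff)
    moreover have "heat_kernel t x = sqrt pi ^ CARD('n) / sqrt t ^ CARD('n) * exp (- (a / t))"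
      by (simp add: heat_kernel_def a_def real_sqrt_divide power_divide power_mult_distrib)
    ultimately show ?thesis by simp
  qed simp
  moreover have "a powr (- s) = 1 / (pi * norm x) ^ (CARD('n) + 1)"
  proof -
    have p: "pi * norm x > 0" using x by simp
    have "a powr s = (pi * norm x) powr (2 * s)"
      using p unfolding a_def by (simp add: powr_powr flip: powr_numeral)
    also have "2 * s = real (CARD('n) + 1)" by (simp add: s_def)
    also have "(pi * norm x) powr real (CARD('n) + 1) = (pi * norm x) ^ (CARD('n) + 1)"
      using p by (rule powr_realpow)
    finally show ?thesis by (simp only: powr_minus inverse_eq_divide)
  qed
  ultimately show ?thesis
    unfolding s_def[symmetric] by (simp only: times_divide_eq_right mult_1_right)
qed

text \<open>A plane wave in \<open>x\<close> with frequency \<open>y\<close>, damped by the heat flow up to time \<open>t\<close>. It vanishes for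
\<open>t \<le> 0\<close>, so that it stays bounded by \<open>1\<close> on the whole time line.\<close>

definition heat_wave :: "real^'n::finite \<Rightarrow> real^'n \<Rightarrow> real \<Rightarrow> complex" where
  "heat_wave x y t = of_real (indicator {0<..} t * exp (- (t * (norm y)\<^sup>2))) * wave x y"

lemma heat_wave_measurable [measurable]:
  "(\<lambda>(y, t). heat_wave x y t) \<in> borel_measurable (lborel \<Otimes>\<^sub>M lborel)"
  unfolding heat_wave_def by measurable

lemma norm_heat_wave_le: "norm (heat_wave x y t) \<le> 1"
  by (auto simp: heat_wave_def norm_mult indicator_def)

lemma heat_wave_fourier:
  assumes "0 < t" "integrable lborel u"
  shows "(\<integral>y. fourier u y * heat_wave x y t \<partial>lborel) = (\<integral>y. u y * of_real (heat_kernel t (x - y)) \<partial>lborel)"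
  using assms by (simp add: heat_convolution[symmetric] inverse_fourier_wave heat_wave_def mult_ac)

text \<open>Either \<open>|x| \<le> 2 |y|\<close>, and the power of \<open>|x|\<close> can be moved to \<open>y\<close>, or \<open>x - y\<close> is at least half as
long as \<open>x\<close>, and the kernel at \<open>x - y\<close> is below its value at \<open>x / 2\<close>.\<close>

lemma heat_kernel_weight_split:
  fixes x y :: "real^'n::finite"
  assumes t: "0 < t"
  shows "norm x ^ n * heat_kernel t (x - y) \<le> 2 ^ n * norm y ^ n * heat_kernel t (x - y) + norm x ^ n * heat_kernel t (x /\<^sub>R 2)"
proof (cases "norm x \<le> 2 * norm y")
  case True
  have "norm x ^ n \<le> (2 * norm y) ^ n" by (intro power_mono True) auto
  hence "norm x ^ n * heat_kernel t (x - y) \<le> 2 ^ n * norm y ^ n * heat_kernel t (x - y)"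
    by (intro mult_right_mono heat_kernel_nonneg t) (simp add: power_mult_distrib)
  moreover have "0 \<le> norm x ^ n * heat_kernel t (x /\<^sub>R 2)"
    by (simp add: heat_kernel_nonneg t)
  ultimately show ?thesis by linarith
next
  case False
  have "norm (x /\<^sub>R 2) \<le> norm (x - y)"
    using False norm_triangle_ineq2[of x y] by simp
  hence "(norm (x /\<^sub>R 2))\<^sup>2 \<le> (norm (x - y))\<^sup>2" by (intro power_mono) auto
  hence "pi\<^sup>2 * (norm (x /\<^sub>R 2))\<^sup>2 / t \<le> pi\<^sup>2 * (norm (x - y))\<^sup>2 / t"
    using t by (intro divide_right_mono mult_left_mono) auto
  hence "heat_kernel t (x - y) \<le> heat_kernel t (x /\<^sub>R 2)"
    unfolding heat_kernel_def using t by (intro mult_left_mono) auto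
  hence "norm x ^ n * heat_kernel t (x - y) \<le> norm x ^ n * heat_kernel t (x /\<^sub>R 2)"
    by (rule mult_left_mono) simp
  moreover have "0 \<le> 2 ^ n * norm y ^ n * heat_kernel t (x - y)"
    by (simp add: heat_kernel_nonneg t)
  ultimately show ?thesis by linarith
qed

lemma heat_kernel_shift_integral:
  assumes t: "0 < t"
  shows "has_bochner_integral lborel (\<lambda>y. heat_kernel t (x - y :: real^'n::finite)) 1"
proof -
  have g: "integrable lborel (heat_kernel t :: real^'n \<Rightarrow> real)" "integral\<^sup>L lborel (heat_kernel t :: real^'n \<Rightarrow> real) = 1"
    using heat_kernel_integral[OF t, where 'n='n] by (auto simp: has_bochner_integral_iff)
  have "integrable lborel (\<lambda>y. heat_kernel t (x + (-1) *\<^sub>R y))"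
    by (rule integrable_lborel_affine[OF _ g(1)]) simp
  moreover have "(\<integral>y. heat_kernel t (x + (-1) *\<^sub>R y) \<partial>lborel) = 1"
    using integral_lborel_affine[of "-1" "heat_kernel t :: real^'n \<Rightarrow> real" x] g(2) by simp
  ultimately show ?thesis by (simp add: has_bochner_integral_iff)
qed

lemma decay_weight_le:
  fixes x :: "real^'n::finite"
  shows "decay_weight x \<le> 1" "norm x ^ (CARD('n) + 1) * decay_weight x \<le> 1"
proof -
  have "1 + norm x ^ (CARD('n) + 1) > 0" by (intro add_pos_nonneg) auto
  then show "decay_weight x \<le> 1" "norm x ^ (CARD('n) + 1) * decay_weight x \<le> 1"
    unfolding decay_weight_def by (simp_all only: pos_divide_le_eq times_divide_eq_right) simp_all
qed

text \<open>The inner integral is the heat flow of \<open>u\<close> at \<open>x\<close> (\<open>heat_wave_fourier\<close>). After multiplication by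
\<open>|x|^(d + 1)\<close>, the splitting \<open>heat_kernel_weight_split\<close> leaves a part bounded uniformly in time, because
\<open>u\<close> itself has this decay, and a part proportional to \<open>|x|^(d + 1)\<close> times the kernel at \<open>x / 2\<close>. The
first part is integrable against \<open>lap_weight\<close>. The second, integrated against \<open>t^(-3/2)\<close>, is
constant in \<open>x\<close> by \<open>heat_kernel_time_integral\<close>.\<close>

lemma heat_average_decay:
  fixes u :: "real^'n::finite \<Rightarrow> complex"
  assumes um[measurable]: "u \<in> borel_measurable borel"
    and u: "\<And>y. norm (u y) \<le> A * decay_weight y" and A: "0 \<le> A"
    and w: "\<And>t. 0 < t \<Longrightarrow> \<bar>w t\<bar> \<le> lap_weight t"
  shows "\<exists>C. \<forall>x. norm (\<integral>t. of_real (indicator {0<..} t * w t) *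
      (\<integral>y. fourier u y * heat_wave x y t \<partial>lborel) \<partial>lborel) \<le> C * decay_weight x"
proof -
  define n where "n = CARD('n) + 1"
  let ?I = "\<lambda>t::real. indicator {0<..} t :: real"
  have ui: "integrable lborel u" by (rule integrable_decay_weight_bound[OF um u])
  define N where "N = (\<integral>y. norm (u y) \<partial>lborel)"
  have N: "N \<ge> 0" by (simp add: N_def)
  define h where "h x t = (\<integral>y. fourier u y * heat_wave x y t \<partial>lborel)" for x t
  have uA: "norm (u y) \<le> A" for y
    using u[of y] mult_left_mono[OF decay_weight_le(1)[of y] A] by simp
  have unA: "norm y ^ n * norm (u y) \<le> A" for y
  proof -
    have "norm y ^ n * norm (u y) \<le> norm y ^ n * (A * decay_weight y)"
      by (intro mult_left_mono u) simp
    also have "\<dots> = A * (norm y ^ n * decay_weight y)" by simp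
    also have "\<dots> \<le> A * 1" unfolding n_def by (intro mult_left_mono decay_weight_le A)
    finally show ?thesis by simp
  qed
  have gi: "integrable lborel (\<lambda>y. heat_kernel t (x - y))" "(\<integral>y. heat_kernel t (x - y) \<partial>lborel) = 1" if "t > 0" for x :: "real^'n" and t
    using heat_kernel_shift_integral[OF that, of x] by (auto simp: has_bochner_integral_iff)
  have hle: "norm (h x t) \<le> (\<integral>y. norm (u y) * heat_kernel t (x - y) \<partial>lborel)" if t: "t > 0" for x t
  proof -
    have "norm (h x t) \<le> (\<integral>y. norm (u y * of_real (heat_kernel t (x - y))) \<partial>lborel)"
      unfolding h_def heat_wave_fourier[OF t ui] by (rule integral_norm_bound)
    then show ?thesis by (simp add: norm_mult heat_kernel_nonneg[OF t])
  qed
  have b1: "norm (h x t) \<le> A" if t: "t > 0" for x t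
  proof -
    have "(\<integral>y. norm (u y) * heat_kernel t (x - y) \<partial>lborel) \<le> (\<integral>y. A * heat_kernel t (x - y) \<partial>lborel)"
    proof (rule integral_mono')
      show "integrable lborel (\<lambda>y. A * heat_kernel t (x - y))" using gi(1)[OF t] by (rule integrable_mult_right)
      show "norm (u y) * heat_kernel t (x - y) \<le> A * heat_kernel t (x - y)" for y
        by (intro mult_right_mono uA heat_kernel_nonneg t)
      show "0 \<le> A * heat_kernel t (x - y)" for y by (simp add: A heat_kernel_nonneg t)
    qed
    then show ?thesis using hle[OF t, of x] gi(2)[OF t, of x] by simp
  qed
  have b2: "norm x ^ n * norm (h x t) \<le> 2 ^ n * A + norm x ^ n * heat_kernel t (x /\<^sub>R 2) * N" if t: "t > 0" for x t
  proof -
    have "norm x ^ n * norm (h x t) \<le> norm x ^ n * (\<integral>y. norm (u y) * heat_kernel t (x - y) \<partial>lborel)"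
      by (intro mult_left_mono hle t) simp
    also have "\<dots> = (\<integral>y. norm x ^ n * (norm (u y) * heat_kernel t (x - y)) \<partial>lborel)" by simp
    also have "\<dots> \<le> (\<integral>y. 2 ^ n * A * heat_kernel t (x - y) + norm x ^ n * heat_kernel t (x /\<^sub>R 2) * norm (u y) \<partial>lborel)"
    proof (rule integral_mono')
      show "integrable lborel (\<lambda>y. 2 ^ n * A * heat_kernel t (x - y) + norm x ^ n * heat_kernel t (x /\<^sub>R 2) * norm (u y))"
        by (rule Bochner_Integration.integrable_add[OF integrable_mult_right[OF gi(1)[OF t]] integrable_mult_right[OF integrable_norm[OF ui]]])
      fix y
      have "norm x ^ n * (norm (u y) * heat_kernel t (x - y)) = norm (u y) * (norm x ^ n * heat_kernel t (x - y))" by simp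
      also have "\<dots> \<le> norm (u y) * (2 ^ n * norm y ^ n * heat_kernel t (x - y) + norm x ^ n * heat_kernel t (x /\<^sub>R 2))"
        by (intro mult_left_mono heat_kernel_weight_split t) simp
      also have "\<dots> = 2 ^ n * (norm y ^ n * norm (u y)) * heat_kernel t (x - y) + norm x ^ n * heat_kernel t (x /\<^sub>R 2) * norm (u y)"
        by (simp add: distrib_left)
      also have "\<dots> \<le> 2 ^ n * A * heat_kernel t (x - y) + norm x ^ n * heat_kernel t (x /\<^sub>R 2) * norm (u y)"
        by (intro add_right_mono mult_right_mono mult_left_mono unA heat_kernel_nonneg t) simp
      finally show "norm x ^ n * (norm (u y) * heat_kernel t (x - y))
          \<le> 2 ^ n * A * heat_kernel t (x - y) + norm x ^ n * heat_kernel t (x /\<^sub>R 2) * norm (u y)" .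
      show "0 \<le> 2 ^ n * A * heat_kernel t (x - y) + norm x ^ n * heat_kernel t (x /\<^sub>R 2) * norm (u y)"
        by (intro add_nonneg_nonneg mult_nonneg_nonneg A heat_kernel_nonneg t) auto
    qed
    also have "\<dots> = 2 ^ n * A + norm x ^ n * heat_kernel t (x /\<^sub>R 2) * N"
      using integrable_mult_right[OF gi(1)[OF t, of x], of "2 ^ n * A"]
        integrable_mult_right[OF integrable_norm[OF ui], of "norm x ^ n * heat_kernel t (x /\<^sub>R 2)"]
      by (simp add: gi(2)[OF t] N_def)
    finally show ?thesis .
  qed
  define W where "W = (\<integral>t. ?I t * lap_weight t \<partial>lborel)"
  define K where "K = sqrt pi ^ CARD('n) * Gamma ((real CARD('n) + 1) / 2) * (2 / pi) ^ n"
  define J where "J x = (\<integral>t. of_real (?I t * w t) * h x t \<partial>lborel)" for x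
  have nw: "norm (of_real (?I t * w t) * h x t) \<le> ?I t * lap_weight t * norm (h x t)" for x t
  proof (cases "t > 0")
    case True
    then show ?thesis using w[OF True] by (simp add: norm_mult mult_right_mono)
  qed simp
  have J1: "norm (J x) \<le> A * W" for x
  proof -
    have "norm (J x) \<le> (\<integral>t. norm (of_real (?I t * w t) * h x t) \<partial>lborel)"
      unfolding J_def by (rule integral_norm_bound)
    also have "\<dots> \<le> (\<integral>t. A * (?I t * lap_weight t) \<partial>lborel)"
    proof (rule integral_mono')
      show "integrable lborel (\<lambda>t. A * (?I t * lap_weight t))"
        by (rule integrable_mult_right[OF integrable_lap_weight])
      fix t
      have "?I t * lap_weight t * norm (h x t) \<le> ?I t * lap_weight t * A"
        by (cases "t > 0") (auto intro!: mult_left_mono b1 lap_weight_nonneg)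
      then show "norm (of_real (?I t * w t) * h x t) \<le> A * (?I t * lap_weight t)"
        using nw[of t x] by (simp only: mult.commute[of A])
      show "0 \<le> A * (?I t * lap_weight t)"
        using A by (cases "t > 0") (auto intro!: mult_nonneg_nonneg lap_weight_nonneg)
    qed
    also have "\<dots> = A * W" by (simp add: W_def)
    finally show ?thesis .
  qed
  have J2: "norm x ^ n * norm (J x) \<le> 2 ^ n * A * W + N * K" for x
  proof (cases "x = 0")
    case True
    have "0 \<le> W" unfolding W_def
      by (rule Bochner_Integration.integral_nonneg) (auto simp: indicator_def lap_weight_nonneg)
    moreover have "0 \<le> K" unfolding K_def by (auto intro!: mult_nonneg_nonneg Gamma_real_nonneg)
    ultimately show ?thesis using True N A by (simp add: n_def)
  next
    case False
    define x2 where "x2 = x /\<^sub>R 2"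
    have x2: "x2 \<noteq> 0" using False by (simp add: x2_def)
    let ?c = "sqrt pi ^ CARD('n) * Gamma ((real CARD('n) + 1) / 2) / (pi * norm x2) ^ n"
    have g: "integrable lborel (\<lambda>t. ?I t * (t powr (-3/2) * heat_kernel t x2))"
      "(\<integral>t. ?I t * (t powr (-3/2) * heat_kernel t x2) \<partial>lborel) = ?c"
      using heat_kernel_time_integral[OF x2] by (auto simp: has_bochner_integral_iff n_def)
    have "norm x ^ n * norm (J x) \<le> norm x ^ n * (\<integral>t. norm (of_real (?I t * w t) * h x t) \<partial>lborel)"
      unfolding J_def by (rule mult_left_mono[OF integral_norm_bound]) simp
    also have "\<dots> = (\<integral>t. norm x ^ n * norm (of_real (?I t * w t) * h x t) \<partial>lborel)" by simp
    also have "\<dots> \<le> (\<integral>t. 2 ^ n * A * (?I t * lap_weight t)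
        + N * norm x ^ n * (?I t * (t powr (-3/2) * heat_kernel t x2)) \<partial>lborel)"
    proof (rule integral_mono')
      show "integrable lborel (\<lambda>t. 2 ^ n * A * (?I t * lap_weight t) + N * norm x ^ n * (?I t * (t powr (-3/2) * heat_kernel t x2)))"
        by (rule Bochner_Integration.integrable_add[OF integrable_mult_right[OF integrable_lap_weight] integrable_mult_right[OF g(1)]])
      fix t
      show "0 \<le> 2 ^ n * A * (?I t * lap_weight t) + N * norm x ^ n * (?I t * (t powr (-3/2) * heat_kernel t x2))"
        using A N by (cases "t > 0") (auto intro!: mult_nonneg_nonneg add_nonneg_nonneg lap_weight_nonneg heat_kernel_nonneg)
      show "norm x ^ n * norm (of_real (?I t * w t) * h x t)
          \<le> 2 ^ n * A * (?I t * lap_weight t) + N * norm x ^ n * (?I t * (t powr (-3/2) * heat_kernel t x2))"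
      proof (cases "t > 0")
        case True
        have "norm x ^ n * norm (of_real (?I t * w t) * h x t) \<le> norm x ^ n * (?I t * lap_weight t * norm (h x t))"
          by (intro mult_left_mono nw) simp
        also have "\<dots> = lap_weight t * (norm x ^ n * norm (h x t))" using True by simp
        also have "\<dots> \<le> lap_weight t * (2 ^ n * A + norm x ^ n * heat_kernel t x2 * N)"
          unfolding x2_def by (intro mult_left_mono b2 lap_weight_nonneg True)
        also have "\<dots> = 2 ^ n * A * lap_weight t + N * norm x ^ n * (lap_weight t * heat_kernel t x2)"
          by (simp add: distrib_left)
        also have "\<dots> \<le> 2 ^ n * A * lap_weight t + N * norm x ^ n * (t powr (-3/2) * heat_kernel t x2)"
          using N by (intro add_left_mono mult_left_mono mult_right_mono lap_weight_le heat_kernel_nonneg True) auto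
        finally show ?thesis using True by simp
      qed simp
    qed
    also have "\<dots> = (\<integral>t. 2 ^ n * A * (?I t * lap_weight t) \<partial>lborel)
        + (\<integral>t. N * norm x ^ n * (?I t * (t powr (-3/2) * heat_kernel t x2)) \<partial>lborel)"
      by (rule Bochner_Integration.integral_add[OF integrable_mult_right[OF integrable_lap_weight] integrable_mult_right[OF g(1)]])
    also have "\<dots> = 2 ^ n * A * W + N * norm x ^ n * ?c"
      unfolding integral_mult_right_zero g(2) W_def ..
    also have "N * norm x ^ n * ?c = N * K"
    proof -
      have "norm x = 2 * norm x2" by (simp add: x2_def)
      hence "norm x ^ n = 2 ^ n * norm x2 ^ n" by (simp add: power_mult_distrib)
      moreover have "norm x2 ^ n \<noteq> 0" using x2 by simp
      ultimately show ?thesis using x2 by (simp add: K_def power_mult_distrib power_divide)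
    qed
    finally show ?thesis .
  qed
  have "norm (J x) \<le> (A * W + (2 ^ n * A * W + N * K)) * decay_weight x" for x
    using J1[of x] J2[of x] unfolding n_def by (rule decay_weight_boundI)
  then show ?thesis unfolding J_def h_def by blast
qed

lemma sum_partial_symbol_sq: "(\<Sum>i\<in>UNIV. partial_symbol i y * partial_symbol i y) = - of_real ((2 * pi * norm y)\<^sup>2)"
proof -
  have "partial_symbol i y * partial_symbol i y = - of_real ((2 * pi)\<^sup>2 * (y $ i)\<^sup>2)" for i
    by (simp add: partial_symbol_def power2_eq_square)
  moreover have "(norm y)\<^sup>2 = (\<Sum>i\<in>UNIV. (y $ i)\<^sup>2)"
    unfolding power2_norm_eq_inner inner_vec_def by (simp add: power2_eq_square)
  ultimately show ?thesis
    by (simp add: power_mult_distrib sum_distrib_left sum_negf)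
qed

lemma fourier_laplacian:
  fixes f :: "real^'n::finite \<Rightarrow> complex"
  assumes f: "f \<in> schwartz"
  shows "fourier (\<lambda>x. \<Sum>i\<in>UNIV. partials [i, i] f x) y = - of_real ((2 * pi * norm y)\<^sup>2) * fourier f y"
proof -
  have int: "integrable lborel (\<lambda>x. partials [i, i] f x * wave x (- y))" for i
    using inverse_fourier_integrable[OF all_moments_integrable[OF schwartz_all_moments[OF test_space_partials[OF f, of "[i, i]"]]], of "- y"]
    by (simp only: wave_commute)
  have "fourier (\<lambda>x. \<Sum>i\<in>UNIV. partials [i, i] f x) y = (\<Sum>i\<in>UNIV. fourier (partials [i, i] f) y)"
    using int by (simp add: fourier_eq sum_distrib_right del: partials_Cons)
  also have "\<dots> = (\<Sum>i\<in>UNIV. partial_symbol i y * partial_symbol i y * fourier f y)"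
    by (simp add: fourier_partials[OF f] del: partials_Cons)
  also have "\<dots> = (\<Sum>i\<in>UNIV. partial_symbol i y * partial_symbol i y) * fourier f y"
    by (rule sum_distrib_right[symmetric])
  finally show ?thesis unfolding sum_partial_symbol_sq .
qed

text \<open>By \<open>square_root_subordination\<close>, multiplication by \<open>\<surd>\<pi> |y|\<close> on the frequency side is an average of
heat flows, with \<open>lap_weight\<close> for the flow of a multiple of \<open>\<Delta>f\<close> and with \<open>id_weight\<close> for the flow
of \<open>f\<close>. Both averages decay by \<open>heat_average_decay\<close>.\<close>

lemma half_laplacian_decay:
  fixes f :: "real^'n::finite \<Rightarrow> complex"
  assumes f: "f \<in> schwartz"
  shows "\<exists>C. \<forall>x. norm (inverse_fourier (\<lambda>y. of_real (norm y) * fourier f y) x) \<le> C * decay_weight x"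
proof -
  let ?I = "\<lambda>t::real. indicator {0<..} t :: real"
  \<comment> \<open>\<open>g\<close> is the function with transform \<open>|y|\<^sup>2 * fourier f y\<close>.\<close>
  define g where "g x = - of_real (1 / (2 * pi)\<^sup>2) * (\<Sum>i\<in>UNIV. partials [i, i] f x)" for x
  have p2: "partials [i, i] f \<in> schwartz" for i by (rule test_space_partials[OF f])
  note fm = test_space_measurable[OF f]
  have gm: "g \<in> borel_measurable borel"
    unfolding g_def[abs_def] using test_space_measurable[OF p2]
    by (intro borel_measurable_times borel_measurable_const borel_measurable_sum) auto
  have fg: "fourier g y = of_real ((norm y)\<^sup>2) * fourier f y" for y
  proof -
    have "fourier g y = - of_real (1 / (2 * pi)\<^sup>2) * fourier (\<lambda>x. \<Sum>i\<in>UNIV. partials [i, i] f x) y"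
      unfolding fourier_eq g_def[abs_def] by (simp only: mult.assoc integral_mult_right_zero)
    also have "\<dots> = of_real (1 / (2 * pi)\<^sup>2 * (2 * pi * norm y)\<^sup>2) * fourier f y"
      unfolding fourier_laplacian[OF f] by simp
    also have "1 / (2 * pi)\<^sup>2 * (2 * pi * norm y)\<^sup>2 = (norm y)\<^sup>2"
      by (simp add: power_mult_distrib)
    finally show ?thesis .
  qed
  obtain A where A: "0 \<le> A" "\<And>x. norm (f x) \<le> A * decay_weight x"
    using schwartz_half_bound[of f] schwartz_subset_half f by blast
  obtain B where B: "0 \<le> B" "\<And>x. norm (g x) \<le> B * decay_weight x"
  proof -
    have "\<forall>i. \<exists>C. C \<ge> 0 \<and> (\<forall>x. norm (partials [i, i] f x) \<le> C * decay_weight x)"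
      using schwartz_half_bound schwartz_subset_half p2 by (metis subsetD)
    then obtain C where C: "\<And>i. C i \<ge> 0" "\<And>i x. norm (partials [i, i] f x) \<le> C i * decay_weight x" by metis
    have "norm (g x) \<le> (1 / (2 * pi)\<^sup>2 * (\<Sum>i\<in>UNIV. C i)) * decay_weight x" for x
    proof -
      have "norm (g x) = 1 / (2 * pi)\<^sup>2 * norm (\<Sum>i\<in>UNIV. partials [i, i] f x)"
        unfolding g_def by (simp only: norm_mult norm_minus_cancel norm_of_real) simp
      also have "\<dots> \<le> 1 / (2 * pi)\<^sup>2 * (\<Sum>i\<in>UNIV. C i * decay_weight x)"
        by (intro mult_left_mono order_trans[OF norm_sum] sum_mono C) simp
      finally show ?thesis by (simp only: sum_distrib_right mult.assoc)
    qed
    moreover have "0 \<le> 1 / (2 * pi)\<^sup>2 * (\<Sum>i\<in>UNIV. C i)"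
      by (intro mult_nonneg_nonneg sum_nonneg C) simp
    ultimately show ?thesis using that by blast
  qed
  have sw: "\<bar>lap_weight t\<bar> \<le> lap_weight t" if "0 < t" for t
    using lap_weight_nonneg[OF that] by simp
  let ?J = "\<lambda>w u x. \<integral>t. of_real (?I t * w t) * (\<integral>y. fourier u y * heat_wave x y t \<partial>lborel) \<partial>lborel"
  obtain C1 where C1: "\<And>x. norm (?J lap_weight g x) \<le> C1 * decay_weight x"
    using heat_average_decay[OF gm B(2,1) sw] by blast
  obtain C2 where C2: "\<And>x. norm (?J id_weight f x) \<le> C2 * decay_weight x"
    using heat_average_decay[OF fm A(2,1) abs_id_weight_le] by blast
  have i1: "integrable lborel (\<lambda>t. complex_of_real (?I t * lap_weight t))"
    by (rule integrable_of_real[OF integrable_lap_weight])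
  have i2: "integrable lborel (\<lambda>t. complex_of_real (?I t * id_weight t))"
  proof (rule integrable_of_real, rule Bochner_Integration.integrable_bound[OF integrable_lap_weight])
    show "AE t in lborel. norm (?I t * id_weight t) \<le> norm (?I t * lap_weight t)"
    proof (intro always_eventually allI)
      fix t show "norm (?I t * id_weight t) \<le> norm (?I t * lap_weight t)"
        using abs_id_weight_le[of t] lap_weight_nonneg[of t] by (cases "t > 0") auto
    qed
  qed measurable
  have if1: "integrable lborel (fourier f)" by (rule all_moments_integrable[OF all_moments_fourier[OF f]])
  have ig1: "integrable lborel (fourier g)"
  proof -
    have "integrable lborel (\<lambda>y. of_real ((norm y)\<^sup>2) * fourier f y)"
      by (rule all_moments_integrable_mult[OF all_moments_fourier[OF f], where C=1 and n=2]) (auto simp: norm_power)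
    then show ?thesis by (simp only: fg[abs_def])
  qed
  have key: "of_real (sqrt pi) * inverse_fourier (\<lambda>y. of_real (norm y) * fourier f y) x = ?J lap_weight g x + ?J id_weight f x" for x
  proof -
    let ?T1 = "\<lambda>y. \<integral>t. of_real (?I t * lap_weight t) * heat_wave x y t \<partial>lborel"
    let ?T2 = "\<lambda>y. \<integral>t. of_real (?I t * id_weight t) * heat_wave x y t \<partial>lborel"
    have m: "(\<lambda>(t, y). heat_wave x y t) \<in> borel_measurable (lborel \<Otimes>\<^sub>M lborel)"
      unfolding heat_wave_def by measurable
    have s1: "?J lap_weight g x = (\<integral>y. fourier g y * ?T1 y \<partial>lborel)" "integrable lborel (\<lambda>y. fourier g y * ?T1 y)"
      using integral_swap_bounded[OF sigma_finite_lborel sigma_finite_lborel i1 ig1 m norm_heat_wave_le] by auto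
    have s2: "?J id_weight f x = (\<integral>y. fourier f y * ?T2 y \<partial>lborel)" "integrable lborel (\<lambda>y. fourier f y * ?T2 y)"
      using integral_swap_bounded[OF sigma_finite_lborel sigma_finite_lborel i2 if1 m norm_heat_wave_le] by auto
    have pt: "fourier g y * ?T1 y + fourier f y * ?T2 y = of_real (sqrt pi) * (of_real (norm y) * fourier f y * wave x y)" for y
    proof -
      have k1: "integrable lborel (\<lambda>t. of_real (?I t * lap_weight t) * heat_wave x y t)"
        by (rule Bochner_Integration.integrable_bound[OF i1])
           (use norm_heat_wave_le[of x y] in \<open>auto simp: norm_mult heat_wave_def[abs_def] intro!: mult_left_le\<close>)
      have k2: "integrable lborel (\<lambda>t. of_real (?I t * id_weight t) * heat_wave x y t)"
        by (rule Bochner_Integration.integrable_bound[OF i2])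
           (use norm_heat_wave_le[of x y] in \<open>auto simp: norm_mult heat_wave_def[abs_def] intro!: mult_left_le\<close>)
      have "of_real ((norm y)\<^sup>2) * ?T1 y + ?T2 y
         = (\<integral>t. of_real ((norm y)\<^sup>2) * (of_real (?I t * lap_weight t) * heat_wave x y t)
            + of_real (?I t * id_weight t) * heat_wave x y t \<partial>lborel)"
        using integrable_mult_right[OF k1, of "of_real ((norm y)\<^sup>2)"] k2 by simp
      also have "\<dots> = (\<integral>t. wave x y * of_real (?I t * (((norm y)\<^sup>2 * lap_weight t + id_weight t) * exp (- (t * (norm y)\<^sup>2)))) \<partial>lborel)"
        by (intro Bochner_Integration.integral_cong refl)
           (simp add: heat_wave_def indicator_def algebra_simps)
      also have "\<dots> = wave x y * of_real (sqrt pi * norm y)"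
        unfolding integral_mult_right_zero integral_complex_of_real
          has_bochner_integral_integral_eq[OF square_root_subordination[OF norm_ge_zero]] ..
      finally have "fourier f y * (of_real ((norm y)\<^sup>2) * ?T1 y + ?T2 y) = fourier f y * (wave x y * of_real (sqrt pi * norm y))"
        by (rule arg_cong)
      then show ?thesis unfolding fg by (simp add: algebra_simps)
    qed
    have "?J lap_weight g x + ?J id_weight f x = (\<integral>y. fourier g y * ?T1 y + fourier f y * ?T2 y \<partial>lborel)"
      unfolding s1(1) s2(1) using s1(2) s2(2) by simp
    also have "\<dots> = of_real (sqrt pi) * inverse_fourier (\<lambda>y. of_real (norm y) * fourier f y) x"
      unfolding pt inverse_fourier_wave by simp
    finally show ?thesis by simp
  qed
  have "norm (inverse_fourier (\<lambda>y. of_real (norm y) * fourier f y) x) \<le> ((C1 + C2) / sqrt pi) * decay_weight x" for x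
  proof -
    have "sqrt pi * norm (inverse_fourier (\<lambda>y. of_real (norm y) * fourier f y) x) = norm (?J lap_weight g x + ?J id_weight f x)"
      unfolding key[symmetric] norm_mult by simp
    also have "\<dots> \<le> C1 * decay_weight x + C2 * decay_weight x"
      by (rule order_trans[OF norm_triangle_ineq add_mono[OF C1 C2]])
    finally show ?thesis by (simp add: field_simps)
  qed
  then show ?thesis by blast
qed

section \<open>Pairing the radial unit field with a gradient\<close>

text \<open>Fubini for a nonnegative kernel whose integral over the second variable is known: then the integral of
the norm is known as well, and integrability of \<open>a\<close> times this integral suffices. The kernels in question are
singular where \<open>a\<close> vanishes, hence the restriction to \<open>a x \<noteq> 0\<close>.\<close>

lemma integral_swap_kernel:
  fixes a :: "'a \<Rightarrow> complex" and k :: "'a \<Rightarrow> 'b \<Rightarrow> real"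
  assumes "sigma_finite_measure M1" "sigma_finite_measure M2"
    and a[measurable]: "a \<in> borel_measurable M1"
    and k[measurable]: "case_prod k \<in> borel_measurable (M1 \<Otimes>\<^sub>M M2)"
    and k0: "\<And>x y. 0 \<le> k x y"
    and W: "\<And>x. a x \<noteq> 0 \<Longrightarrow> has_bochner_integral M2 (k x) (W x)"
    and aW: "integrable M1 (\<lambda>x. a x * of_real (W x))"
  shows "(\<integral>x. a x * of_real (W x) \<partial>M1) = (\<integral>y. (\<integral>x. a x * of_real (k x y) \<partial>M1) \<partial>M2)"
proof -
  interpret pair_sigma_finite M1 M2 by (rule pair_sigma_finite.intro) fact+
  define F where "F x y = a x * of_real (k x y)" for x y
  have Fm: "case_prod F \<in> borel_measurable (M1 \<Otimes>\<^sub>M M2)"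
    unfolding F_def by measurable
  have Wi: "integrable M2 (k x)" "integral\<^sup>L M2 (k x) = W x" if "a x \<noteq> 0" for x
    using W[OF that] by (auto simp: has_bochner_integral_iff)
  have i1: "(\<integral>y. norm (F x y) \<partial>M2) = norm (a x * of_real (W x))" for x
  proof (cases "a x = 0")
    case False
    have "0 \<le> W x" unfolding Wi(2)[OF False, symmetric]
      by (rule Bochner_Integration.integral_nonneg) (rule k0)
    then show ?thesis
      by (simp add: F_def norm_mult abs_of_nonneg[OF k0] Wi(2)[OF False])
  qed (simp add: F_def)
  have i2: "(\<integral>y. F x y \<partial>M2) = a x * of_real (W x)" for x
    by (cases "a x = 0") (simp_all add: F_def Wi(2))
  have i3: "integrable M2 (F x)" for x
    by (cases "a x = 0") (auto simp: F_def[abs_def] intro!: integrable_mult_right integrable_of_real Wi)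
  have "integrable (M1 \<Otimes>\<^sub>M M2) (case_prod F)"
  proof (rule Fubini_integrable[OF Fm])
    show "integrable M1 (\<lambda>x. \<integral>y. norm (case_prod F (x, y)) \<partial>M2)"
      unfolding prod.case i1 by (rule integrable_norm[OF aW])
    show "AE x in M1. integrable M2 (\<lambda>y. case_prod F (x, y))"
      using i3 by simp
  qed
  from Fubini_integral[OF this] show ?thesis
    unfolding i2 by (simp add: F_def)
qed

lemma all_moments_gaussian:
  assumes t: "0 < t"
  shows "all_moments (\<lambda>y::real^'n::finite. of_real (exp (- (t * (norm y)\<^sup>2))))"
proof (rule all_momentsI)
  fix k :: nat
  define n where "n = Suc k"
  have "norm y ^ k * norm (complex_of_real (exp (- (t * (norm y)\<^sup>2)))) \<le> 1 + (n / t) ^ n" for y :: "real^'n"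
  proof -
    let ?r = "norm y" and ?e = "exp (- (t * (norm y)\<^sup>2))"
    have k: "?r ^ k \<le> 1 + (?r\<^sup>2) ^ n"
    proof (cases "?r \<le> 1")
      case True
      then have "?r ^ k \<le> 1" by (simp add: power_le_one)
      moreover have "0 \<le> (?r\<^sup>2) ^ n" by simp
      ultimately show ?thesis by linarith
    next
      case False
      then have "?r ^ k \<le> ?r ^ (2 * n)" by (intro power_increasing) (auto simp: n_def)
      then show ?thesis by (simp add: power_mult)
    qed
    have n: "n > 0" by (simp add: n_def)
    \<comment> \<open>\<open>exp s\<close> dominates \<open>(s / n) ^ n\<close>, here with \<open>s = t * ?r\<^sup>2\<close>.\<close>
    have "(t * ?r\<^sup>2 / n) ^ n \<le> (1 + t * ?r\<^sup>2 / n) ^ n"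
      using t by (intro power_mono) auto
    also have "\<dots> \<le> exp (t * ?r\<^sup>2)"
      using t n by (intro exp_ge_one_plus_x_over_n_power_n) (auto intro: order_trans[of _ 0])
    finally have "(t / n) ^ n * (?r\<^sup>2) ^ n \<le> exp (t * ?r\<^sup>2)"
      by (simp add: power_mult_distrib power_divide)
    hence "(n / t) ^ n * ((t / n) ^ n * (?r\<^sup>2) ^ n) \<le> (n / t) ^ n * exp (t * ?r\<^sup>2)"
      using t by (intro mult_left_mono) auto
    moreover have "(n / t) ^ n * ((t / n) ^ n * (?r\<^sup>2) ^ n) = (?r\<^sup>2) ^ n"
      using t n by (simp add: mult.assoc[symmetric] flip: power_mult_distrib)
    ultimately have "(?r\<^sup>2) ^ n * ?e \<le> (n / t) ^ n * exp (t * ?r\<^sup>2) * ?e"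
      by (intro mult_right_mono) auto
    also have "\<dots> = (n / t) ^ n" by (simp add: mult.assoc flip: exp_add)
    finally have e1: "(?r\<^sup>2) ^ n * ?e \<le> (n / t) ^ n" .
    have e2: "?e \<le> 1" using t by simp
    have "?r ^ k * ?e \<le> (1 + (?r\<^sup>2) ^ n) * ?e" by (intro mult_right_mono k) simp
    also have "\<dots> = ?e + (?r\<^sup>2) ^ n * ?e" by (simp only: distrib_right mult_1_left)
    also have "\<dots> \<le> 1 + (n / t) ^ n" using e1 e2 by (rule add_mono[rotated])
    finally show ?thesis by simp
  qed
  then show "\<exists>C. \<forall>x::real^'n. norm x ^ k * norm (complex_of_real (exp (- (t * (norm x)\<^sup>2)))) \<le> C"
    by blast
qed measurable

text \<open>Differentiating the Fourier transform of a Gaussian produces the factor \<open>z $ i\<close> under the integral.\<close>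

lemma gaussian_moment:
  fixes y :: "real^'n::finite"
  assumes t: "0 < t"
  shows "(\<integral>z. of_real (z $ i * exp (- (t * (norm z)\<^sup>2))) * wave z y \<partial>lborel)
    = of_real pi * \<i> * of_real (y $ i / t * heat_kernel t y)"
proof -
  let ?e = "\<lambda>z::real^'n. complex_of_real (exp (- (t * (norm z)\<^sup>2)))"
  have ife: "inverse_fourier ?e = (\<lambda>y. of_real (heat_kernel t y))"
    by (rule ext) (simp add: inverse_fourier_wave has_bochner_integral_integral_eq[OF gaussian_fourier[OF t]])
  have "((\<lambda>y. complex_of_real (heat_kernel t y)) has_derivative
      (\<lambda>h. of_real (heat_kernel t y * (- (pi\<^sup>2 * (2 * (y \<bullet> h)) / t))))) (at y)"
    unfolding heat_kernel_def power2_norm_eq_inner using t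
    by (auto intro!: derivative_eq_intros simp: inner_commute algebra_simps)
  from partial_eqI[OF this, of i]
  have "partial i (inverse_fourier ?e) y = of_real (heat_kernel t y * (- (pi\<^sup>2 * (2 * (y $ i)) / t)))"
    unfolding ife by (simp add: inner_axis)
  moreover have "partial i (inverse_fourier ?e) y = 2 * of_real pi * \<i> * (\<integral>z. of_real (z $ i * exp (- (t * (norm z)\<^sup>2))) * wave z y \<partial>lborel)"
    unfolding partial_inverse_fourier[OF all_moments_gaussian[OF t]] inverse_fourier_wave
    by (simp add: partial_symbol_def wave_commute[of y] mult.assoc mult.left_commute flip: integral_mult_right_zero)
  ultimately have eq: "2 * of_real pi * \<i> * (\<integral>z. of_real (z $ i * exp (- (t * (norm z)\<^sup>2))) * wave z y \<partial>lborel)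
     = of_real (heat_kernel t y * (- (pi\<^sup>2 * (2 * (y $ i)) / t)))" by simp
  have "2 * of_real pi * \<i> * (of_real pi * \<i> * X) = 2 * of_real pi * of_real pi * X * (\<i> * \<i>)" for X
    by (simp only: mult_ac)
  hence "of_real (heat_kernel t y * (- (pi\<^sup>2 * (2 * (y $ i)) / t)))
      = 2 * of_real pi * \<i> * (of_real pi * \<i> * of_real (y $ i / t * heat_kernel t y))"
    by (simp add: power2_eq_square mult_ac)
  from trans[OF eq this] show ?thesis
    by (simp only: mult_cancel_left) simp
qed

text \<open>The Fourier multiplier of \<open>(-\<Delta>)^(m/2)\<close>. Natural powers are used, so \<open>laplacian_symbol 0\<close> is \<open>1\<close>
also at the origin.\<close>

definition laplacian_symbol :: "nat \<Rightarrow> real^'n::finite \<Rightarrow> complex" where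
  "laplacian_symbol m y = of_real ((2 * pi * norm y) ^ m)"

lemma laplacian_symbol_measurable [measurable]: "laplacian_symbol m \<in> borel_measurable borel"
  unfolding laplacian_symbol_def[abs_def] by measurable

lemma all_moments_laplacian_symbol:
  assumes "all_moments f"
  shows "all_moments (\<lambda>y. laplacian_symbol m y * f y)"
  by (rule all_moments_mult[OF assms laplacian_symbol_measurable, where C="(2 * pi) ^ m" and n=m])
     (simp add: laplacian_symbol_def norm_mult norm_power power_mult_distrib)

text \<open>For \<open>m = 0\<close> this is Fourier inversion, the power \<open>0\<close> of the Laplacian being the identity by
definition.\<close>

lemma frac_neg_laplacian_eq:
  fixes f :: "real^'n::finite \<Rightarrow> complex"
  assumes f: "f \<in> schwartz"
  shows "frac_neg_laplacian (real m / 2) f = inverse_fourier (\<lambda>y. laplacian_symbol m y * fourier f y)"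
proof (cases "m = 0")
  case True
  then show ?thesis by (simp add: frac_neg_laplacian_def laplacian_symbol_def fourier_inversion[OF f])
next
  case False
  have "of_real ((2 * pi) powr real m) * (of_real (norm y powr real m) * fourier f y) = laplacian_symbol m y * fourier f y" for y
  proof -
    have "(2 * pi) powr real m = (2 * pi) ^ m" by (rule powr_realpow) simp
    moreover have "norm y powr real m = norm y ^ m"
      using False by (cases "y = 0") (auto simp: powr_realpow)
    ultimately show ?thesis by (simp add: laplacian_symbol_def power_mult_distrib)
  qed
  hence e: "(\<lambda>y. of_real ((2 * pi) powr real m) * (of_real (norm y powr real m) * fourier f y)) = (\<lambda>y. laplacian_symbol m y * fourier f y)"
    by (rule ext)
  have "frac_neg_laplacian (real m / 2) f x
      = inverse_fourier (\<lambda>y. of_real ((2 * pi) powr real m) * (of_real (norm y powr real m) * fourier f y)) x" for x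
    unfolding inverse_fourier_cmult using False by (simp add: frac_neg_laplacian_def)
  then show ?thesis unfolding e by (rule ext)
qed

text \<open>Subordination turns the \<open>j\<close>-th component of the unit field at \<open>x\<close> into Gaussian moments. For each time
the pairing is carried to the frequency side by \<open>gaussian_moment\<close>, where it becomes an integral against
\<open>t^(-3/2)\<close> times the heat kernel in \<open>y\<close>. Integrating over time first gives \<open>|y|^(-d - 1)\<close>; with
\<open>|y|^(d - 1)\<close> from the symbol and two factors \<open>y $ j\<close>, one from the gradient and one from the moment, only
the factor \<open>(y $ j)\<^sup>2 / |y|\<^sup>2\<close>, homogeneous of degree zero, survives.\<close>

lemma radial_integral:
  fixes f :: "real^'n::finite \<Rightarrow> complex" and x :: "real^'n" and j :: 'n
  assumes f: "f \<in> schwartz"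
  defines "G \<equiv> inverse_fourier (\<lambda>y. partial_symbol j y * (laplacian_symbol (CARD('n) - 1) y * fourier f y))"
  assumes G: "integrable lborel G"
  shows "(\<integral>z. of_real ((z - x) $ j / norm (z - x)) * G z \<partial>lborel) =
    - of_real (2 ^ CARD('n) * pi powr ((real CARD('n) - 1) / 2) * Gamma ((real CARD('n) + 1) / 2)) *
      (\<integral>y. of_real ((y $ j)\<^sup>2 / (norm y)\<^sup>2) * fourier f y * wave x y \<partial>lborel)"
proof -
  define d where "d = CARD('n)"
  have d: "d > 0" by (simp add: d_def)
  let ?I = "\<lambda>t::real. indicator {0<..} t :: real"
  define M where "M y = laplacian_symbol (d - 1) y * fourier f y" for y :: "real^'n"
  define mu where "mu y = partial_symbol j y * M y" for y
  have rf: "all_moments (fourier f)" by (rule all_moments_fourier[OF f])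
  have rM: "all_moments M" unfolding M_def by (rule all_moments_laplacian_symbol[OF rf])
  have rmu: "all_moments mu" unfolding mu_def by (rule all_moments_partial_symbol[OF rM])
  note [measurable] = all_moments_measurable[OF rf] all_moments_measurable[OF rM] all_moments_measurable[OF rmu]
  have [measurable]: "G \<in> borel_measurable borel"
    using borel_measurable_integrable[OF G] by simp
  have Gif: "G = inverse_fourier mu" by (simp add: G_def mu_def[abs_def] M_def d_def)
  define a where "a z = of_real ((z - x) $ j) * G z" for z
  define k where "k z t = ?I t * (t powr (-1/2) * exp (- (t * (norm (z - x))\<^sup>2)))" for z t
  have am[measurable]: "a \<in> borel_measurable borel"
    unfolding a_def[abs_def] vector_minus_component by measurable
  have le: "\<bar>(z - x) $ j / norm (z - x)\<bar> \<le> 1" for z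
    using component_le_norm_cart[of "z - x" j] by (cases "z = x") (auto simp: divide_le_eq)
  have s1: "(\<integral>z. a z * of_real (sqrt pi / norm (z - x)) \<partial>lborel) = (\<integral>t. (\<integral>z. a z * of_real (k z t) \<partial>lborel) \<partial>lborel)"
  proof (rule integral_swap_kernel[OF sigma_finite_lborel sigma_finite_lborel])
    show "(\<lambda>(z, t). k z t) \<in> borel_measurable (lborel \<Otimes>\<^sub>M lborel)"
      unfolding k_def by measurable
    show "0 \<le> k z t" for z t by (simp add: k_def)
    show "has_bochner_integral lborel (k z) (sqrt pi / norm (z - x))" if "a z \<noteq> 0" for z
    proof -
      have "norm (z - x) > 0" using that by (auto simp: a_def)
      from has_bochner_integral_inverse_sqrt_exp[OF this] show ?thesis
        unfolding k_def[abs_def] .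
    qed
    show "integrable lborel (\<lambda>z. a z * of_real (sqrt pi / norm (z - x)))"
    proof (rule Bochner_Integration.integrable_bound[OF integrable_mult_right[OF G, of "of_real (sqrt pi)"]])
      show "AE z in lborel. norm (a z * of_real (sqrt pi / norm (z - x))) \<le> norm (of_real (sqrt pi) * G z)"
      proof (intro always_eventually allI)
        fix z
        have eq: "a z * of_real (sqrt pi / norm (z - x)) = of_real (sqrt pi * ((z - x) $ j / norm (z - x))) * G z"
          by (simp add: a_def)
        have "norm (a z * of_real (sqrt pi / norm (z - x))) = sqrt pi * \<bar>(z - x) $ j / norm (z - x)\<bar> * norm (G z)"
          unfolding eq norm_mult norm_of_real by (simp only: abs_mult abs_of_nonneg[OF real_sqrt_ge_zero[OF pi_ge_zero]])
        also have "\<dots> \<le> sqrt pi * 1 * norm (G z)"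
          by (intro mult_right_mono mult_left_mono le) auto
        finally show "norm (a z * of_real (sqrt pi / norm (z - x))) \<le> norm (of_real (sqrt pi) * G z)"
          by (simp add: norm_mult)
      qed
    qed measurable
  qed measurable
  define b where "b y = of_real ((y $ j)\<^sup>2) * M y * wave x y" for y
  have bm[measurable]: "b \<in> borel_measurable borel" unfolding b_def by measurable
  \<comment> \<open>\<open>t^(-1/2)\<close> from subordination and \<open>t^(-1)\<close> from the moment give the power \<open>-3/2\<close>.\<close>
  define q where "q y t = ?I t * (t powr (-3/2) * heat_kernel t y)" for y :: "real^'n" and t
  have s2: "(\<integral>z. a z * of_real (k z t) \<partial>lborel) = - of_real (2 * pi\<^sup>2) * (\<integral>y. b y * of_real (q y t) \<partial>lborel)" for t
  proof (cases "t > 0")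
    case t: True
    let ?g = "\<lambda>z. complex_of_real ((z - x) $ j * exp (- (t * (norm (z - x))\<^sup>2)))"
    have gi0: "integrable lborel (\<lambda>z::real^'n. complex_of_real (z $ j * exp (- (t * (norm z)\<^sup>2))))"
    proof -
      have "integrable lborel (\<lambda>z::real^'n. complex_of_real (z $ j) * of_real (exp (- (t * (norm z)\<^sup>2))))"
        by (rule all_moments_integrable_mult[OF all_moments_gaussian[OF t], where C=1 and n=1]) (auto simp: component_le_norm_cart)
      then show ?thesis by simp
    qed
    have gi: "integrable lborel ?g"
      using integrable_lborel_affine[of 1, OF _ gi0, of "- x"] by (simp add: add.commute)
    have in_z: "(\<integral>z. ?g z * wave z y \<partial>lborel) = wave x y * (of_real pi * \<i> * of_real (y $ j / t * heat_kernel t y))" for y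
    proof -
      have gm: "(\<lambda>z. ?g z * wave z y) \<in> borel_measurable borel"
        unfolding vector_minus_component by measurable
      have "(\<integral>z. ?g z * wave z y \<partial>lborel) = (\<integral>z. ?g (x + 1 *\<^sub>R z) * wave (x + 1 *\<^sub>R z) y \<partial>lborel)"
        by (subst integral_lborel_affine[OF _ gm, of 1 x]) simp_all
      also have "\<dots> = (\<integral>z. wave x y * (of_real (z $ j * exp (- (t * (norm z)\<^sup>2))) * wave z y) \<partial>lborel)"
        by (simp add: wave_add mult_ac)
      also have "\<dots> = wave x y * (of_real pi * \<i> * of_real (y $ j / t * heat_kernel t y))"
        unfolding integral_mult_right_zero gaussian_moment[OF t] ..
      finally show ?thesis .
    qed
    have "(\<integral>z. ?g z * G z \<partial>lborel) = (\<integral>z. ?g z * (\<integral>y. mu y * wave z y \<partial>lborel) \<partial>lborel)"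
      by (simp add: Gif inverse_fourier_wave)
    also have "\<dots> = (\<integral>y. mu y * (\<integral>z. ?g z * wave z y \<partial>lborel) \<partial>lborel)"
      by (rule integral_swap_bounded(1)[OF sigma_finite_lborel sigma_finite_lborel gi all_moments_integrable[OF rmu]])
         (unfold split_beta', (rule wave_measurable; simp), simp)
    also have "\<dots> = (\<integral>y. - of_real (2 * pi\<^sup>2) * (b y * of_real (heat_kernel t y / t)) \<partial>lborel)"
      unfolding in_z
      by (intro Bochner_Integration.integral_cong refl)
         (simp add: mu_def partial_symbol_def b_def power2_eq_square mult_ac)
    finally have A: "(\<integral>z. ?g z * G z \<partial>lborel) = - of_real (2 * pi\<^sup>2) * (\<integral>y. b y * of_real (heat_kernel t y / t) \<partial>lborel)"
      unfolding integral_mult_right_zero .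
    have l: "a z * of_real (k z t) = of_real (t powr (-1/2)) * (?g z * G z)" for z
      using t by (simp add: a_def k_def mult_ac)
    have p: "t powr (-3/2) = t powr (-1/2) / t"
      using powr_diff[of t "-1/2" 1] t by simp
    have r: "b y * of_real (q y t) = of_real (t powr (-1/2)) * (b y * of_real (heat_kernel t y / t))" for y
      unfolding q_def p using t by simp
    show ?thesis
      unfolding l r integral_mult_right_zero A by simp
  qed (simp add: k_def q_def)
  define c where "c = sqrt pi ^ d * Gamma ((real d + 1) / 2)"
  have bval: "b y * of_real (c / (pi * norm y) ^ (d + 1)) = of_real (2 ^ (d - 1) * c / pi\<^sup>2) *
      (of_real ((y $ j)\<^sup>2 / (norm y)\<^sup>2) * fourier f y * wave x y)" for y
  proof (cases "y = 0")
    case False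
    then have ny: "norm y \<noteq> 0" by simp
    have "(y $ j)\<^sup>2 * (2 * pi * norm y) ^ (d - 1) * (c / (pi * norm y) ^ (d + 1))
      = 2 ^ (d - 1) * c / pi\<^sup>2 * ((y $ j)\<^sup>2 / (norm y)\<^sup>2)"
    proof -
      have e: "(pi * norm y) ^ (d + 1) = (pi * norm y) ^ (d - 1) * (pi\<^sup>2 * (norm y)\<^sup>2)"
        using d by (simp add: power_mult_distrib[symmetric] power_add[symmetric])
      have e2: "(2 * pi * norm y) ^ (d - 1) = 2 ^ (d - 1) * (pi * norm y) ^ (d - 1)"
        by (simp add: power_mult_distrib mult.assoc)
      have e3: "(pi * norm y) ^ (d - 1) \<noteq> 0" using ny by simp
      show ?thesis unfolding e e2 using e3 ny by simp
    qed
    from arg_cong[OF this, of complex_of_real] show ?thesis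
      by (simp add: b_def M_def laplacian_symbol_def mult_ac del: of_real_power)
  qed (simp add: b_def)
  have y2: "\<bar>(y $ j)\<^sup>2 / (norm y)\<^sup>2\<bar> \<le> 1" for y :: "real^'n"
    using power_mono[OF component_le_norm_cart[of y j], of 2] by (cases "y = 0") (auto simp: divide_le_eq)
  have s3: "(\<integral>y. b y * of_real (c / (pi * norm y) ^ (d + 1)) \<partial>lborel) = (\<integral>t. (\<integral>y. b y * of_real (q y t) \<partial>lborel) \<partial>lborel)"
  proof (rule integral_swap_kernel[OF sigma_finite_lborel sigma_finite_lborel])
    show "(\<lambda>(y, t). q y t) \<in> borel_measurable (lborel \<Otimes>\<^sub>M lborel)"
      unfolding q_def heat_kernel_def by measurable
    show "0 \<le> q y t" for y t by (cases "t > 0") (simp_all add: q_def heat_kernel_nonneg)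
    show "has_bochner_integral lborel (q y) (c / (pi * norm y) ^ (d + 1))" if "b y \<noteq> 0" for y
    proof -
      have "y \<noteq> 0" using that by (auto simp: b_def)
      from heat_kernel_time_integral[OF this] show ?thesis
        unfolding q_def[abs_def] c_def d_def .
    qed
    show "integrable lborel (\<lambda>y. b y * of_real (c / (pi * norm y) ^ (d + 1)))"
      unfolding bval
    proof (rule integrable_mult_right, rule Bochner_Integration.integrable_bound[OF all_moments_integrable[OF rf]])
      show "AE y in lborel. norm (of_real ((y $ j)\<^sup>2 / (norm y)\<^sup>2) * fourier f y * wave x y) \<le> norm (fourier f y)"
      proof (intro always_eventually allI)
        fix y
        show "norm (of_real ((y $ j)\<^sup>2 / (norm y)\<^sup>2) * fourier f y * wave x y) \<le> norm (fourier f y)"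
          unfolding norm_mult norm_of_real norm_wave mult_1_right
          by (rule mult_left_le_one_le[OF norm_ge_zero abs_ge_zero y2])
      qed
    qed measurable
  qed measurable
  have "of_real (sqrt pi) * (\<integral>z. of_real ((z - x) $ j / norm (z - x)) * G z \<partial>lborel)
      = (\<integral>z. a z * of_real (sqrt pi / norm (z - x)) \<partial>lborel)"
    unfolding integral_mult_right_zero[symmetric]
    by (intro Bochner_Integration.integral_cong refl) (simp add: a_def)
  also have "\<dots> = - of_real (2 * pi\<^sup>2) * (\<integral>y. b y * of_real (c / (pi * norm y) ^ (d + 1)) \<partial>lborel)"
    unfolding s1 s2 s3 integral_mult_right_zero ..
  also have "\<dots> = - of_real (2 * pi\<^sup>2 * (2 ^ (d - 1) * c / pi\<^sup>2)) * (\<integral>y. of_real ((y $ j)\<^sup>2 / (norm y)\<^sup>2) * fourier f y * wave x y \<partial>lborel)"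
    unfolding bval integral_mult_right_zero by (simp only: of_real_mult mult.assoc mult_minus_left)
  also have "2 * pi\<^sup>2 * (2 ^ (d - 1) * c / pi\<^sup>2) = sqrt pi * (2 ^ d * pi powr ((real d - 1) / 2) * Gamma ((real d + 1) / 2))"
  proof -
    have "sqrt pi ^ d = sqrt pi * pi powr ((real d - 1) / 2)"
    proof -
      have "sqrt pi ^ d = pi powr (real d / 2)"
        by (simp add: powr_powr flip: powr_half_sqrt powr_realpow)
      also have "real d / 2 = 1/2 + (real d - 1) / 2" by (simp add: field_simps)
      also have "pi powr (1/2 + (real d - 1) / 2) = pi powr (1/2) * pi powr ((real d - 1) / 2)"
        by (rule powr_add)
      also have "pi powr (1/2) = sqrt pi" by (simp add: powr_half_sqrt)
      finally show ?thesis .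
    qed
    moreover have "(2::real) ^ d = 2 * 2 ^ (d - 1)" using d by (cases d) auto
    ultimately show ?thesis by (simp add: c_def)
  qed
  finally have "of_real (sqrt pi) * (\<integral>z. of_real ((z - x) $ j / norm (z - x)) * G z \<partial>lborel)
    = of_real (sqrt pi) * (- of_real (2 ^ d * pi powr ((real d - 1) / 2) * Gamma ((real d + 1) / 2)) *
      (\<integral>y. of_real ((y $ j)\<^sup>2 / (norm y)\<^sup>2) * fourier f y * wave x y \<partial>lborel))"
    by (simp only: of_real_mult mult.assoc mult_minus_left mult_minus_right)
  moreover have "complex_of_real (sqrt pi) \<noteq> 0" by simp
  ultimately show ?thesis
    unfolding d_def by (simp only: mult_cancel_left) simp
qed

section \<open>Symbols of test functions with half decay\<close>

text \<open>Symbols for which the duality between distributions and test functions of half decay can be computed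
on the frequency side. The class is closed under sums and under multiplication by \<open>partial_symbol\<close>, and so under even
powers of the Laplacian symbol, and it contains \<open>fourier f\<close> and \<open>|y|\<close> times \<open>fourier f\<close> for Schwartz
functions \<open>f\<close>; these cover all powers \<open>(-\<Delta>)^(m/2)\<close>.\<close>

definition half_symbol :: "(real^'n::finite \<Rightarrow> complex) \<Rightarrow> bool" where
  "half_symbol m \<longleftrightarrow> all_moments m \<and> inverse_fourier m \<in> schwartz_half"

lemma half_symbol_all_moments: "half_symbol m \<Longrightarrow> all_moments m" by (simp add: half_symbol_def)
lemma half_symbol_half: "half_symbol m \<Longrightarrow> inverse_fourier m \<in> schwartz_half" by (simp add: half_symbol_def)

lemma half_symbolI:
  assumes "all_moments m" "\<And>is. \<exists>C. \<forall>x. norm (inverse_fourier (\<lambda>y. prod_list (map (\<lambda>i. partial_symbol i y) is) * m y) x) \<le> C * decay_weight x"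
  shows "half_symbol m"
  using assms partials_inverse_fourier[OF assms(1)] smooth_inverse_fourier[OF assms(1)] by (simp add: half_symbol_def schwartz_half_iff)

lemma half_symbol_bound:
  assumes "half_symbol m"
  shows "\<exists>C. \<forall>x. norm (inverse_fourier (\<lambda>y. prod_list (map (\<lambda>i. partial_symbol i y) is) * m y) x) \<le> C * decay_weight x"
  using half_symbol_half[OF assms] partials_inverse_fourier[OF half_symbol_all_moments[OF assms]] unfolding schwartz_half_iff by metis

lemma half_symbol_partial_symbol: "half_symbol m \<Longrightarrow> half_symbol (\<lambda>y. partial_symbol i y * m y)"
  using test_space_partial[OF half_symbol_half, of m i] by (simp add: half_symbol_def partial_inverse_fourier all_moments_partial_symbol)

lemma all_moments_sum:
  assumes "finite I" "\<And>i. i \<in> I \<Longrightarrow> all_moments (m i)"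
  shows "all_moments (\<lambda>y. \<Sum>i\<in>I. m i y)"
  unfolding all_moments_def
proof safe
  have [measurable]: "m i \<in> borel_measurable borel" if "i \<in> I" for i
    using all_moments_measurable[OF assms(2)[OF that]] .
  show ms[measurable]: "(\<lambda>y. \<Sum>i\<in>I. m i y) \<in> borel_measurable borel" by measurable
  fix k
  have int: "integrable lborel (\<lambda>y. \<Sum>i\<in>I. norm y ^ k * norm (m i y))"
    by (rule Bochner_Integration.integrable_sum) (rule all_moments_moment[OF assms(2)])
  show "integrable lborel (\<lambda>y. norm y ^ k * norm (\<Sum>i\<in>I. m i y))"
  proof (rule Bochner_Integration.integrable_bound[OF int])
    show "AE y in lborel. norm (norm y ^ k * norm (\<Sum>i\<in>I. m i y)) \<le> norm (\<Sum>i\<in>I. norm y ^ k * norm (m i y))"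
    proof (intro always_eventually allI)
      fix y
      have "norm y ^ k * norm (\<Sum>i\<in>I. m i y) \<le> norm y ^ k * (\<Sum>i\<in>I. norm (m i y))"
        by (intro mult_left_mono norm_sum) simp
      then show "norm (norm y ^ k * norm (\<Sum>i\<in>I. m i y)) \<le> norm (\<Sum>i\<in>I. norm y ^ k * norm (m i y))"
        by (simp add: sum_distrib_left sum_nonneg)
    qed
  qed measurable
qed

lemma half_symbol_sum:
  fixes m :: "'i \<Rightarrow> real^'n::finite \<Rightarrow> complex"
  assumes I: "finite I" and m: "\<And>i. i \<in> I \<Longrightarrow> half_symbol (m i)"
  shows "half_symbol (\<lambda>y. \<Sum>i\<in>I. m i y)"
proof (rule half_symbolI)
  show "all_moments (\<lambda>y. \<Sum>i\<in>I. m i y)" by (rule all_moments_sum[OF I half_symbol_all_moments[OF m]])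
  fix "is" :: "'n list"
  let ?p = "\<lambda>y :: real^'n. prod_list (map (\<lambda>i. partial_symbol i y) is)"
  have "\<forall>i\<in>I. \<exists>C. \<forall>x. norm (inverse_fourier (\<lambda>y. ?p y * m i y) x) \<le> C * decay_weight x"
    using half_symbol_bound[OF m] by blast
  then obtain C where C: "\<And>i x. i \<in> I \<Longrightarrow> norm (inverse_fourier (\<lambda>y. ?p y * m i y) x) \<le> C i * decay_weight x"
    unfolding bchoice_iff by blast
  have "norm (inverse_fourier (\<lambda>y. ?p y * (\<Sum>i\<in>I. m i y)) x) \<le> (\<Sum>i\<in>I. C i) * decay_weight x" for x
  proof -
    have "inverse_fourier (\<lambda>y. ?p y * (\<Sum>i\<in>I. m i y)) x = (\<Sum>i\<in>I. inverse_fourier (\<lambda>y. ?p y * m i y) x)"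
      unfolding sum_distrib_left
      by (rule inverse_fourier_sum) (rule all_moments_integrable[OF conjunct1[OF partials_inverse_fourier[OF half_symbol_all_moments[OF m]]]])
    then show ?thesis
      by (simp add: sum_distrib_right sum_norm_le C)
  qed
  then show "\<exists>C. \<forall>x. norm (inverse_fourier (\<lambda>y. ?p y * (\<Sum>i\<in>I. m i y)) x) \<le> C * decay_weight x" by blast
qed

lemma half_symbol_cmult:
  fixes m :: "real^'n::finite \<Rightarrow> complex"
  assumes m: "half_symbol m"
  shows "half_symbol (\<lambda>y. c * m y)"
proof (rule half_symbolI)
  show "all_moments (\<lambda>y. c * m y)"
    by (rule all_moments_mult[OF half_symbol_all_moments[OF m], where C="norm c" and n=0]) auto
  fix "is" :: "'n list"
  let ?p = "\<lambda>y :: real^'n. prod_list (map (\<lambda>i. partial_symbol i y) is)"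
  obtain C where C: "\<And>x. norm (inverse_fourier (\<lambda>y. ?p y * m y) x) \<le> C * decay_weight x"
    using half_symbol_bound[OF m] by blast
  have "norm (inverse_fourier (\<lambda>y. ?p y * (c * m y)) x) \<le> (norm c * C) * decay_weight x" for x
  proof -
    have "inverse_fourier (\<lambda>y. ?p y * (c * m y)) x = c * inverse_fourier (\<lambda>y. ?p y * m y) x"
      unfolding inverse_fourier_cmult[symmetric] by (simp only: mult.left_commute)
    then show ?thesis using mult_left_mono[OF C[of x], of "norm c"] by (simp add: norm_mult mult.assoc)
  qed
  then show "\<exists>C. \<forall>x. norm (inverse_fourier (\<lambda>y. ?p y * (c * m y)) x) \<le> C * decay_weight x" by blast
qed

text \<open>One more application of the Laplacian on the frequency side, as a sum of second derivatives. In this form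
it matches \<open>dist_neg_laplacian\<close>.\<close>

lemma laplacian_symbol_Suc2: "laplacian_symbol (k + 2) y * m = - 1 * (\<Sum>i\<in>UNIV. laplacian_symbol k y * (partial_symbol i y * (partial_symbol i y * m)))"
proof -
  have "(\<Sum>i\<in>UNIV. laplacian_symbol k y * (partial_symbol i y * (partial_symbol i y * m))) = laplacian_symbol k y * ((\<Sum>i\<in>UNIV. partial_symbol i y * partial_symbol i y) * m)"
    by (simp add: sum_distrib_left sum_distrib_right mult.assoc)
  moreover have "laplacian_symbol (k + 2) y = laplacian_symbol k y * of_real ((2 * pi * norm y)\<^sup>2)"
    unfolding laplacian_symbol_def power_add of_real_mult ..
  ultimately show ?thesis
    unfolding sum_partial_symbol_sq by simp
qed

lemma half_symbol_laplacian_symbol: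
  assumes "half_symbol m"
  shows "half_symbol (\<lambda>y. laplacian_symbol (2 * k) y * m y)"
  using assms
proof (induction k arbitrary: m)
  case 0
  then show ?case by (simp add: laplacian_symbol_def)
next
  case (Suc k)
  have "half_symbol (\<lambda>y. laplacian_symbol (2 * k) y * (partial_symbol i y * (partial_symbol i y * m y)))" for i
    by (intro Suc.IH half_symbol_partial_symbol Suc.prems)
  hence "half_symbol (\<lambda>y. - 1 * (\<Sum>i\<in>UNIV. laplacian_symbol (2 * k) y * (partial_symbol i y * (partial_symbol i y * m y))))"
    by (intro half_symbol_cmult half_symbol_sum) auto
  moreover have "laplacian_symbol (2 * Suc k) y * m y = - 1 * (\<Sum>i\<in>UNIV. laplacian_symbol (2 * k) y * (partial_symbol i y * (partial_symbol i y * m y)))" for y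
  proof -
    have "2 * Suc k = 2 * k + 2" by simp
    then show ?thesis by (simp only: laplacian_symbol_Suc2)
  qed
  ultimately show ?case by (simp only:)
qed

lemma half_symbol_fourier: "f \<in> schwartz \<Longrightarrow> half_symbol (fourier f)"
  using schwartz_subset_half by (auto simp: half_symbol_def all_moments_fourier fourier_inversion)

text \<open>Partial derivatives of \<open>(-\<Delta>)^(1/2) f\<close> are \<open>(-\<Delta>)^(1/2)\<close> of partial derivatives of \<open>f\<close>, so the decay of all
of them is \<open>half_laplacian_decay\<close>.\<close>

lemma half_symbol_half_laplacian:
  fixes f :: "real^'n::finite \<Rightarrow> complex"
  assumes f: "f \<in> schwartz"
  shows "half_symbol (\<lambda>y. laplacian_symbol 1 y * fourier f y)"
proof (rule half_symbolI)
  show "all_moments (\<lambda>y. laplacian_symbol 1 y * fourier f y)"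
    by (rule all_moments_laplacian_symbol[OF all_moments_fourier[OF f]])
  fix "is" :: "'n list"
  let ?p = "\<lambda>y :: real^'n. prod_list (map (\<lambda>i. partial_symbol i y) is)"
  obtain C where C: "\<And>x. norm (inverse_fourier (\<lambda>y. of_real (norm y) * fourier (partials is f) y) x) \<le> C * decay_weight x"
    using half_laplacian_decay[OF test_space_partials[OF f]] by blast
  have "norm (inverse_fourier (\<lambda>y. ?p y * (laplacian_symbol 1 y * fourier f y)) x) \<le> (2 * pi * C) * decay_weight x" for x
  proof -
    have "?p y * (laplacian_symbol 1 y * fourier f y) = of_real (2 * pi) * (of_real (norm y) * fourier (partials is f) y)" for y
      by (simp add: laplacian_symbol_def fourier_partials[OF f])
    then have "inverse_fourier (\<lambda>y. ?p y * (laplacian_symbol 1 y * fourier f y)) x = of_real (2 * pi) * inverse_fourier (\<lambda>y. of_real (norm y) * fourier (partials is f) y) x"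
      unfolding inverse_fourier_cmult[symmetric] by (simp only:)
    then show ?thesis using mult_left_mono[OF C[of x], of "2 * pi"] by (simp add: norm_mult mult.assoc)
  qed
  then show "\<exists>C. \<forall>x. norm (inverse_fourier (\<lambda>y. ?p y * (laplacian_symbol 1 y * fourier f y)) x) \<le> C * decay_weight x" by blast
qed

text \<open>In odd dimension the power \<open>(d - 1) / 2\<close> of the Laplacian is a natural number; in even dimension it
exceeds one by \<open>1/2\<close>.\<close>

lemma half_symbol_fractional:
  fixes f :: "real^'n::finite \<Rightarrow> complex"
  assumes f: "f \<in> schwartz"
  shows "half_symbol (\<lambda>y. laplacian_symbol (CARD('n) - 1) y * fourier f y)"
proof (cases "odd CARD('n)")
  case True
  then obtain k where "CARD('n) = 2 * k + 1" by (auto elim: oddE)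
  then show ?thesis using half_symbol_laplacian_symbol[OF half_symbol_fourier[OF f], of k] by simp
next
  case False
  then obtain k where "CARD('n) = 2 * k" by (auto elim: evenE)
  moreover have "CARD('n) > 0" by simp
  ultimately obtain l where l: "CARD('n) - 1 = 2 * l + 1" by (cases k) auto
  have "laplacian_symbol (2 * l) y * (laplacian_symbol 1 y * fourier f y) = laplacian_symbol (2 * l + 1) y * fourier f y" for y :: "real^'n"
    by (simp add: laplacian_symbol_def)
  then show ?thesis using half_symbol_laplacian_symbol[OF half_symbol_half_laplacian[OF f], of l] unfolding l by (simp only:)
qed

section \<open>The unit field as a fundamental solution\<close>

text \<open>Summing \<open>radial_integral\<close> over the components, the factors \<open>(y $ j)\<^sup>2 / |y|\<^sup>2\<close> add up to \<open>1\<close> away from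
the origin, and what is left is the inversion integral of \<open>fourier f\<close>.\<close>

lemma fundamental_identity:
  fixes f :: "real^'n::finite \<Rightarrow> complex"
  assumes f: "f \<in> schwartz"
  defines "g \<equiv> inverse_fourier (\<lambda>y. laplacian_symbol (CARD('n) - 1) y * fourier f y)"
  shows "f x = - of_real (gamma_const CARD('n)) *
    (\<Sum>j\<in>UNIV. \<integral>z. of_real ((z - x) $ j / norm (z - x)) * partial j g z \<partial>lborel)"
proof -
  let ?c = "2 ^ CARD('n) * pi powr ((real CARD('n) - 1) / 2) * Gamma ((real CARD('n) + 1) / 2)"
  have gt: "half_symbol (\<lambda>y. laplacian_symbol (CARD('n) - 1) y * fourier f y)" by (rule half_symbol_fractional[OF f])
  have pg: "partial j g = inverse_fourier (\<lambda>y. partial_symbol j y * (laplacian_symbol (CARD('n) - 1) y * fourier f y))" for j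
    unfolding g_def by (rule partial_inverse_fourier[OF half_symbol_all_moments[OF gt]])
  have ig: "integrable lborel (partial j g)" for j
    unfolding g_def by (rule schwartz_half_integrable[OF test_space_partial[OF half_symbol_half[OF gt]]])
  have rf: "all_moments (fourier f)" by (rule all_moments_fourier[OF f])
  note [measurable] = all_moments_measurable[OF rf]
  have r: "(\<integral>z. of_real ((z - x) $ j / norm (z - x)) * partial j g z \<partial>lborel)
     = - of_real ?c * (\<integral>y. of_real ((y $ j)\<^sup>2 / (norm y)\<^sup>2) * fourier f y * wave x y \<partial>lborel)" for j
    unfolding pg by (rule radial_integral[OF f ig[of j, unfolded pg]])
  have int: "integrable lborel (\<lambda>y. of_real ((y $ j)\<^sup>2 / (norm y)\<^sup>2) * fourier f y * wave x y)" for j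
  proof (rule Bochner_Integration.integrable_bound[OF all_moments_integrable[OF rf]])
    show "AE y in lborel. norm (of_real ((y $ j)\<^sup>2 / (norm y)\<^sup>2) * fourier f y * wave x y) \<le> norm (fourier f y)"
    proof (intro always_eventually allI)
      fix y
      have "\<bar>(y $ j)\<^sup>2 / (norm y)\<^sup>2\<bar> \<le> 1"
        using power_mono[OF component_le_norm_cart[of y j], of 2] by (cases "y = 0") (auto simp: divide_le_eq)
      then show "norm (of_real ((y $ j)\<^sup>2 / (norm y)\<^sup>2) * fourier f y * wave x y) \<le> norm (fourier f y)"
        unfolding norm_mult norm_of_real norm_wave mult_1_right
        by (rule mult_left_le_one_le[OF norm_ge_zero abs_ge_zero])
    qed
  qed measurable
  have "(\<Sum>j\<in>UNIV. \<integral>y. of_real ((y $ j)\<^sup>2 / (norm y)\<^sup>2) * fourier f y * wave x y \<partial>lborel)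
     = (\<integral>y. (\<Sum>j\<in>UNIV. of_real ((y $ j)\<^sup>2 / (norm y)\<^sup>2) * fourier f y * wave x y) \<partial>lborel)"
    by (rule Bochner_Integration.integral_sum[symmetric]) (rule int)
  also have "\<dots> = inverse_fourier (fourier f) x"
    unfolding inverse_fourier_wave
  proof (rule integral_cong_AE)
    show "AE y in lborel. (\<Sum>j\<in>UNIV. of_real ((y $ j)\<^sup>2 / (norm y)\<^sup>2) * fourier f y * wave x y) = fourier f y * wave x y"
      using AE_lborel_singleton[of "0 :: real^'n"]
    proof eventually_elim
      case (elim y)
      have "(\<Sum>j\<in>UNIV. (y $ j)\<^sup>2 / (norm y)\<^sup>2) = (\<Sum>j\<in>UNIV. (y $ j)\<^sup>2) / (norm y)\<^sup>2"
        by (rule sum_divide_distrib[symmetric])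
      also have "(\<Sum>j\<in>UNIV. (y $ j)\<^sup>2) = (norm y)\<^sup>2"
        unfolding power2_norm_eq_inner inner_vec_def by (simp add: power2_eq_square)
      finally have "(\<Sum>j\<in>UNIV. (y $ j)\<^sup>2 / (norm y)\<^sup>2) = 1" using elim by simp
      then show ?case by (simp only: sum_distrib_right[symmetric] of_real_sum[symmetric]) simp
    qed
  qed measurable
  also have "\<dots> = f x" by (simp add: fourier_inversion[OF f])
  finally have s: "(\<Sum>j\<in>UNIV. \<integral>y. of_real ((y $ j)\<^sup>2 / (norm y)\<^sup>2) * fourier f y * wave x y \<partial>lborel) = f x" .
  have "gamma_const CARD('n) * ?c = 1"
  proof -
    have "Gamma ((real CARD('n) + 1) / 2) > 0" by (rule Gamma_real_pos) simp
    hence "Gamma ((real CARD('n) + 1) / 2) \<noteq> 0" by (rule less_imp_neq[THEN not_sym])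
    hence "?c \<noteq> 0" by (simp only: mult_eq_0_iff) simp
    then show ?thesis unfolding gamma_const_def by (rule left_inverse)
  qed
  then have "complex_of_real (gamma_const CARD('n)) * of_real ?c = 1"
    by (metis of_real_1 of_real_mult)
  then show ?thesis
    unfolding r sum_distrib_left[symmetric] s by (simp only: minus_mult_minus mult.assoc[symmetric] mult_1_left)
qed

section \<open>The operator on bounded vector fields\<close>

lemma dist_divergence_eq:
  assumes "f \<in> schwartz_half"
  shows "dist_divergence T f = - (\<Sum>j\<in>UNIV. \<integral>x. of_real (T x $ j) * partial j f x \<partial>lborel)"
  using assms test_space_partial[OF assms]
  by (simp add: dist_divergence_def dist_partial_def dist_of_fun_def sum_negf)

lemma bounded_mult_integrable:
  fixes g :: "real^'n::finite \<Rightarrow> complex" and T :: "real^'n \<Rightarrow> real"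
  assumes [measurable]: "T \<in> borel_measurable borel" and b: "\<And>x. \<bar>T x\<bar> \<le> 1" and g: "integrable lborel g"
  shows "integrable lborel (\<lambda>x. of_real (T x) * g x)"
proof (rule Bochner_Integration.integrable_bound[OF g])
  show "AE x in lborel. norm (of_real (T x) * g x) \<le> norm (g x)"
    using b by (auto simp: norm_mult mult_left_le_one_le)
  have [measurable]: "g \<in> borel_measurable borel" using g by auto
  show "(\<lambda>x. of_real (T x) * g x) \<in> borel_measurable lborel" by measurable
qed

text \<open>Linearity along half symbols, where all integrals converge.\<close>

lemma dist_divergence_sum:
  fixes T :: "real^'n::finite \<Rightarrow> real^'n"
  assumes Tm: "\<And>j. (\<lambda>x. T x $ j) \<in> borel_measurable borel" and Tb: "\<And>x j. \<bar>T x $ j\<bar> \<le> 1"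
    and I: "finite I" and m: "\<And>i. i \<in> I \<Longrightarrow> half_symbol (m i)"
  shows "dist_divergence T (inverse_fourier (\<lambda>y. c * (\<Sum>i\<in>I. m i y))) = c * (\<Sum>i\<in>I. dist_divergence T (inverse_fourier (m i)))"
proof -
  have g: "half_symbol (\<lambda>y. c * (\<Sum>i\<in>I. m i y))" by (rule half_symbol_cmult[OF half_symbol_sum[OF I m]])
  have pm: "partial j (inverse_fourier (m i)) \<in> schwartz_half" if "i \<in> I" for i j
    by (rule test_space_partial[OF half_symbol_half[OF m[OF that]]])
  have p: "partial j (inverse_fourier (\<lambda>y. c * (\<Sum>i\<in>I. m i y))) x = c * (\<Sum>i\<in>I. partial j (inverse_fourier (m i)) x)" for j x
  proof -
    have "partial j (inverse_fourier (\<lambda>y. c * (\<Sum>i\<in>I. m i y))) x = inverse_fourier (\<lambda>y. partial_symbol j y * (c * (\<Sum>i\<in>I. m i y))) x"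
      by (simp add: partial_inverse_fourier[OF half_symbol_all_moments[OF g]])
    also have "\<dots> = inverse_fourier (\<lambda>y. c * (\<Sum>i\<in>I. partial_symbol j y * m i y)) x"
      by (simp only: sum_distrib_left mult.left_commute)
    also have "\<dots> = c * (\<Sum>i\<in>I. inverse_fourier (\<lambda>y. partial_symbol j y * m i y) x)"
      unfolding inverse_fourier_cmult by (subst inverse_fourier_sum) (auto intro: all_moments_integrable[OF all_moments_partial_symbol[OF half_symbol_all_moments[OF m]]])
    finally show ?thesis by (simp add: partial_inverse_fourier[OF half_symbol_all_moments[OF m]])
  qed
  have int: "integrable lborel (\<lambda>x. of_real (T x $ j) * partial j (inverse_fourier (m i)) x)" if "i \<in> I" for i j
    by (rule bounded_mult_integrable[OF Tm Tb schwartz_half_integrable[OF pm[OF that]]])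
  have e: "(\<integral>x. of_real (T x $ j) * partial j (inverse_fourier (\<lambda>y. c * (\<Sum>i\<in>I. m i y))) x \<partial>lborel)
     = c * (\<Sum>i\<in>I. \<integral>x. of_real (T x $ j) * partial j (inverse_fourier (m i)) x \<partial>lborel)" for j
  proof -
    have "of_real (T x $ j) * partial j (inverse_fourier (\<lambda>y. c * (\<Sum>i\<in>I. m i y))) x
       = c * (\<Sum>i\<in>I. of_real (T x $ j) * partial j (inverse_fourier (m i)) x)" for x
      unfolding p by (simp only: sum_distrib_left mult.left_commute)
    then show ?thesis using int by simp
  qed
  have "dist_divergence T (inverse_fourier (\<lambda>y. c * (\<Sum>i\<in>I. m i y)))
      = - (\<Sum>j\<in>UNIV. c * (\<Sum>i\<in>I. \<integral>x. of_real (T x $ j) * partial j (inverse_fourier (m i)) x \<partial>lborel))"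
    unfolding dist_divergence_eq[OF half_symbol_half[OF g]] e ..
  also have "\<dots> = c * (\<Sum>i\<in>I. - (\<Sum>j\<in>UNIV. \<integral>x. of_real (T x $ j) * partial j (inverse_fourier (m i)) x \<partial>lborel))"
    unfolding sum_distrib_left[symmetric] by (subst sum.swap) (simp add: sum_negf)
  also have "\<dots> = c * (\<Sum>i\<in>I. dist_divergence T (inverse_fourier (m i)))"
    by (intro arg_cong[where f="\<lambda>z. c * z"] sum.cong refl) (simp add: dist_divergence_eq[OF half_symbol_half[OF m]])
  finally show ?thesis .
qed

text \<open>Each step moves two derivatives from the distribution to the test function, where they multiply the
symbol.\<close>

lemma iterated_neg_laplacian:
  fixes T :: "real^'n::finite \<Rightarrow> real^'n"
  assumes Tm: "\<And>j. (\<lambda>x. T x $ j) \<in> borel_measurable borel" and Tb: "\<And>x j. \<bar>T x $ j\<bar> \<le> 1"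
    and m: "half_symbol m"
  shows "(dist_neg_laplacian ^^ k) (dist_divergence T) (inverse_fourier m) = dist_divergence T (inverse_fourier (\<lambda>y. laplacian_symbol (2 * k) y * m y))"
  using m
proof (induction k arbitrary: m)
  case 0
  then show ?case by (simp add: laplacian_symbol_def)
next
  case (Suc k)
  let ?S = "(dist_neg_laplacian ^^ k) (dist_divergence T)"
  have gi: "half_symbol (\<lambda>y. partial_symbol i y * (partial_symbol i y * m y))" for i
    by (intro half_symbol_partial_symbol Suc.prems)
  have pp: "partial i (partial i (inverse_fourier m)) = inverse_fourier (\<lambda>y. partial_symbol i y * (partial_symbol i y * m y))" for i
    using half_symbol_all_moments[OF Suc.prems] by (simp add: partial_inverse_fourier all_moments_partial_symbol)
  have h: "inverse_fourier m \<in> schwartz_half" "partial i (inverse_fourier m) \<in> schwartz_half" for i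
    using half_symbol_half[OF Suc.prems] test_space_partial by auto
  have "dist_neg_laplacian ?S (inverse_fourier m) = - (\<Sum>i\<in>UNIV. ?S (inverse_fourier (\<lambda>y. partial_symbol i y * (partial_symbol i y * m y))))"
    using h by (simp add: dist_neg_laplacian_def dist_partial_def pp)
  also have "\<dots> = - 1 * (\<Sum>i\<in>UNIV. dist_divergence T (inverse_fourier (\<lambda>y. laplacian_symbol (2 * k) y * (partial_symbol i y * (partial_symbol i y * m y)))))"
    by (simp add: Suc.IH[OF gi])
  also have "\<dots> = dist_divergence T (inverse_fourier (\<lambda>y. - 1 * (\<Sum>i\<in>UNIV. laplacian_symbol (2 * k) y * (partial_symbol i y * (partial_symbol i y * m y)))))"
    by (rule dist_divergence_sum[symmetric, OF Tm Tb]) (auto intro: half_symbol_laplacian_symbol gi)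
  also have "\<dots> = dist_divergence T (inverse_fourier (\<lambda>y. laplacian_symbol (2 * Suc k) y * m y))"
  proof -
    have k: "2 * Suc k = 2 * k + 2" by simp
    show ?thesis unfolding k laplacian_symbol_Suc2 ..
  qed
  finally show ?case by simp
qed

text \<open>In even dimension the factor \<open>(-\<Delta>)^(1/2)\<close> acts first on the test function and leads from Schwartz functions
to functions of half decay; the symbol is the same in both parities.\<close>

lemma L_op_eq:
  fixes T :: "real^'n::finite \<Rightarrow> real^'n"
  assumes Tm: "\<And>j. (\<lambda>x. T x $ j) \<in> borel_measurable borel" and Tb: "\<And>x j. \<bar>T x $ j\<bar> \<le> 1"
    and f: "f \<in> schwartz"
  shows "L_op T f = of_real (gamma_const CARD('n)) * dist_divergence T (inverse_fourier (\<lambda>y. laplacian_symbol (CARD('n) - 1) y * fourier f y))"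
proof (cases "odd CARD('n)")
  case True
  then obtain k where k: "CARD('n) = 2 * k + 1" by (auto elim: oddE)
  have "(dist_neg_laplacian ^^ k) (dist_divergence T) f = dist_divergence T (inverse_fourier (\<lambda>y. laplacian_symbol (2 * k) y * fourier f y))"
    using iterated_neg_laplacian[OF Tm Tb half_symbol_fourier[OF f], of k] by (simp add: fourier_inversion[OF f])
  then show ?thesis
    using True f k by (simp add: L_op_def)
next
  case False
  then obtain k where k: "CARD('n) = 2 * k" by (auto elim: evenE)
  moreover have "CARD('n) > 0" by simp
  ultimately obtain l where l: "CARD('n) = 2 * l + 2" by (cases k) auto
  have fr: "frac_neg_laplacian (1 / 2) f = inverse_fourier (\<lambda>y. laplacian_symbol 1 y * fourier f y)"
    using frac_neg_laplacian_eq[OF f, of 1] by simp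
  have e: "laplacian_symbol (2 * l) y * (laplacian_symbol 1 y * fourier f y) = laplacian_symbol (2 * l + 1) y * fourier f y" for y :: "real^'n"
    by (simp add: laplacian_symbol_def)
  have "(dist_neg_laplacian ^^ l) (dist_divergence T) (frac_neg_laplacian (1 / 2) f)
     = dist_divergence T (inverse_fourier (\<lambda>y. laplacian_symbol (2 * l + 1) y * fourier f y))"
    using iterated_neg_laplacian[OF Tm Tb half_symbol_half_laplacian[OF f], of l] unfolding fr e .
  then show ?thesis
    using False f l by (simp add: L_op_def dist_sqrt_neg_laplacian_def)
qed

lemma L_adjoint_eq:
  fixes f :: "real^'n::finite \<Rightarrow> complex"
  assumes f: "f \<in> schwartz"
  shows "L_adjoint f z $ j = - of_real (gamma_const CARD('n)) * partial j (inverse_fourier (\<lambda>y. laplacian_symbol (CARD('n) - 1) y * fourier f y)) z"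
proof -
  have "(real CARD('n) - 1) / 2 = real (CARD('n) - 1) / 2"
    by (simp add: of_nat_diff Suc_leI)
  then show ?thesis
    unfolding L_adjoint_def by (simp only: frac_neg_laplacian_eq[OF f] vec_lambda_beta)
qed

section \<open>The geometric distribution function\<close>

text \<open>Both orders of the pair occur, since the swap of integrals is used in both directions.\<close>

lemma direction_measurable:
  fixes A B :: "(real^'n::finite) measure"
  assumes "sets A = sets borel" "sets B = sets borel"
  shows "(\<lambda>(z, x). (z - x) $ j / norm (z - x)) \<in> borel_measurable (A \<Otimes>\<^sub>M B)"
    and "(\<lambda>(x, z). (z - x) $ j / norm (z - x)) \<in> borel_measurable (A \<Otimes>\<^sub>M B)"
  unfolding measurable_cong_sets[OF sets_pair_measure_cong[OF assms] refl] vector_minus_component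
  by measurable

text \<open>At \<open>z = x\<close> the quotient is \<open>0 / 0 = 0\<close>, which accounts for the indicator in the definition.\<close>

lemma geometric_cdf_component:
  fixes P :: "(real^'n::finite) measure"
  assumes P: "prob_space P" and sP: "sets P = sets borel"
  shows "geometric_cdf P z $ j = (\<integral>x. (z - x) $ j / norm (z - x) \<partial>P)"
    and "\<bar>geometric_cdf P z $ j\<bar> \<le> 1"
    and "(\<lambda>z. geometric_cdf P z $ j) \<in> borel_measurable borel"
proof -
  interpret prob_space P by fact
  note [measurable_cong] = sP
  let ?v = "\<lambda>z x. (z - x) /\<^sub>R norm (z - x)"
  have e: "of_bool (x \<noteq> z) *\<^sub>R ?v z x = ?v z x" for x z :: "real^'n" by simp
  have n1: "norm (?v z x) \<le> 1" for z x :: "real^'n" by (cases "z = x") simp_all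
  have vi: "integrable P (?v z)" for z
    by (rule integrable_const_bound[where B=1]) (use n1 in auto)
  have c: "geometric_cdf P z $ j = (\<integral>x. (z - x) $ j / norm (z - x) \<partial>P)" for z
  proof -
    have "geometric_cdf P z $ j = (\<integral>x. ?v z x $ j \<partial>P)"
      unfolding geometric_cdf_def e by (rule integral_bounded_linear[OF bounded_linear_vec_nth vi, symmetric])
    then show ?thesis by (simp add: inverse_eq_divide)
  qed
  then show "geometric_cdf P z $ j = (\<integral>x. (z - x) $ j / norm (z - x) \<partial>P)" .
  have "norm (geometric_cdf P z) \<le> (\<integral>x. norm (?v z x) \<partial>P)"
    unfolding geometric_cdf_def e by (rule integral_norm_bound)
  also have "\<dots> \<le> (\<integral>x. 1 \<partial>P)"
    by (rule integral_mono[OF integrable_norm[OF vi]]) (use n1 in auto)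
  finally have "norm (geometric_cdf P z) \<le> 1" by (simp add: prob_space)
  then show "\<bar>geometric_cdf P z $ j\<bar> \<le> 1"
    using component_le_norm_cart[of "geometric_cdf P z" j] by linarith
  show "(\<lambda>z. geometric_cdf P z $ j) \<in> borel_measurable borel"
    unfolding c by (rule borel_measurable_lebesgue_integral) (rule direction_measurable(1)[OF refl sP])
qed

text \<open>The identity \<open>fundamental_identity\<close> is averaged over \<open>x\<close> with respect to \<open>P\<close>, and the two integrations
are exchanged: the components of the unit field are bounded by \<open>1\<close> and the gradient is integrable.\<close>

lemma expectation_formula:
  fixes P :: "(real^'n::finite) measure" and f :: "real^'n \<Rightarrow> complex"
  assumes P: "prob_space P" and sP: "sets P = sets borel" and f: "f \<in> schwartz"
  defines "g \<equiv> inverse_fourier (\<lambda>y. laplacian_symbol (CARD('n) - 1) y * fourier f y)"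
  shows "integrable lborel (\<lambda>z. of_real (geometric_cdf P z $ j) * partial j g z)"
    and "(\<integral>x. f x \<partial>P) = - of_real (gamma_const CARD('n)) *
      (\<Sum>j\<in>UNIV. \<integral>z. of_real (geometric_cdf P z $ j) * partial j g z \<partial>lborel)"
proof -
  interpret prob_space P by fact
  note [measurable_cong] = sP
  have gt: "half_symbol (\<lambda>y. laplacian_symbol (CARD('n) - 1) y * fourier f y)" by (rule half_symbol_fractional[OF f])
  have ig: "integrable lborel (partial j g)" for j
    unfolding g_def by (rule schwartz_half_integrable[OF test_space_partial[OF half_symbol_half[OF gt]]])
  let ?k = "\<lambda>j x z. complex_of_real ((z - x) $ j / norm (z - x))"
  have k1: "norm (?k j x z) \<le> 1" for j and x z :: "real^'n"
    unfolding norm_of_real using component_le_norm_cart[of "z - x" j] by (cases "z = x") (auto simp: divide_le_eq)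
  have i1: "integrable P (\<lambda>x. 1 :: complex)" by simp
  have km: "(\<lambda>(x, z). ?k j x z) \<in> borel_measurable (P \<Otimes>\<^sub>M lborel)" for j
    using measurable_compose[OF direction_measurable(2)[OF sP sets_lborel, of j] borel_measurable_of_real] by (simp only: split_beta')
  have sg: "sigma_finite_measure P" by unfold_locales
  have kF: "(\<integral>x. 1 * ?k j x z \<partial>P) = of_real (geometric_cdf P z $ j)" for j z
    by (simp add: geometric_cdf_component(1)[OF P sP] del: of_real_divide)
  note sw = integral_swap_bounded[OF sg sigma_finite_lborel i1 ig km k1, unfolded kF]
  show "integrable lborel (\<lambda>z. of_real (geometric_cdf P z $ j) * partial j g z)"
    using sw(2)[of j] by (simp only: mult.commute)
  have A: "(\<integral>x. (\<integral>z. ?k j x z * partial j g z \<partial>lborel) \<partial>P) = (\<integral>z. of_real (geometric_cdf P z $ j) * partial j g z \<partial>lborel)" for j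
    using sw(1)[of j] by (simp only: mult_1_left mult.commute)
  have Ai: "integrable P (\<lambda>x. \<integral>z. ?k j x z * partial j g z \<partial>lborel)" for j
  proof -
    have km': "(\<lambda>(z, x). ?k j x z) \<in> borel_measurable (lborel \<Otimes>\<^sub>M P)"
      using measurable_compose[OF direction_measurable(1)[OF sets_lborel sP, of j] borel_measurable_of_real] by (simp only: split_beta')
    have "integrable P (\<lambda>x. 1 * (\<integral>z. partial j g z * ?k j x z \<partial>lborel))"
      by (rule integral_swap_bounded(2)[OF sigma_finite_lborel sg ig i1 km' k1])
    then show ?thesis by (simp only: mult_1_left mult.commute)
  qed
  have "(\<integral>x. f x \<partial>P) = (\<integral>x. - of_real (gamma_const CARD('n)) * (\<Sum>j\<in>UNIV. \<integral>z. ?k j x z * partial j g z \<partial>lborel) \<partial>P)"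
    unfolding g_def by (rule Bochner_Integration.integral_cong[OF refl]) (rule fundamental_identity[OF f])
  also have "\<dots> = - of_real (gamma_const CARD('n)) * (\<Sum>j\<in>UNIV. \<integral>z. of_real (geometric_cdf P z $ j) * partial j g z \<partial>lborel)"
    unfolding integral_mult_right_zero A[symmetric]
    by (subst Bochner_Integration.integral_sum[OF Ai]) simp
  finally show "(\<integral>x. f x \<partial>P) = - of_real (gamma_const CARD('n)) *
      (\<Sum>j\<in>UNIV. \<integral>z. of_real (geometric_cdf P z $ j) * partial j g z \<partial>lborel)" .
qed

section \<open>Measures as tempered distributions\<close>

lemma smooth_has_derivative:
  "smooth f \<Longrightarrow> (partials is f has_derivative frechet_derivative (partials is f) (at x)) (at x)"
  by (simp add: smooth_def frechet_derivative_works[symmetric])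

lemma partials_add:
  assumes "smooth f" "smooth g"
  shows "partials is (\<lambda>x. f x + g x) = (\<lambda>x. partials is f x + partials is g x)"
proof (induction "is")
  case (Cons i "is")
  show ?case
    unfolding partials_Cons Cons.IH
    by (rule ext, subst partial_eqI[OF has_derivative_add[OF smooth_has_derivative[OF assms(1)] smooth_has_derivative[OF assms(2)]]])
       (simp add: partial_def)
qed simp

lemma partials_cmult:
  assumes "smooth f"
  shows "partials is (\<lambda>x. c * f x) = (\<lambda>x. c * partials is f x)"
proof (induction "is")
  case (Cons i "is")
  show ?case
    unfolding partials_Cons Cons.IH
    by (rule ext, subst partial_eqI[OF has_derivative_mult_right[OF smooth_has_derivative[OF assms]]])
       (simp add: partial_def)
qed simp

lemma schwartz_add:
  assumes f: "f \<in> schwartz" and g: "g \<in> schwartz"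
  shows "(\<lambda>x. f x + g x) \<in> schwartz"
proof -
  have sf: "smooth f" and sg: "smooth g" using f g by (auto simp: test_space_def)
  have "smooth (\<lambda>x. f x + g x)"
    using sf sg by (simp add: smooth_def partials_add[OF sf sg])
  moreover have "bdd_above (range (\<lambda>x. w x * norm (partials is (\<lambda>x. f x + g x) x)))"
    if w: "w \<in> schwartz_weights" for w "is"
  proof -
    have w0: "w x \<ge> 0" for x using w by (auto simp: schwartz_weights_def)
    obtain C where C: "\<And>x. w x * norm (partials is f x) \<le> C"
      using test_space_bound[OF test_space_partials[OF f] w] by blast
    obtain D where D: "\<And>x. w x * norm (partials is g x) \<le> D"
      using test_space_bound[OF test_space_partials[OF g] w] by blast
    have "w x * norm (partials is f x + partials is g x) \<le> C + D" for x
      using mult_left_mono[OF norm_triangle_ineq w0[of x], of "partials is f x" "partials is g x"] C[of x] D[of x]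
      by (simp add: distrib_left)
    then show ?thesis by (auto simp: bdd_above_def partials_add[OF sf sg])
  qed
  ultimately show ?thesis by (simp add: test_space_def)
qed

lemma schwartz_cmult:
  assumes f: "f \<in> schwartz"
  shows "(\<lambda>x. c * f x) \<in> schwartz"
proof -
  have sf: "smooth f" using f by (auto simp: test_space_def)
  have "smooth (\<lambda>x. c * f x)"
    using sf by (simp add: smooth_def partials_cmult[OF sf])
  moreover have "bdd_above (range (\<lambda>x. w x * norm (partials is (\<lambda>x. c * f x) x)))"
    if w: "w \<in> schwartz_weights" for w "is"
  proof -
    obtain C where C: "\<And>x. w x * norm (partials is f x) \<le> C"
      using test_space_bound[OF test_space_partials[OF f] w] by blast
    have "w x * norm (c * partials is f x) \<le> norm c * C" for x
      using mult_left_mono[OF C[of x] norm_ge_zero[of c]] by (simp add: norm_mult mult_ac)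
    then show ?thesis unfolding partials_cmult[OF sf] by (auto simp: bdd_above_def simp del: norm_mult)
  qed
  ultimately show ?thesis by (simp add: test_space_def)
qed

lemma schwartz_diff: "f \<in> schwartz \<Longrightarrow> g \<in> schwartz \<Longrightarrow> (\<lambda>x. f x - g x) \<in> schwartz"
  using schwartz_add[OF _ schwartz_cmult[of g "-1"], of f] by simp

text \<open>Integration against a probability measure is bounded by the supremum norm, hence by the seminorm with the
constant weight and no derivatives.\<close>

lemma dist_of_measure_tempered:
  fixes P :: "(real^'n::finite) measure"
  assumes P: "prob_space P" and sP: "sets P = sets borel"
  shows "dist_of_measure P \<in> tempered_distributions"
proof -
  interpret prob_space P by fact
  let ?T = "dist_of_measure P"
  have int: "integrable P f" if f: "f \<in> schwartz" for f
  proof -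
    obtain C where C: "\<And>y. norm (f y) \<le> C" using schwartz_bound[OF f, of 0] by auto
    show ?thesis
      using test_space_measurable[OF f] C by (intro integrable_const_bound[where B=C]) (auto simp: measurable_cong_sets[OF sP refl])
  qed
  have T: "?T f = (\<integral>x. f x \<partial>P)" if "f \<in> schwartz" for f
    using that by (simp add: dist_of_measure_def)
  have ext: "?T \<in> extensional schwartz"
    by (simp add: dist_of_measure_def)
  have add: "?T (\<lambda>x. f x + g x) = ?T f + ?T g" if "f \<in> schwartz" "g \<in> schwartz" for f g
    using that by (simp add: T schwartz_add int)
  have cmult: "?T (\<lambda>x. c * f x) = c * ?T f" if "f \<in> schwartz" for c f
    using that by (simp add: T schwartz_cmult)
  \<comment> \<open>This weight is the constant \<open>2\<close>.\<close>
  define w :: "real^'n \<Rightarrow> real" where "w = (\<lambda>x. 1 + norm x ^ 0)"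
  have w: "w \<in> schwartz_weights" unfolding w_def schwartz_weights_def by (rule rangeI)
  have close: "dist (?T f) (?T g) \<le> weighted_seminorm w [] (\<lambda>x. f x - g x)" if f: "f \<in> schwartz" and g: "g \<in> schwartz" for f g
  proof -
    let ?h = "\<lambda>x. f x - g x"
    let ?s = "weighted_seminorm w [] ?h"
    have h: "?h \<in> schwartz" by (rule schwartz_diff[OF f g])
    obtain C where "\<And>x. w x * norm (?h x) \<le> C"
      using test_space_bound[OF h w] by blast
    then have "bdd_above (range (\<lambda>x. w x * norm (?h x)))"
      by (rule bdd_aboveI2)
    then have le: "w x * norm (?h x) \<le> ?s" for x
      unfolding weighted_seminorm_def partials_Nil by (intro cSUP_upper) auto
    have "norm (?h x) \<le> ?s" for x
    proof -
      have "w x = 2" by (simp add: w_def)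
      from le[of x, unfolded this] show ?thesis using norm_ge_zero[of "?h x"] by linarith
    qed
    then have "(\<integral>x. norm (?h x) \<partial>P) \<le> (\<integral>x. ?s \<partial>P)"
      by (intro integral_mono integrable_norm int h) auto
    moreover have "norm (\<integral>x. ?h x \<partial>P) \<le> (\<integral>x. norm (?h x) \<partial>P)"
      by (rule integral_norm_bound)
    moreover have "(\<integral>x. ?h x \<partial>P) = ?T f - ?T g"
      using int f g by (simp add: T)
    ultimately show ?thesis by (simp add: dist_norm prob_space)
  qed
  have cont: "continuous_map (test_topology schwartz_weights) euclidean ?T"
    unfolding continuous_map_def
  proof (intro conjI allI impI)
    let ?X = "test_topology schwartz_weights :: (real^'n \<Rightarrow> complex) topology"
    have top: "topspace ?X \<subseteq> schwartz"
      unfolding test_topology_def topology_generated_by_topspace by auto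
    fix U assume "openin euclidean (U :: complex set)"
    then have U: "open U" by simp
    show "openin ?X {f \<in> topspace ?X. ?T f \<in> U}"
    proof (subst openin_subopen, intro ballI)
      fix g assume g': "g \<in> {f \<in> topspace ?X. ?T f \<in> U}"
      then have g: "g \<in> schwartz" "?T g \<in> U" using top by auto
      obtain e where e: "e > 0" "\<And>z. dist z (?T g) < e \<Longrightarrow> z \<in> U"
        using U g(2) unfolding open_dist by blast
      define V where "V = {f \<in> schwartz. weighted_seminorm w [] (\<lambda>x. f x - g x) < e}"
      have V: "openin ?X V"
        unfolding test_topology_def by (rule topology_generated_by_Basis) 
          (unfold V_def, rule CollectI, rule exI[of _ w], rule exI[of _ "[]"], rule exI[of _ g],
            rule exI[of _ e], intro conjI refl w g(1) e(1))
      have "g \<in> V" using g e by (simp add: V_def weighted_seminorm_def)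
      moreover have "V \<subseteq> {f \<in> topspace ?X. ?T f \<in> U}"
      proof
        fix f assume f: "f \<in> V"
        then have "f \<in> topspace ?X" using V openin_subset by blast
        moreover have "dist (?T f) (?T g) < e"
          using close[of f g] f g by (auto simp: V_def)
        ultimately show "f \<in> {f \<in> topspace ?X. ?T f \<in> U}" using e(2) by simp
      qed
      ultimately show "\<exists>V. openin ?X V \<and> g \<in> V \<and> V \<subseteq> {f \<in> topspace ?X. ?T f \<in> U}"
        using V by blast
    qed
  qed simp
  show ?thesis
    unfolding test_dual_def using ext add cmult cont by blast
qed

section \<open>Recovering the measure\<close>

theorem theorem3p2:
  fixes P :: "(real^'n::finite) measure"
    and M :: "'b measure"
    and Z :: "'b \<Rightarrow> real^'n"
  assumes "prob_space P" and "sets P = sets borel"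
    and "prob_space M" and "Z \<in> M \<rightarrow>\<^sub>M borel" and "distr M borel Z = P"
  shows "dist_of_measure P \<in> tempered_distributions \<and>
         L_op (geometric_cdf P) \<in> tempered_distributions \<and>
         dist_of_measure P = L_op (geometric_cdf P) \<and>
         (\<forall>\<psi>\<in>schwartz.
           integrable lborel
             (\<lambda>z. \<Sum>i\<in>UNIV. of_real (geometric_cdf P z $ i) * L_adjoint \<psi> z $ i) \<and>
           prob_space.expectation M (\<lambda>\<omega>. \<psi> (Z \<omega>)) =
             (\<integral>z. (\<Sum>i\<in>UNIV. of_real (geometric_cdf P z $ i) * L_adjoint \<psi> z $ i) \<partial>lborel))"
proof -
  note P = assms(1,2)
  let ?F = "geometric_cdf P"
  let ?g = "\<lambda>\<psi>. inverse_fourier (\<lambda>y. laplacian_symbol (CARD('n) - 1) y * fourier \<psi> y)"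
  let ?c = "- complex_of_real (gamma_const CARD('n))"
  have L: "L_op ?F \<psi> = (\<integral>x. \<psi> x \<partial>P)" if \<psi>: "\<psi> \<in> schwartz" for \<psi>
  proof -
    have "L_op ?F \<psi> = of_real (gamma_const CARD('n)) * dist_divergence ?F (?g \<psi>)"
      by (rule L_op_eq[OF geometric_cdf_component(3)[OF P] geometric_cdf_component(2)[OF P] \<psi>])
    also have "\<dots> = ?c * (\<Sum>j\<in>UNIV. \<integral>z. of_real (?F z $ j) * partial j (?g \<psi>) z \<partial>lborel)"
      unfolding dist_divergence_eq[OF half_symbol_half[OF half_symbol_fractional[OF \<psi>]]] by simp
    also have "\<dots> = (\<integral>x. \<psi> x \<partial>P)"
      by (rule expectation_formula(2)[OF P \<psi>, symmetric])
    finally show ?thesis .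
  qed
  have eq: "dist_of_measure P = L_op ?F"
  proof
    fix \<psi>
    show "dist_of_measure P \<psi> = L_op ?F \<psi>"
    proof (cases "\<psi> \<in> schwartz")
      case True
      then show ?thesis by (simp add: L dist_of_measure_def)
    next
      case False
      then show ?thesis by (simp add: dist_of_measure_def L_op_def)
    qed
  qed
  have "integrable lborel (\<lambda>z. \<Sum>i\<in>UNIV. of_real (?F z $ i) * L_adjoint \<psi> z $ i) \<and>
     prob_space.expectation M (\<lambda>\<omega>. \<psi> (Z \<omega>)) = (\<integral>z. (\<Sum>i\<in>UNIV. of_real (?F z $ i) * L_adjoint \<psi> z $ i) \<partial>lborel)"
    if \<psi>: "\<psi> \<in> schwartz" for \<psi>
  proof -
    have e: "of_real (?F z $ i) * L_adjoint \<psi> z $ i = ?c * (of_real (?F z $ i) * partial i (?g \<psi>) z)" for z i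
      unfolding L_adjoint_eq[OF \<psi>] by simp
    have int: "integrable lborel (\<lambda>z. of_real (?F z $ i) * partial i (?g \<psi>) z)" for i
      by (rule expectation_formula(1)[OF P \<psi>])
    have "prob_space.expectation M (\<lambda>\<omega>. \<psi> (Z \<omega>)) = (\<integral>x. \<psi> x \<partial>P)"
      unfolding assms(5)[symmetric]
      by (rule integral_distr[OF assms(4) test_space_measurable[OF \<psi>], symmetric])
    also have "\<dots> = ?c * (\<Sum>i\<in>UNIV. \<integral>z. of_real (?F z $ i) * partial i (?g \<psi>) z \<partial>lborel)"
      by (rule expectation_formula(2)[OF P \<psi>])
    also have "\<dots> = (\<integral>z. ?c * (\<Sum>i\<in>UNIV. of_real (?F z $ i) * partial i (?g \<psi>) z) \<partial>lborel)"
      unfolding integral_mult_right_zero by (subst Bochner_Integration.integral_sum[OF int]) simp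
    finally have "prob_space.expectation M (\<lambda>\<omega>. \<psi> (Z \<omega>)) =
      (\<integral>z. (\<Sum>i\<in>UNIV. of_real (?F z $ i) * L_adjoint \<psi> z $ i) \<partial>lborel)"
      unfolding e sum_distrib_left[symmetric] .
    moreover have "integrable lborel (\<lambda>z. \<Sum>i\<in>UNIV. of_real (?F z $ i) * L_adjoint \<psi> z $ i)"
      unfolding e by (rule Bochner_Integration.integrable_sum) (rule integrable_mult_right[OF int])
    ultimately show ?thesis by blast
  qed
  then show ?thesis
    using dist_of_measure_tempered[OF P] eq by simp
qed

end
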